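(* Let $n$ be an even positive integer. Then the path $P_n$ is determined by its Hermitian spectrum (DHS) if and only if $n\notin\{8,14\}$.
   Context: A mixed graph has undirected edges and directed edges (ordered pairs $(x,y)$). For vertices $v_1,\dots,v_n$, its Hermitian adjacency matrix $H(X)$ has $(j,k)$ entry $1$ if $v_jv_k$ is an undirected edge, $i$ if $(v_j,v_k)$ is a directed edge, $-i$ if $(v_k,v_j)$ is a directed edge, $0$ otherwise; $\mathrm{Spec}_H(X)$ is its multiset of eigenvalues. Mixed graphs $X,Y$ on the same vertex set are switching equivalent if $H(X)=D^{-1}H(Y)D$ for a diagonal $D$ with diagonal entries in $\{\pm1,\pm i\}$. A mixed graph $X$ is DHS if every mixed graph $Y$ with $\mathrm{Spec}_H(Y)=\mathrm{Spec}_H(X)$ is switching equivalent to a mixed graph isomorphic to $X$. $P_n$ is the path on $n$ vertices with all edges undirected. *)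

theory Defs
  imports "Jordan_Normal_Form.Char_Poly"
begin

record 'a mixed_graph =
  verts :: "'a set"
  edges :: "'a set set"
  arcs :: "('a \<times> 'a) set"

text \<open>
  Mixed graphs are finite and have no loops, and two vertices are joined in at most one
  way: by an undirected edge or by one arc. This is what makes the entries of the Hermitian
  adjacency matrix well defined.
\<close>

definition mixed_graph :: "'a mixed_graph \<Rightarrow> bool" where
  "mixed_graph X \<longleftrightarrow>
     finite (verts X) \<and>
     (\<forall>e\<in>edges X. \<exists>x\<in>verts X. \<exists>y\<in>verts X. x \<noteq> y \<and> e = {x, y}) \<and>
     (\<forall>(x, y)\<in>arcs X. x \<in> verts X \<and> y \<in> verts X \<and> x \<noteq> y \<and>
        (y, x) \<notin> arcs X \<and> {x, y} \<notin> edges X)"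

definition herm_entry :: "'a mixed_graph \<Rightarrow> 'a \<Rightarrow> 'a \<Rightarrow> complex" where
  "herm_entry X x y =
     (if {x, y} \<in> edges X then 1
      else if (x, y) \<in> arcs X then \<i>
      else if (y, x) \<in> arcs X then - \<i>
      else 0)"

text \<open>
  The vertices are listed in increasing order. Any other listing conjugates the matrix by a
  permutation matrix, so spectrum and switching equivalence do not depend on this choice.
\<close>

definition herm_mat :: "'a::linorder mixed_graph \<Rightarrow> complex mat" where
  "herm_mat X =
     (let vs = sorted_list_of_set (verts X); n = card (verts X)
      in mat n n (\<lambda>(j, k). herm_entry X (vs ! j) (vs ! k)))"

definition herm_spec :: "'a::linorder mixed_graph \<Rightarrow> complex multiset" where
  "herm_spec X = proots (char_poly (herm_mat X))"

text \<open>
  The third and fourth arguments of \<^const>\<open>similar_mat_wit\<close> are inverse to each other, so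
  the last conjunct below says that the matrix of \<open>X\<close> is \<open>inverse D * herm_mat Y * D\<close>.
\<close>

definition switching_equivalent :: "'a::linorder mixed_graph \<Rightarrow> 'a mixed_graph \<Rightarrow> bool" where
  "switching_equivalent X Y \<longleftrightarrow>
     verts X = verts Y \<and>
     (\<exists>D D'. diagonal_mat D \<and> set (diag_mat D) \<subseteq> {1, - 1, \<i>, - \<i>} \<and>
        similar_mat_wit (herm_mat X) (herm_mat Y) D' D)"

definition isomorphic :: "'a mixed_graph \<Rightarrow> 'b mixed_graph \<Rightarrow> bool" where
  "isomorphic X Y \<longleftrightarrow>
     (\<exists>f. bij_betw f (verts X) (verts Y) \<and>
        (\<forall>x\<in>verts X. \<forall>y\<in>verts X.
           ({f x, f y} \<in> edges Y \<longleftrightarrow> {x, y} \<in> edges X) \<and>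
           ((f x, f y) \<in> arcs Y \<longleftrightarrow> (x, y) \<in> arcs X)))"

text \<open>
  Quantifying over graphs with vertices in the type of the vertices of \<open>X\<close> loses nothing:
  a graph with the spectrum of \<open>X\<close> has as many vertices as \<open>X\<close>, hence is isomorphic to a
  graph on the vertex set of \<open>X\<close>.
\<close>

definition DHS :: "'a::linorder mixed_graph \<Rightarrow> bool" where
  "DHS X \<longleftrightarrow>
     (\<forall>Y :: 'a mixed_graph. mixed_graph Y \<and> herm_spec Y = herm_spec X \<longrightarrow>
        (\<exists>Z. mixed_graph Z \<and> isomorphic Z X \<and> switching_equivalent Y Z))"

definition path_graph :: "nat \<Rightarrow> nat mixed_graph" where
  "path_graph n = \<lparr>verts = {0..<n}, edges = {{i, Suc i} | i. Suc i < n}, arcs = {}\<rparr>"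

end

theory Submission
  imports Defs
begin

text \<open>
  Let \<open>Y\<close> have the spectrum of the path and Hermitian matrix \<open>H\<close>. The eigenvalues are distinct,
  lie in \<open>(-2, 2)\<close>, and \<open>U_n (H / 2) = 0\<close> where the Chebyshev polynomial \<open>U_n (x / 2)\<close> has integer
  coefficients and constant term \<open>\<plusminus>1\<close> because \<open>n\<close> is even. Hence \<open>4 - H^2\<close> is a positive definite
  form over the Gaussian integers, and \<open>H\<close> is invertible modulo every Gaussian prime.

  Positivity bounds all degrees by 3 and makes the cubic vertices orthonormal for this form. Norms of
  vectors can be reduced step by step knowing inner products only modulo \<open>1 + i\<close>, that is, knowing
  only the underlying graph. Together with invertibility modulo \<open>1 + i\<close>, 3 and 5 this leaves just six
  possible components containing a pair of vertices with two common neighbours (a 4-cycle), each with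
  6 or 8 vertices. Comparing the traces of \<open>H^2\<close> and \<open>H^4\<close> with those of the path, twice the number
  of cubic vertices equals the number of ordered pairs with two common neighbours, which rules out two
  of the six graphs and all cubic vertices outside them. So every other component has maximum
  degree 2, and it is a path since a cycle is singular modulo \<open>1 + i\<close>.

  Finally, look at the component that carries an eigenvector of \<open>2 cos (\<pi> / (n + 1))\<close>. A path component
  must have all \<open>n\<close> vertices, and then \<open>Y\<close> is switching equivalent to the path. On the four remaining
  graphs the eigenvalue equations force \<open>n + 1 = 9\<close>, 24 or 15. For \<open>n = 8\<close> and \<open>n = 14\<close> these graphs,
  together with paths on 2 and on 2 and 4 vertices, do give cospectral mates.
\<close>

text \<open>Since only the spectrum of \<open>Y\<close> is given, both its shape and its arc
  directions are unknown. Parity separates the two: all nonzero entries of \<open>H\<close> are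
  units, hence 1 modulo \<open>1 + i\<close>, and 4 is even, so inner products under
  \<open>4 - H^2\<close> modulo \<open>1 + i\<close> see only numbers of common neighbours. An odd
  Gaussian integer has modulus at least 1; so projecting off a vector of norm at most 1 lowers the
  norm by at least 1 whenever the inner product is odd. Reaching norm 0 with an odd coordinate left
  is the contradiction.

  The primes 3 and 5 cover what this calculus misses: a cubic vertex with no odd partner is an
  eigenvector of \<open>H^2\<close> for 3, and a cubic vertex paired only with one vertex of degree
  2 spans with it an invariant plane of determinant 3 times 2 minus 1.

  The largest eigenvalue is the useful one because a path on \<open>m\<close> vertices has it only
  if \<open>sin ((m + 1) pi / (n + 1)) = 0\<close>, which fails for \<open>m < n\<close>. On the
  exceptional graphs \<open>H^2\<close> preserves the two colour classes and is a matrix of size 3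
  or 4 on one of them. Its phases cancel, so the polynomial satisfied by \<open>l^2\<close> depends
  on the graph alone; at \<open>l^2 = 2 + 2 cos (2 pi / (n + 1))\<close> it determines the
  angle.\<close>

section \<open>Graphs with a norm calculus modulo two\<close>

text \<open>
  Adjacency lists. Vertices 0, 1, 2, 3 form a 4-cycle in this order; vertices 4 and 5 are the third
  neighbours of the cubic vertices 0 and 1.
\<close>

definition graph6 :: "nat list list" where
  "graph6 = [[1,3,4],[0,2,5],[1,3],[0,2],[0],[1]]"
definition graph8a :: "nat list list" where
  "graph8a = [[1,3,4],[0,2,5],[1,3],[0,2],[0],[1,6],[5,7],[6]]"
definition graph8b :: "nat list list" where
  "graph8b = [[1,3,4],[0,2,5],[1,3],[0,2],[0,6],[1,7],[4,7],[5,6]]"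
definition graph8c :: "nat list list" where
  "graph8c = [[1,3,4],[0,2,5],[1,3,6],[0,2],[0,5,7],[1,4],[2],[4]]"
definition graph8d :: "nat list list" where
  "graph8d = [[1,3,4],[0,2,5],[1,3,6],[0,2],[0,7],[1],[2],[4]]"
definition graph8e :: "nat list list" where
  "graph8e = [[1,3,4],[0,2,5],[1,3,6],[0,2,7],[0],[1],[2],[3]]"

text \<open>
  In the application, \<open>nrm xs k\<close> says that some vector of Gaussian integers has norm at most \<open>k\<close> with
  respect to \<open>4 - H^2\<close> and is odd exactly at the vertices occurring an odd number of times in \<open>xs\<close>.
  The number of common neighbours is the inner product of two vertices modulo \<open>1 + i\<close>, so
  \<open>nrm_reduce\<close> is the orthogonal projection away from a vector of norm 1.
\<close>

locale binary_norm_graph =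
  fixes V :: "'a set" and N :: "'a \<Rightarrow> 'a set" and nrm :: "'a list \<Rightarrow> int \<Rightarrow> bool"
  assumes finite_V: "finite V"
    and N_sub: "N x \<subseteq> V"
    and N_sym: "y \<in> N x \<Longrightarrow> x \<in> N y"
    and N_irrefl: "x \<notin> N x"
    and nrm_single: "x \<in> V \<Longrightarrow> nrm [x] (4 - int (card (N x)))"
    and nrm_reduce: "nrm xs k \<Longrightarrow> nrm ys 1 \<Longrightarrow>
          odd (\<Sum>x\<leftarrow>xs. \<Sum>y\<leftarrow>ys. card (N x \<inter> N y)) \<Longrightarrow> nrm (xs @ ys) (k - 1)"
    and nrm_pos: "nrm xs k \<Longrightarrow> odd (count_list xs x) \<Longrightarrow> 0 < k"
    and nonsingular: "S \<subseteq> V \<Longrightarrow> S \<noteq> {} \<Longrightarrow> \<exists>x. odd (card (N x \<inter> S))"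
begin

lemma finite_N [simp]: "finite (N x)"
  using finite_V N_sub finite_subset by blast

lemma in_V: "y \<in> N x \<Longrightarrow> x \<in> V" "y \<in> N x \<Longrightarrow> y \<in> V"
  using N_sub N_sym by blast+

lemma card_in_V: "card (N x) = Suc m \<Longrightarrow> x \<in> V"
  using in_V(1) by (metis card.empty ex_in_conv nat.distinct(1))

lemma N_sym_iff: "y \<in> N x \<longleftrightarrow> x \<in> N y"
  using N_sym by blast

lemma N_empty: assumes "x \<in> V" shows "N x \<noteq> {}"
proof -
  obtain y where "odd (card (N y \<inter> {x}))" using nonsingular[of "{x}"] assms by auto
  then have "x \<in> N y" by (cases "x \<in> N y") auto
  then show ?thesis using N_sym by blast
qed

text \<open>The basis vector at \<open>x\<close> has norm \<open>4 - card (N x)\<close>, which must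
  be positive.\<close>

lemma card_N_le: "card (N x) \<le> 3"
proof (cases "x \<in> V")
  case True
  then show ?thesis using nrm_pos[OF nrm_single[OF True], of x] by simp
next
  case False
  then have "N x = {}" using in_V by blast
  then show ?thesis by simp
qed

text \<open>The indicator of \<open>{x,y}\<close> would be a kernel vector modulo
  \<open>1 + i\<close>: every vertex sees both or neither.\<close>

lemma no_twins: assumes "x \<noteq> y" "x \<in> V" "N x = N y" shows False
proof -
  have "y \<in> V" using assms N_empty in_V by blast
  obtain z where z: "odd (card (N z \<inter> {x,y}))" using nonsingular[of "{x,y}"] assms \<open>y \<in> V\<close> by auto
  have "x \<in> N z \<longleftrightarrow> y \<in> N z" using assms N_sym_iff by blast
  then have "N z \<inter> {x,y} = {} \<or> N z \<inter> {x,y} = {x,y}" by auto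
  then show False using z assms(1) by auto
qed

lemma nrm_cubic: "card (N x) = 3 \<Longrightarrow> nrm [x] 1"
  using nrm_single[of x] card_in_V[of x 2] by simp

lemma nrm_card2: "card (N x) = 2 \<Longrightarrow> nrm [x] 2"
  using nrm_single[of x] card_in_V[of x 1] by simp

lemma nrm_card1: "card (N x) = 1 \<Longrightarrow> nrm [x] 3"
  using nrm_single[of x] card_in_V[of x 0] by simp

text \<open>Two vectors of norm 1 with odd inner product would project to norm 0, although the
  result is odd at \<open>x\<close>.\<close>

lemma even_cubic: assumes "card (N x) = 3" "card (N y) = 3" "x \<noteq> y" shows "even (card (N x \<inter> N y))"
proof (rule ccontr)
  assume "odd (card (N x \<inter> N y))"
  then have "nrm ([x] @ [y]) (1 - 1)" by (intro nrm_reduce nrm_cubic assms) simp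
  then show False using nrm_pos[of "[x,y]" 0 x] assms(3) by simp
qed

text \<open>After \<open>x\<close> is projected off \<open>y\<close>, the inner product with
  \<open>z\<close> is still odd because that of \<open>y\<close> and \<open>z\<close> is even. So
  norm 2 would drop twice, to 0.\<close>

lemma no_two_partners:
  assumes "card (N x) = 2" "card (N y) = 3" "card (N z) = 3" "x \<noteq> y" "x \<noteq> z" "y \<noteq> z"
    "odd (card (N x \<inter> N y))" "odd (card (N x \<inter> N z))"
  shows False
proof -
  have "nrm ([x] @ [y]) (2 - 1)" using assms by (intro nrm_reduce nrm_cubic nrm_card2) simp_all
  then have "nrm ([x,y] @ [z]) (1 - 1)"
    using assms even_cubic[OF assms(2,3,6)] by (intro nrm_reduce nrm_cubic) simp_all
  then show False using nrm_pos[of "[x,y,z]" 0 x] assms by simp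
qed

text \<open>A checkable form of \<open>nonsingular\<close>: a vertex without neighbours in
  \<open>S\<close> sees 0 of it, so for an explicit \<open>S\<close> only finitely many named
  vertices remain.\<close>

lemma no_kernel: assumes "S \<subseteq> V" "S \<noteq> {}" "\<And>x. x \<in> \<Union>(N ` S) \<Longrightarrow> even (card (N x \<inter> S))" shows False
proof -
  obtain x where x: "odd (card (N x \<inter> S))" using nonsingular assms by blast
  then have "N x \<inter> S \<noteq> {}" by auto
  then have "x \<in> \<Union>(N ` S)" using N_sym by blast
  then show False using assms x by blast
qed

lemma card_N_cases: "x \<in> V \<Longrightarrow> card (N x) = 1 \<or> card (N x) = 2 \<or> card (N x) = 3"
  using card_N_le[of x] N_empty[of x] card_0_eq[of "N x"] by (auto simp del: card_0_eq)

lemma N1: "y \<in> N x \<Longrightarrow> card (N x) = 1 \<Longrightarrow> N x = {y}"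
  by (metis card_1_singletonE singletonD)

lemma N2: assumes "{y,z} \<subseteq> N x" "y \<noteq> z" "card (N x) = 2" shows "N x = {y,z}"
  using card_subset_eq[of "N x" "{y,z}"] assms by simp

lemma N2_ex: assumes "y \<in> N x" "card (N x) = 2" obtains z where "N x = {y,z}" "z \<noteq> y" "z \<noteq> x"
proof -
  have "card (N x - {y}) = 1" using assms by simp
  then obtain z where "N x - {y} = {z}" by (meson card_1_singletonE)
  moreover from this have "N x = insert y {z}" using insert_Diff[OF assms(1)] by simp
  ultimately show ?thesis using that[of z] N_irrefl[of x] by auto
qed

lemma N3_ex: assumes "{y,z} \<subseteq> N x" "y \<noteq> z" "card (N x) = 3"
  obtains t where "N x = {y,z,t}" "t \<noteq> y" "t \<noteq> z" "t \<noteq> x"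
proof -
  have "card (N x - {y,z}) = 1" using assms by (simp add: card_Diff_subset)
  then obtain t where "N x - {y,z} = {t}" by (meson card_1_singletonE)
  moreover have "N x = {y,z} \<union> (N x - {y,z})" using assms(1) by blast
  ultimately have "N x = {y,z,t}" "t \<in> N x - {y,z}" by auto
  then show ?thesis using that[of t] N_irrefl[of x] by auto
qed

lemma N3: assumes "{y,z,t} \<subseteq> N x" "y \<noteq> z" "y \<noteq> t" "z \<noteq> t" shows "N x = {y,z,t}"
  using card_seteq[of "N x" "{y,z,t}"] assms card_N_le[of x] by simp

end

text \<open>
  The two assumptions reflect that \<open>H\<close> is invertible modulo 3 and modulo 5: otherwise \<open>H^2 e = 3 e\<close>,
  or \<open>H^4 e = 5 (H^2 e - e)\<close>, for the basis vector \<open>e\<close> of \<open>x\<close>.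
\<close>

locale parity_graph = binary_norm_graph +
  assumes cubic_partner: "card (N x) = 3 \<Longrightarrow> \<exists>y. y \<noteq> x \<and> odd (card (N x \<inter> N y))"
    and cubic_partner_not_exclusive: "card (N x) = 3 \<Longrightarrow> card (N y) = 2 \<Longrightarrow>
          odd (card (N x \<inter> N y)) \<Longrightarrow>
          \<exists>z. z \<noteq> x \<and> z \<noteq> y \<and> (odd (card (N x \<inter> N z)) \<or> odd (card (N y \<inter> N z)))"
begin

text \<open>An odd number of common neighbours is nonzero, so odd partners lie two steps away. This
  turns the conditions coming from 3 and 5 into the finite checks \<open>no_even_cubic\<close> and
  \<open>no_exclusive\<close>.\<close>

lemma partner_near: "odd (card (N x \<inter> N y)) \<Longrightarrow> y \<in> \<Union>(N ` N x)"
  using N_sym by (metis UN_I card.empty disjoint_iff even_zero)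

lemma no_even_cubic:
  assumes "card (N x) = 3" "\<And>y. y \<in> \<Union>(N ` N x) \<Longrightarrow> y \<noteq> x \<Longrightarrow> even (card (N x \<inter> N y))"
  shows False
  using cubic_partner[OF assms(1)] assms(2) partner_near by blast

lemma no_exclusive:
  assumes "card (N x) = 3" "card (N y) = 2" "odd (card (N x \<inter> N y))"
    "\<And>z. z \<in> \<Union>(N ` N x) \<Longrightarrow> z \<noteq> x \<Longrightarrow> z \<noteq> y \<Longrightarrow> even (card (N x \<inter> N z))"
    "\<And>z. z \<in> \<Union>(N ` N y) \<Longrightarrow> z \<noteq> x \<Longrightarrow> z \<noteq> y \<Longrightarrow> even (card (N y \<inter> N z))"
  shows False
proof -
  obtain z where z: "z \<noteq> x" "z \<noteq> y" and "odd (card (N x \<inter> N z)) \<or> odd (card (N y \<inter> N z))"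
    using cubic_partner_not_exclusive[OF assms(1-3)] by blast
  from this(3) show False
  proof
    assume *: "odd (card (N x \<inter> N z))"
    show False using assms(4)[OF partner_near[OF *] z] * by simp
  next
    assume *: "odd (card (N y \<inter> N z))"
    show False using assms(5)[OF partner_near[OF *] z] * by simp
  qed
qed

text \<open>The adjacent vertices \<open>v\<close> and \<open>a\<close> are known to be cubic, with
  tails \<open>v'\<close> and \<open>a'\<close> off the cycle. For \<open>u\<close> and
  \<open>b\<close> only inclusions are demanded, since the later case distinction is on their
  degrees, 2 or 3.\<close>

definition square :: "'a \<Rightarrow> 'a \<Rightarrow> 'a \<Rightarrow> 'a \<Rightarrow> 'a \<Rightarrow> 'a \<Rightarrow> bool" where
  "square v a u b v' a' \<longleftrightarrow> N v = {a,b,v'} \<and> N a = {v,u,a'} \<and> {a,b} \<subseteq> N u \<and> {v,u} \<subseteq> N b \<and>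
     distinct [v,a,u,b,v',a']"

lemma square_swap: "square v a u b v' a' \<Longrightarrow> square a v b u a' v'"
  unfolding square_def by auto

lemma squareD:
  assumes "square v a u b v' a'"
  shows "N v = {a,b,v'}" "N a = {v,u,a'}" "distinct [v,a,u,b,v',a']"
  using assms unfolding square_def by auto

text \<open>The adjacent cubic vertices \<open>v\<close> and \<open>a\<close> share an even number
  of neighbours. That excludes a common tail and a single chord. Two chords give the complete graph
  on four vertices, where any two vertices share exactly two neighbours, contrary to
  \<open>no_even_cubic\<close>.\<close>

lemma square_intro:
  assumes "v \<noteq> u" "a \<noteq> b" "{a,b} \<subseteq> N v" "{a,b} \<subseteq> N u" "card (N v) = 3" "card (N a) = 3"
  shows "\<exists>v' a'. square v a u b v' a'"
proof -
  obtain v' where v': "N v = {a,b,v'}" "v' \<noteq> a" "v' \<noteq> b" "v' \<noteq> v"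
    using N3_ex[OF assms(3,2,5)] .
  have sub: "{v,u} \<subseteq> N a" "{v,u} \<subseteq> N b" using assms N_sym by auto
  obtain a' where a': "N a = {v,u,a'}" "a' \<noteq> v" "a' \<noteq> u" "a' \<noteq> a"
    using N3_ex[OF sub(1) assms(1,6)] .
  have d: "v \<noteq> a" "v \<noteq> b" "u \<noteq> a" "u \<noteq> b" using assms sub N_irrefl by auto
  have ev: "even (card (N v \<inter> N a))" using even_cubic[of v a] assms d by auto
  have k: "v' \<noteq> u"
  proof
    assume "v' = u"
    then have Nv: "N v = {a,b,u}" using v' by simp
    have "a' = b"
    proof (rule ccontr)
      assume "a' \<noteq> b"
      then have "N v \<inter> N a = {u}" unfolding Nv a'(1) using d a' assms(1,2) by auto
      then show False using ev by simp
    qed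
    then have Na: "N a = {v,u,b}" using a' by simp
    have Nu: "N u = {v,a,b}" using N3[of v a b u] assms(2,4) d Nv N_sym[of u v] by auto
    have Nb: "N b = {v,u,a}" using N3[of v u a b] assms(1) d sub(2) Na N_sym[of b a] by auto
    show False by (rule no_even_cubic[of v]) (use assms(1,2) d in \<open>auto simp: Nv Na Nu Nb\<close>)
  qed
  have "a' \<noteq> b"
  proof
    assume "a' = b"
    then have "N v \<inter> N a = {b}" unfolding v'(1) a'(1) using v' d assms(1,2) k by auto
    then show False using ev by simp
  qed
  moreover have "v' \<noteq> a'"
  proof
    assume "v' = a'"
    then have "N v \<inter> N a = {a'}" unfolding v'(1) a'(1) using v' d assms(1,2) k by auto
    then show False using ev by simp
  qed
  ultimately show ?thesis using k v' a' d assms(1-4) sub unfolding square_def by auto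
qed

text \<open>Two opposite vertices of degree 2 would be twins. So each opposite pair of the 4-cycle
  contains a cubic vertex, and two such vertices from different pairs are adjacent.\<close>

lemma square_exists:
  assumes "x \<noteq> y" "card (N x \<inter> N y) = 2"
  shows "\<exists>v a u b v' a'. square v a u b v' a' \<and> x \<in> {v,a,u,b}"
proof -
  obtain p q where pq: "N x \<inter> N y = {p,q}" "p \<noteq> q" using assms(2) by (meson card_2_iff)
  then have sub: "{p,q} \<subseteq> N x" "{p,q} \<subseteq> N y" "{x,y} \<subseteq> N p" "{x,y} \<subseteq> N q" using N_sym by auto
  have V: "x \<in> V" "y \<in> V" "p \<in> V" "q \<in> V" using sub in_V by blast+
  have step: "card (N s) = 3 \<or> card (N t) = 3" if "s \<noteq> t" "{c,d} \<subseteq> N s" "{c,d} \<subseteq> N t" "c \<noteq> d" for s t c d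
  proof (rule ccontr)
    assume "\<not> ?thesis"
    moreover have "s \<in> V" "t \<in> V" using that in_V by blast+
    moreover have "card {c,d} \<le> card (N s)" "card {c,d} \<le> card (N t)"
      using that by (auto intro!: card_mono simp del: card_insert_disjoint card_insert_if)
    ultimately have "card (N s) = 2" "card (N t) = 2" using card_N_cases[of s] card_N_cases[of t] that by auto
    then show False using N2 that no_twins[of s t] \<open>s \<in> V\<close> by metis
  qed
  have xy: "card (N x) = 3 \<or> card (N y) = 3" and pq3: "card (N p) = 3 \<or> card (N q) = 3"
    using step[of x y p q] step[of p q x y] sub assms pq by auto
  have *: "\<exists>v a u b v' a'. square v a u b v' a' \<and> {v,u} = {s,t}"
    if "s \<noteq> t" "card (N s) = 3" "{p,q} \<subseteq> N s" "{p,q} \<subseteq> N t" for s t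
    using pq3
  proof
    assume "card (N p) = 3"
    then show ?thesis using square_intro[of s t p q] that pq(2) by blast
  next
    assume "card (N q) = 3"
    then show ?thesis using square_intro[of s t q p] that pq(2) by (metis insert_commute)
  qed
  have "\<exists>v a u b v' a'. square v a u b v' a' \<and> {v,u} = {x,y}"
    using xy
  proof
    assume "card (N x) = 3"
    then show ?thesis using *[of x y] assms(1) sub by blast
  next
    assume "card (N y) = 3"
    then show ?thesis using *[of y x] assms(1) sub by (metis insert_commute)
  qed
  then obtain v a u b v' a' where sq: "square v a u b v' a'" "{v,u} = {x,y}" by blast
  then have "x \<in> {v,a,u,b}" by auto
  then show ?thesis using sq(1) by blast
qed

text \<open>Neighbourhoods are matched by equality, not inclusion, so an embedded connected graph is
  a whole component and not just a subgraph.\<close>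

definition embeds :: "nat list list \<Rightarrow> 'a list \<Rightarrow> bool" where
  "embeds G ws \<longleftrightarrow> distinct ws \<and> list_all2 (\<lambda>x is. N x = (!) ws ` set is) ws G"


section \<open>Squares with exactly two cubic vertices: \<open>u\<close> and \<open>b\<close> have
  degree 2\<close>

lemma square_cubic: assumes "square v a u b v' a'" shows "card (N v) = 3" "card (N a) = 3"
  using assms unfolding square_def by auto

lemma square_tail: assumes "square v a u b v' a'"
  shows "v \<in> N v'" "a \<in> N a'" "v' \<in> V" "a' \<in> V" "a \<notin> N v'" "v \<notin> N a'"
proof -
  have s: "N v = {a,b,v'}" "N a = {v,u,a'}" "distinct [v,a,u,b,v',a']" using assms unfolding square_def by auto
  have "v' \<in> N v" "a' \<in> N a" using s by auto
  then show "v \<in> N v'" "a \<in> N a'" "v' \<in> V" "a' \<in> V" using N_sym in_V by blast+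
  show "a \<notin> N v'" using N_sym[of a v'] s by auto
  show "v \<notin> N a'" using N_sym[of v a'] s by auto
qed

text \<open>If \<open>v'\<close> had degree 2, only \<open>u\<close> and \<open>a'\<close> would be
  two steps from \<open>v\<close>, each sharing two neighbours with it. The third neighbour
  \<open>v''\<close> of \<open>v'\<close> is not cubic because it would share just \<open>v'\<close>
  with the cubic \<open>v\<close>.\<close>

lemma short_square_adjacent_tails_cubic:
  assumes sq: "square v a u b v' a'" and Nu: "N u = {a,b}" and Nb: "N b = {v,u}" and adj: "a' \<in> N v'"
  obtains v'' where "N v' = {v,a',v''}" "v'' \<notin> {v,a,u,b,v',a'}" "card (N v'') \<noteq> 3"
proof -
  note Nv = squareD(1)[OF sq] and Na = squareD(2)[OF sq] and d = squareD(3)[OF sq]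
  note t = square_tail[OF sq]
  have "card (N v') = 3"
  proof (rule ccontr)
    assume *: "card (N v') \<noteq> 3"
    have "card {v,a'} \<le> card (N v')" using t adj by (intro card_mono) auto
    then have "card (N v') = 2" using * card_N_le[of v'] d by auto
    then have Nv': "N v' = {v,a'}" using N2[of v a' v'] t adj d by auto
    have "b \<notin> N a'" using N_sym[of b a'] Nb d by auto
    then have "N v \<inter> N a' = {a,v'}" using Nv t N_sym[OF adj] by auto
    then have e: "even (card (N v \<inter> N a'))" using d by simp
    have "even (card (N v \<inter> N y))" if "y \<in> \<Union>(N ` N v)" "y \<noteq> v" for y
    proof -
      have "y = u \<or> y = a'" using that unfolding Nv by (auto simp: Na Nb Nv')
      then show ?thesis using e d by (auto simp: Nv Nu)
    qed
    then show False using no_even_cubic[OF square_cubic(1)[OF sq]] by blast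
  qed
  then obtain v'' where v'': "N v' = {v,a',v''}" "v'' \<noteq> v" "v'' \<noteq> a'" "v'' \<noteq> v'"
    using N3_ex[of v a' v'] t adj d by auto
  have v'v'': "v' \<in> N v''" using v'' N_sym[of v'' v'] by auto
  then have n: "v'' \<notin> {v,a,u,b,v',a'}" using v'' Nv Na Nu Nb d by auto
  moreover have "card (N v'') \<noteq> 3"
  proof
    assume "card (N v'') = 3"
    then have "even (card (N v'' \<inter> N v))" using even_cubic sq square_cubic n by simp
    moreover have "N v'' \<inter> N v = {v'}"
      using v'v'' n N_sym[of a v''] N_sym[of b v''] unfolding Nv Na Nb by auto
    ultimately show False by simp
  qed
  ultimately show ?thesis using that v'' by blast
qed

text \<open>If \<open>v''\<close> avoids \<open>a''\<close>, it shares just \<open>v'\<close> with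
  each of the cubic vertices \<open>v\<close> and \<open>a'\<close>, one partner too many for norm
  2.\<close>

lemma short_square_adjacent_tails_card2:
  assumes sq: "square v a u b v' a'" and Nu: "N u = {a,b}" and Nb: "N b = {v,u}"
    and Nv': "N v' = {v,a',v''}" and Na': "N a' = {a,v',a''}"
    and n: "v'' \<notin> {v,a,u,b,v',a'}" "a'' \<notin> {v,a,u,b,v',a'}" and c: "card (N v'') = 2"
  shows "N v'' = {v',a''}"
proof -
  note Nv = squareD(1)[OF sq] and Na = squareD(2)[OF sq] and d = squareD(3)[OF sq]
  have "v' \<in> N v''" using Nv' N_sym by auto
  then obtain z where z: "N v'' = {v',z}" "z \<noteq> v'" "z \<noteq> v''" using N2_ex c by metis
  then have "v'' \<in> N z" using N_sym by auto
  then have z2: "z \<notin> {v,a,u,b}" using Nv Na Nu Nb n by auto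
  show ?thesis
  proof (rule ccontr)
    assume "N v'' \<noteq> {v',a''}"
    then have "z \<noteq> a''" using z by auto
    then have i: "N v'' \<inter> N v = {v'}" "N v'' \<inter> N a' = {v'}"
      unfolding z Nv Na' using z z2 d by auto
    have "v'' \<noteq> v" "v'' \<noteq> a'" "v \<noteq> a'" using n d by auto
    moreover have "card (N a') = 3" unfolding Na' using n d by auto
    moreover have "odd (card (N v'' \<inter> N v))" "odd (card (N v'' \<inter> N a'))" by (simp_all add: i)
    ultimately show False
      using no_two_partners[OF c square_cubic(1)[OF sq]] by metis
  qed
qed

lemma short_square_tails_not_adjacent:
  assumes sq: "square v a u b v' a'" and Nu: "N u = {a,b}" and Nb: "N b = {v,u}"
  shows "a' \<notin> N v'"
proof
  assume adj: "a' \<in> N v'"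
  note Nv = squareD(1)[OF sq] and Na = squareD(2)[OF sq] and d = squareD(3)[OF sq]
  have sq2: "square a v b u a' v'" by (rule square_swap[OF sq])
  obtain v'' where v'': "N v' = {v,a',v''}" "v'' \<notin> {v,a,u,b,v',a'}" "card (N v'') \<noteq> 3"
    using short_square_adjacent_tails_cubic[OF sq Nu Nb adj] .
  obtain a'' where a'': "N a' = {a,v',a''}" "a'' \<notin> {a,v,b,u,a',v'}" "card (N a'') \<noteq> 3"
    using short_square_adjacent_tails_cubic[OF sq2 Nb Nu N_sym[OF adj]] .
  have ne: "v'' \<noteq> a''"
  proof
    assume "v'' = a''"
    then have "N v' \<inter> N a' = {v''}" unfolding v'' a'' using v'' a'' d by auto
    moreover have "card (N v') = 3" "card (N a') = 3"
      unfolding v''(1) a''(1) using v''(2) a''(2) d by auto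
    ultimately show False using even_cubic[of v' a'] d by simp
  qed
  have mem: "v' \<in> N v''" "a' \<in> N a''" by (rule N_sym, simp add: v''(1) a''(1))+
  then have V: "v'' \<in> V" "a'' \<in> V" using in_V by blast+
  have 1: "N v'' = {v',a''}" if "card (N v'') = 2"
    by (rule short_square_adjacent_tails_card2[OF sq Nu Nb v''(1) a''(1) v''(2) _ that]) (use a''(2) in auto)
  have 2: "N a'' = {a',v''}" if "card (N a'') = 2"
    by (rule short_square_adjacent_tails_card2[OF sq2 Nb Nu a''(1) v''(1) a''(2) _ that]) (use v''(2) in auto)
  show False
  proof (cases "card (N v'') = 2 \<or> card (N a'') = 2")
    case True
    then have "a'' \<in> N v''" "v'' \<in> N a''" using 1 2 N_sym by blast+
    then have "card (N v'') \<noteq> 1" "card (N a'') \<noteq> 1"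
      using N1[of v' v''] N1[of a' a''] mem v''(2) a''(2) by auto
    then have "card (N v'') = 2" "card (N a'') = 2" using card_N_cases V v''(3) a''(3) by blast+
    then have N2: "N v'' = {v',a''}" "N a'' = {a',v''}" "card (N v'') = 2" using 1 2 by auto
    \<comment> \<open>Here \<open>v\<close> and \<open>v''\<close> share only \<open>v'\<close>, and
      neither has another odd partner; the prime 5 excludes this.\<close>
    show False
      by (rule no_exclusive[OF square_cubic(1)[OF sq] N2(3)])
        (use d v''(2) a''(2) ne in \<open>auto simp: Nv Na Nu Nb v''(1) a''(1) N2(1,2)\<close>)
  next
    case False
    then have c: "card (N v'') = 1" "card (N a'') = 1" using card_N_cases V v''(3) a''(3) by blast+
    then have N1': "N v'' = {v'}" "N a'' = {a'}" using N1 mem by blast+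
    have c3: "card (N a) = 3" "card (N v') = 3" "card (N b) = 2"
      unfolding Na v''(1) Nb using v''(2) d by auto
    note S = Nv Na Nu Nb v''(1) a''(1) N1'
    \<comment> \<open>The leaf \<open>a''\<close> has norm 3 and loses 2 to the orthogonal vectors
      \<open>a\<close> and \<open>v'\<close>; \<open>b\<close> has norm 2 and loses 1 to
      \<open>v'\<close>. The two resulting vectors of norm 1 have an odd inner product.\<close>
    have "nrm ([a''] @ [a]) (3 - 1)"
      by (rule nrm_reduce) (use d v''(2) a''(2) ne in \<open>auto simp add: nrm_card1[OF c(2)] nrm_cubic[OF c3(1)] S\<close>)
    then have "nrm ([a'',a] @ [v']) (2 - 1)"
      by (intro nrm_reduce) (use d v''(2) a''(2) ne in \<open>auto simp add: nrm_cubic[OF c3(2)] S\<close>)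
    moreover have "nrm ([b] @ [v']) (2 - 1)"
      by (rule nrm_reduce) (use d v''(2) a''(2) ne in \<open>auto simp add: nrm_card2[OF c3(3)] nrm_cubic[OF c3(2)] S\<close>)
    ultimately have "nrm ([b,v'] @ [a'',a,v']) (1 - 1)"
      by (intro nrm_reduce) (use d v''(2) a''(2) ne in \<open>auto simp: S\<close>)
    from nrm_pos[OF this, of b] show False using d a''(2) by auto
  qed
qed

text \<open>As the tails are not adjacent, a cubic \<open>v'\<close> would share only
  \<open>v\<close> with the cubic vertex \<open>a\<close>.\<close>

lemma short_square_tail_not_cubic:
  assumes sq: "square v a u b v' a'" and Nu: "N u = {a,b}" and Nb: "N b = {v,u}"
  shows "card (N v') \<noteq> 3"
proof
  assume "card (N v') = 3"
  note Nv = squareD(1)[OF sq] and Na = squareD(2)[OF sq] and d = squareD(3)[OF sq]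
  have "even (card (N v' \<inter> N a))" using even_cubic[OF \<open>card (N v') = 3\<close> square_cubic(2)[OF sq]] d by auto
  moreover have "N v' \<inter> N a = {v}"
    using short_square_tails_not_adjacent[OF sq Nu Nb] square_tail[OF sq] N_sym[of u v'] d
    unfolding Na Nu by auto
  ultimately show False by simp
qed

text \<open>The set \<open>{a,b,a''}\<close> is a kernel vector: its neighbours \<open>v\<close>,
  \<open>u\<close> and \<open>a'\<close> each see exactly two of its members.\<close>

lemma short_square_leaf_kernel:
  assumes sq: "square v a u b v' a'" and Nu: "N u = {a,b}" and Nb: "N b = {v,u}"
    and Na': "N a' = {a,a''}" and Na'': "N a'' = {a'}"
  shows False
proof -
  note Nv = squareD(1)[OF sq] and Na = squareD(2)[OF sq] and d = squareD(3)[OF sq]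
  have "a'' \<notin> {v,a,u,b,v',a'}" using d Nv Na Nu Nb square_tail[OF sq] Na' Na'' by auto
  moreover have "{a,b,a''} \<subseteq> V" using in_V Na Nb Na'' by blast
  ultimately show False
    by (intro no_kernel[of "{a,b,a''}"]) (use d in \<open>auto simp: Nv Na Nu Nb Na' Na''\<close>)
qed


text \<open>The long tail continues through \<open>a''\<close> to \<open>z\<close>. A cubic
  \<open>a''\<close> would share only \<open>a'\<close> with \<open>a\<close>, and a leaf
  \<open>a''\<close> gives a kernel vector. At \<open>z\<close> degree 3 and degree 2 are excluded
  by the vector \<open>[a',v]\<close> of norm 1, so the tail ends there.\<close>

lemma short_square_tails_leaf_card2:
  assumes sq: "square v a u b v' a'" and Nu: "N u = {a,b}" and Nb: "N b = {v,u}"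
    and Nv': "N v' = {v}" and c: "card (N a') = 2"
  shows "\<exists>ws. embeds graph8a ws \<and> {v,a,u,b} \<subseteq> set ws"
proof -
  note Nv = squareD(1)[OF sq] and Na = squareD(2)[OF sq] and d = squareD(3)[OF sq]
  have "a \<in> N a'" by (rule square_tail[OF sq])
  then obtain a'' where a'': "N a' = {a,a''}" "a'' \<noteq> a" "a'' \<noteq> a'" using N2_ex c by metis
  have m: "a' \<in> N a''" by (rule N_sym) (simp add: a'')
  then have n: "a'' \<notin> {v,a,u,b,v',a'}" using d a''(2,3) by (auto simp: Nv Nu Nb Nv')
  have cv: "card (N v) = 3" "card (N a) = 3" and cu: "card (N u) = 2" 
    using square_cubic[OF sq] d by (auto simp: Nu)
  have "card (N a'') \<noteq> 3"
  proof
    assume "card (N a'') = 3"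
    then have "even (card (N a'' \<inter> N a))" using even_cubic[OF _ cv(2)] n by auto
    moreover have "N a'' \<inter> N a = {a'}"
      using m n N_sym[of v a''] N_sym[of u a''] unfolding Na by (auto simp: Nv Nu)
    ultimately show False by simp
  qed
  moreover have "card (N a'') \<noteq> 1"
    using short_square_leaf_kernel[OF sq Nu Nb a''(1)] N1[OF m] by blast
  moreover have "a'' \<in> V" using m in_V by blast
  ultimately have c2: "card (N a'') = 2" using card_N_cases by blast
  then obtain z where z: "N a'' = {a',z}" "z \<noteq> a'" "z \<noteq> a''" using N2_ex m by metis
  have m2: "a'' \<in> N z" by (rule N_sym) (simp add: z)
  then have n2: "z \<notin> {v,a,u,b,v',a',a''}" using n d z(2,3) by (auto simp: Nv Na Nu Nb Nv')
  have V: "z \<in> V" using m2 in_V by blast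
  have i: "a'' \<in> N z" "a \<notin> N z" "b \<notin> N z" "v' \<notin> N z"
    using m2 n2 n N_sym[of a z] N_sym[of b z] N_sym[of v' z] by (auto simp: Na Nb Nv')
  note S = Nv Na Nu Nb Nv' a''(1) z(1)
  have A: "nrm ([a'] @ [v]) (2 - 1)"
    by (rule nrm_reduce) (use d n n2 in \<open>auto intro: nrm_card2[OF c] nrm_cubic[OF cv(1)] simp: S\<close>)
  have "card (N z) \<noteq> 3"
  proof
    assume "card (N z) = 3"
    then have "nrm ([a',v] @ [z]) (1 - 1)"
      using A i n d by (intro nrm_reduce nrm_cubic) (simp_all add: S)
    from nrm_pos[OF this, of v] show False using d n2 by auto
  qed
  moreover have "card (N z) \<noteq> 2"
  proof
    assume z2: "card (N z) = 2"
    have "nrm ([u] @ [a',v]) (2 - 1)"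
      by (rule nrm_reduce) (use A d n n2 in \<open>auto intro: nrm_card2[OF cu] simp: S\<close>)
    moreover have "nrm ([z] @ [a',v]) (2 - 1)"
      by (rule nrm_reduce) (use A i n d in \<open>auto intro: nrm_card2[OF z2] simp: Nv a''(1)\<close>)
    ultimately have "nrm ([z,a',v] @ [u,a',v]) (1 - 1)"
      by (intro nrm_reduce) (use d n n2 i in \<open>auto simp: Nv Nu a''(1)\<close>)
    from nrm_pos[OF this, of z] show False using n2 by auto
  qed
  ultimately have "card (N z) = 1" using card_N_cases[OF V] by blast
  then have "N z = {a''}" using N1 m2 by blast
  then have "embeds graph8a [v,a,u,b,v',a',a'',z]"
    using d n n2 unfolding embeds_def graph8a_def by (auto simp: S)
  then show ?thesis by force
qed

text \<open>Formulated for the side of \<open>v\<close> only, so that \<open>square_swap\<close>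
  yields the other side. The main tool is \<open>[v'',v]\<close>, which has norm 1 if
  \<open>v''\<close> has degree 2: it meets \<open>a\<close> oddly if \<open>v'' = a''\<close>, and
  meets \<open>[a',v]\<close> oddly if \<open>v''\<close> and \<open>a''\<close> are distinct and
  not adjacent.\<close>

lemma short_square_tails_card2_aux:
  assumes sq: "square v a u b v' a'" and Nu: "N u = {a,b}" and Nb: "N b = {v,u}"
    and c: "card (N v') = 2" "card (N a') = 2"
  obtains v'' a'' where "N v' = {v,v''}" "N a' = {a,a''}" "distinct [v,a,u,b,v',a',v'',a'']"
    "card (N v'') = 1 \<or> N v'' = {v',a''}"
proof -
  note Nv = squareD(1)[OF sq] and Na = squareD(2)[OF sq] and d = squareD(3)[OF sq]
  have cv: "card (N v) = 3" "card (N a) = 3" using square_cubic[OF sq] by auto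
  obtain v'' where v'': "N v' = {v,v''}" "v'' \<noteq> v" "v'' \<noteq> v'"
    using N2_ex[OF square_tail(1)[OF sq] c(1)] .
  obtain a'' where a'': "N a' = {a,a''}" "a'' \<noteq> a" "a'' \<noteq> a'"
    using N2_ex[OF square_tail(2)[OF sq] c(2)] .
  have adj: "a' \<noteq> v''" using short_square_tails_not_adjacent[OF sq Nu Nb] v''(1) by auto
  have adj': "v' \<noteq> a''" using short_square_tails_not_adjacent[OF square_swap[OF sq] Nb Nu] a''(1) by auto
  have m: "v' \<in> N v''" "a' \<in> N a''" by (rule N_sym, simp add: v'' a'')+
  have n: "v'' \<notin> {v,a,u,b,v',a'}" "a'' \<notin> {v,a,u,b,v',a'}"
    using m d v''(2,3) a''(2,3) adj adj' by (auto simp: Nv Na Nu Nb)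
  have i: "v' \<in> N v''" "a \<notin> N v''" "b \<notin> N v''"
    using m n N_sym[of a v''] N_sym[of b v''] by (auto simp: Na Nb)
  have V: "v'' \<in> V" using m in_V by blast
  have c3: "card (N v'') \<noteq> 3"
  proof
    assume "card (N v'') = 3"
    then have "even (card (N v'' \<inter> N v))" using even_cubic[OF _ cv(1), of v''] n by simp
    then show False using i d by (simp add: Nv)
  qed
  have B: "nrm ([v''] @ [v]) (2 - 1)" if "card (N v'') = 2"
    by (rule nrm_reduce) (use that i d in \<open>auto intro: nrm_card2 nrm_cubic[OF cv(1)] simp: Nv\<close>)
  have ne: "v'' \<noteq> a''"
  proof
    assume eq: "v'' = a''"
    then have "{v',a'} \<subseteq> N v''" using m by auto
    then have "card {v',a'} \<le> card (N v'')" by (intro card_mono) auto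
    then have c2: "card (N v'') = 2" using c3 card_N_cases[OF V] d by auto
    then have Nv'': "N v'' = {v',a'}" using N2 \<open>{v',a'} \<subseteq> N v''\<close> d by auto
    have "nrm ([v'',v] @ [a]) (1 - 1)"
      by (rule nrm_reduce) (use B[OF c2] d n in \<open>auto intro: nrm_cubic[OF cv(2)] simp: Nv Na Nv''\<close>)
    from nrm_pos[OF this, of a] show False using n d by auto
  qed
  have "N v'' = {v',a''}" if c2: "card (N v'') = 2"
  proof (rule ccontr)
    assume "N v'' \<noteq> {v',a''}"
    then have j: "a'' \<notin> N v''" using N2[of v' a'' v''] m adj' c2 by auto
    have "nrm ([a'] @ [v]) (2 - 1)"
      by (rule nrm_reduce) (use d n ne in \<open>auto intro: nrm_card2[OF c(2)] nrm_cubic[OF cv(1)] simp: Nv a''(1)\<close>)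
    then have "nrm ([v'',v] @ [a',v]) (1 - 1)"
      using B[OF c2] by (intro nrm_reduce) (use d n ne i j in \<open>auto simp: Nv a''(1)\<close>)
    from nrm_pos[OF this, of a'] show False using n d by auto
  qed
  then have "card (N v'') = 1 \<or> N v'' = {v',a''}" using card_N_cases[OF V] c3 by blast
  moreover have "distinct [v,a,u,b,v',a',v'',a'']" using d n ne by auto
  ultimately show ?thesis using that v''(1) a''(1) by blast
qed

text \<open>If \<open>v''\<close> were a leaf, so would be \<open>a''\<close>, which is excluded by
  the kernel vector of \<open>short_square_leaf_kernel\<close>. So \<open>v''\<close> and
  \<open>a''\<close> are joined and close a 6-cycle sharing an edge with the square.\<close>

lemma short_square_tails_card2:
  assumes sq: "square v a u b v' a'" and Nu: "N u = {a,b}" and Nb: "N b = {v,u}"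
    and c: "card (N v') = 2" "card (N a') = 2"
  shows "\<exists>ws. embeds graph8b ws \<and> {v,a,u,b} \<subseteq> set ws"
proof -
  note Nv = squareD(1)[OF sq] and Na = squareD(2)[OF sq]
  obtain v'' a'' where 1: "N v' = {v,v''}" "N a' = {a,a''}" and d: "distinct [v,a,u,b,v',a',v'',a'']"
    and v'': "card (N v'') = 1 \<or> N v'' = {v',a''}"
    using short_square_tails_card2_aux[OF sq Nu Nb c] .
  obtain p q where 2: "N a' = {a,p}" "N v' = {v,q}" and d2: "distinct [a,v,b,u,a',v',p,q]"
    and "card (N p) = 1 \<or> N p = {a',q}"
    using short_square_tails_card2_aux[OF square_swap[OF sq] Nb Nu c(2,1)] .
  moreover have "p = a''" "q = v''" using 1 2 d d2 by (auto simp: doubleton_eq_iff)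
  ultimately have a'': "card (N a'') = 1 \<or> N a'' = {a',v''}" by simp
  have m: "v' \<in> N v''" "a' \<in> N a''" by (rule N_sym, simp add: 1)+
  have "N v'' = {v',a''}"
  proof (rule ccontr)
    assume "\<not> ?thesis"
    then have "N v'' = {v'}" using v'' N1[OF m(1)] by blast
    then have "a'' \<notin> N v''" using d by auto
    then have "N a'' \<noteq> {a',v''}" using N_sym[of v'' a''] by auto
    then have "N a'' = {a'}" using a'' N1[OF m(2)] by blast
    then show False using short_square_leaf_kernel[OF sq Nu Nb 1(2)] by blast
  qed
  moreover from this have "v'' \<in> N a''" using N_sym[of a'' v''] by auto
  then have "N a'' = {a',v''}" using a'' N1[OF m(2)] d by auto
  ultimately have "embeds graph8b [v,a,u,b,v',a',v'',a'']"
    using d unfolding embeds_def graph8b_def by (auto simp: Nv Na Nu Nb 1)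
  then show ?thesis by force
qed

lemma short_square_classify:
  assumes sq: "square v a u b v' a'" and Nu: "N u = {a,b}" and Nb: "N b = {v,u}"
  shows "\<exists>G\<in>{graph6,graph8a,graph8b}. \<exists>ws. embeds G ws \<and> {v,a,u,b} \<subseteq> set ws"
proof -
  note Nv = squareD(1)[OF sq] and Na = squareD(2)[OF sq] and d = squareD(3)[OF sq]
  note sq2 = square_swap[OF sq]
  have "card (N v') = 1 \<or> card (N v') = 2" "card (N a') = 1 \<or> card (N a') = 2"
    using card_N_cases square_tail[OF sq] short_square_tail_not_cubic[OF sq Nu Nb]
      short_square_tail_not_cubic[OF sq2 Nb Nu] by blast+
  then consider "N v' = {v}" "N a' = {a}" | "N v' = {v}" "card (N a') = 2"
    | "N a' = {a}" "card (N v') = 2" | "card (N v') = 2" "card (N a') = 2"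
    using N1 square_tail[OF sq] by blast
  then show ?thesis
  proof cases
    case 1
    then have "embeds graph6 [v,a,u,b,v',a']"
      using d unfolding embeds_def graph6_def by (auto simp: Nv Na Nu Nb)
    then show ?thesis by force
  next
    case 2
    then show ?thesis using short_square_tails_leaf_card2[OF sq Nu Nb] by blast
  next
    case 3
    then show ?thesis using short_square_tails_leaf_card2[OF sq2 Nb Nu] by blast
  next
    case 4
    then show ?thesis using short_square_tails_card2[OF sq Nu Nb] by blast
  qed
qed


section \<open>Kites: squares with exactly three cubic vertices \<open>v\<close>, \<open>a\<close>,
  \<open>u\<close>\<close>

lemma cubic_neighbour:
  assumes "N x = {p,q,r}" "card (N x) = 3" "card (N y) = 3" "p \<in> N y" "x \<noteq> y" "q \<notin> N y"
  shows "r \<in> N y"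
proof (rule ccontr)
  assume "r \<notin> N y"
  then have "N x \<inter> N y = {p}" using assms(4,6) unfolding assms(1) by auto
  then show False using even_cubic[OF assms(2,3,5)] by simp
qed

text \<open>Parity of common neighbours keeps the tail \<open>u'\<close> away from the other two
  tails. The second conclusion is the reflection exchanging \<open>v\<close> and \<open>u\<close>,
  by which statements about \<open>v'\<close> also serve \<open>u'\<close>.\<close>

lemma kite_distinct:
  assumes sq: "square v a u b v' a'" and Nu: "N u = {a,b,u'}" and c: "card (N u) = 3"
  shows "distinct [v,a,u,b,v',a',u']" "square u a v b u' a'"
proof -
  have Nv: "N v = {a,b,v'}" and Na: "N a = {v,u,a'}" and b: "{v,u} \<subseteq> N b" and d: "distinct [v,a,u,b,v',a']"
    using sq unfolding square_def by auto
  note cv = square_cubic[OF sq]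
  have "card {a,b,u'} = 3" using c Nu by simp
  then have 1: "u' \<noteq> a" "u' \<noteq> b" using d by (auto simp: card_insert_if split: if_splits)
  have 2: "u' \<noteq> u" using N_irrefl[of u] Nu by auto
  have 3: "u' \<noteq> v" using N_sym[of v u] Nu Nv d by auto
  have 4: "u' \<noteq> v'"
  proof
    assume "u' = v'"
    then have "N v \<inter> N u = {a,b,v'}" using Nv Nu by auto
    then show False using even_cubic[of v u] cv c d by simp
  qed
  have 5: "u' \<noteq> a'"
  proof
    assume *: "u' = a'"
    have "v \<notin> N u" using 3 d Nu by auto
    then have "N a \<inter> N u = {a'}" unfolding Na Nu using * d 1 2 by auto
    then show False using even_cubic[of a u] cv c d by simp
  qed
  show D: "distinct [v,a,u,b,v',a',u']" using 1 2 3 4 5 d by auto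
  show "square u a v b u' a'" unfolding square_def using D Nu Na Nv b by auto
qed

text \<open>A cubic \<open>a'\<close> shares \<open>a\<close> with both \<open>v\<close> and
  \<open>u\<close>, hence by parity also \<open>v'\<close> and \<open>u'\<close>. Then
  \<open>b\<close>, \<open>v'\<close> and \<open>u'\<close>, which are all that lies two steps from
  \<open>a\<close>, share two neighbours each with it.\<close>

lemma kite_apex_tail_not_cubic:
  assumes sq: "square v a u b v' a'" and Nu: "N u = {a,b,u'}" and Nb: "N b = {v,u}" and c: "card (N u) = 3"
  shows "card (N a') \<noteq> 3"
proof
  assume ca: "card (N a') = 3"
  note Nv = squareD(1)[OF sq] and Na = squareD(2)[OF sq]
  note d = kite_distinct(1)[OF sq Nu c] note cv = square_cubic[OF sq] note t = square_tail[OF sq]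
  have b: "b \<notin> N a'" using N_sym[of b a'] d by (auto simp: Nb)
  have 1: "v' \<in> N a'" by (rule cubic_neighbour[OF Nv cv(1) ca t(2)]) (use b d in auto)
  have 2: "u' \<in> N a'" by (rule cubic_neighbour[OF Nu c ca t(2)]) (use b d in auto)
  have Na': "N a' = {a,v',u'}" using N3 1 2 t d by auto
  have u'v': "u \<notin> N v'" "v \<notin> N u'" using N_sym[of u v'] N_sym[of v u'] d by (auto simp: Nu Nv)
  have m: "v \<in> N v'" "a' \<in> N v'" "u \<in> N u'" "a' \<in> N u'" using t(1) N_sym[OF 1] N_sym[OF 2] N_sym[of u' u] by (auto simp: Nu)
  have e: "even (card (N a \<inter> N y))" if "y \<in> \<Union>(N ` N a)" "y \<noteq> a" for y
  proof -
    have "y \<in> {b,v',u'}" using that d unfolding Na by (auto simp: Nv Nu Na')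
    then show ?thesis using d m u'v' by (auto simp: Na Nb)
  qed
  show False by (rule no_even_cubic[OF cv(2) e])
qed

lemma kite_side_tail_cubic_adjacent:
  assumes sq: "square v a u b v' a'" and Nu: "N u = {a,b,u'}" and c: "card (N u) = 3" and cv': "card (N v') = 3"
  shows "a' \<in> N v'"
proof -
  have Na: "N a = {v,u,a'}" using sq unfolding square_def by auto
  note d = kite_distinct(1)[OF sq Nu c]
  have "u \<notin> N v'" using N_sym[of u v'] d by (auto simp: Nu)
  then show ?thesis
    by (intro cubic_neighbour[OF Na square_cubic(2)[OF sq] cv' square_tail(1)[OF sq]]) (use d in auto)
qed

text \<open>A cubic \<open>v'\<close> must be adjacent to \<open>a'\<close>, which closes a second
  square on the edge between \<open>v\<close> and \<open>a\<close>. The two open ends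
  \<open>u'\<close> and \<open>v''\<close> are leaves: degree 2 at either one forces an edge between
  them, and then \<open>{v,u,v''}\<close> is a kernel vector.\<close>

lemma kite_side_tail_cubic:
  assumes sq: "square v a u b v' a'" and Nu: "N u = {a,b,u'}" and Nb: "N b = {v,u}" and c: "card (N u) = 3"
    and cv': "card (N v') = 3"
  shows "\<exists>ws. embeds graph8c ws \<and> {v,a,u,b} \<subseteq> set ws"
proof -
  note Nv = squareD(1)[OF sq] and Na = squareD(2)[OF sq]
  note d = kite_distinct(1)[OF sq Nu c] note cv = square_cubic[OF sq] note t = square_tail[OF sq]
  note sq2 = kite_distinct(2)[OF sq Nu c]
  have adj: "a' \<in> N v'" by (rule kite_side_tail_cubic_adjacent[OF sq Nu c cv'])
  have adj2: "v' \<in> N a'" by (rule N_sym[OF adj])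
  have "card {a,v'} \<le> card (N a')" using adj2 t by (intro card_mono) auto
  then have "card (N a') = 2"
    using kite_apex_tail_not_cubic[OF sq Nu Nb c] card_N_cases[OF t(4)] d by auto
  then have Na': "N a' = {a,v'}" using N2[of a v' a'] adj2 t d by auto
  then have ca': "card (N a') = 2" using d by auto
  obtain v'' where v'': "N v' = {v,a',v''}" "v'' \<noteq> v" "v'' \<noteq> a'" "v'' \<noteq> v'"
    using N3_ex[of v a' v'] adj t d cv' by auto
  have m: "v' \<in> N v''" "u \<in> N u'" by (rule N_sym, simp add: v'' Nu)+
  then have nv: "v'' \<notin> {v,a,u,b,v',a'}" using d v''(2-) by (auto simp: Nv Na Nb Nu)
  have V: "v'' \<in> V" "u' \<in> V" using m in_V by blast+
  have cb: "card (N b) = 2" using d by (simp add: Nb)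
  have cu': "card (N u') \<noteq> 3"
  proof
    assume "card (N u') = 3"
    then have "a' \<in> N u'" 
      using kite_side_tail_cubic_adjacent[OF sq2 Nv cv(1)] by simp
    then have "u' \<in> N a'" by (rule N_sym)
    then show False using d by (auto simp: Na')
  qed
  have iv: "a \<notin> N v''" "b \<notin> N v''" "u \<notin> N v'' \<or> v'' = u'"
    using N_sym[of a v''] N_sym[of b v''] N_sym[of u v''] nv by (auto simp: Na Nb Nu)
  have iu: "a \<notin> N u'" "b \<notin> N u'" "v \<notin> N u'"  "a' \<notin> N u'"
    using N_sym[of a u'] N_sym[of b u'] N_sym[of v u'] N_sym[of a' u'] d by (auto simp: Na Nb Nv Na')
  have cv'': "card (N v'') \<noteq> 3"
  proof
    assume "card (N v'') = 3"
    then have "even (card (N v'' \<inter> N v))" using even_cubic[OF _ cv(1), of v''] nv by simp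
    then show False using iv m d by (simp add: Nv)
  qed
  have ne: "v'' \<noteq> u'"
  proof
    assume eq: "v'' = u'"
    then have "{v',u} \<subseteq> N u'" using m by auto
    moreover from this have "card {v',u} \<le> card (N u')" by (intro card_mono) auto
    ultimately have c2: "card (N u') = 2" "N u' = {u,v'}"
      using cu' card_N_cases[OF V(2)] N2[of u v' u'] d by auto
    show False
      by (rule no_two_partners[OF c2(1) cv]) (use d in \<open>auto simp: c2(2) Nv Na\<close>)
  qed
  \<comment> \<open>Two vectors of norm 1 prepared for the open ends. If \<open>u'\<close> and
    \<open>v''\<close> are not adjacent, \<open>[u',a]\<close> meets \<open>[b,v']\<close> oddly and
    \<open>[v'',v]\<close> meets \<open>[a',u]\<close> oddly.\<close>
  have B: "nrm ([b] @ [v']) (2 - 1)"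
    by (rule nrm_reduce) (use d nv in \<open>auto intro: nrm_card2[OF cb] nrm_cubic[OF cv'] simp: Nb v''(1)\<close>)
  have A: "nrm ([a'] @ [u]) (2 - 1)"
    by (rule nrm_reduce) (use d nv in \<open>auto intro: nrm_card2[OF ca'] nrm_cubic[OF c] simp: Nu Na'\<close>)
  have u2: "v'' \<in> N u'" if "card (N u') = 2"
  proof (rule ccontr)
    assume n: "v'' \<notin> N u'"
    have "nrm ([u'] @ [a]) (2 - 1)"
      by (rule nrm_reduce) (use iu m d in \<open>auto intro: nrm_card2[OF that] nrm_cubic[OF cv(2)] simp: Na\<close>)
    then have "nrm ([u',a] @ [b,v']) (1 - 1)"
      using B by (intro nrm_reduce) (use n iu m d nv in \<open>auto simp: Na Nb v''(1)\<close>)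
    from nrm_pos[OF this, of a] show False using d by auto
  qed
  have v2: "u' \<in> N v''" if "card (N v'') = 2"
  proof (rule ccontr)
    assume n: "u' \<notin> N v''"
    have u: "u \<notin> N v''" using iv ne by simp
    have "nrm ([v''] @ [v]) (2 - 1)"
      by (rule nrm_reduce) (use iv(1,2) m d in \<open>auto intro: nrm_card2[OF that] nrm_cubic[OF cv(1)] simp: Nv\<close>)
    then have "nrm ([v'',v] @ [a',u]) (1 - 1)"
      using A by (intro nrm_reduce) (use n iv(1,2) m d nv u in \<open>auto simp: Nv Nu Na'\<close>)
    from nrm_pos[OF this, of v] show False using d nv by auto
  qed
  have "card (N u') \<noteq> 2 \<and> card (N v'') \<noteq> 2"
  proof (rule ccontr)
    assume "\<not> ?thesis"
    then have "v'' \<in> N u'" "u' \<in> N v''" using u2 v2 N_sym by blast+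
    moreover from this have "card (N u') \<noteq> 1" "card (N v'') \<noteq> 1"
      using N1[of v'' u'] N1[of u' v''] m d nv by auto
    ultimately have N': "N u' = {u,v''}" "N v'' = {v',u'}"
      using card_N_cases[OF V(1)] card_N_cases[OF V(2)] cu' cv'' N2[of u v'' u'] N2[of v' u' v''] m nv d by auto
    have "{v,u,v''} \<subseteq> V" using V(1) in_V(1)[of a v] in_V(1)[of a u] Nv Nu by auto
    then show False
      by (rule no_kernel) (use d nv ne in \<open>auto simp: Nv Na Nu Nb v''(1) Na' N'\<close>)
  qed
  then have "N u' = {u}" "N v'' = {v'}" using card_N_cases V cu' cv'' N1 m by blast+
  then have "embeds graph8c [v,a,u,b,v',a',u',v'']"
    using d nv ne unfolding embeds_def graph8c_def by (auto simp: Nv Na Nu Nb v''(1) Na')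
  then show ?thesis by force
qed


text \<open>Otherwise \<open>a'\<close> and \<open>v'\<close> both have degree 2 and are joined.
  Then only \<open>u\<close> and \<open>a'\<close> are two steps from \<open>v\<close>, and each
  shares two neighbours with it.\<close>

lemma kite_apex_tail_leaf:
  assumes sq: "square v a u b v' a'" and Nu: "N u = {a,b,u'}" and Nb: "N b = {v,u}" and c: "card (N u) = 3"
    and cv': "card (N v') \<noteq> 3" 
  shows "a' \<notin> N v'"
proof
  assume adj: "a' \<in> N v'"
  note Nv = squareD(1)[OF sq] and Na = squareD(2)[OF sq]
  note d = kite_distinct(1)[OF sq Nu c] note cv = square_cubic[OF sq] note t = square_tail[OF sq]
  have adj2: "v' \<in> N a'" by (rule N_sym[OF adj])
  have "card {a,v'} \<le> card (N a')" "card {v,a'} \<le> card (N v')" using adj adj2 t by (intro card_mono; auto)+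
  then have "card (N a') = 2" "card (N v') = 2"
    using kite_apex_tail_not_cubic[OF sq Nu Nb c] card_N_cases[OF t(4)] card_N_cases[OF t(3)] cv' d by auto
  then have N': "N a' = {a,v'}" "N v' = {v,a'}" using N2[of a v' a'] N2[of v a' v'] adj adj2 t d by auto
  have e: "even (card (N v \<inter> N y))" if "y \<in> \<Union>(N ` N v)" "y \<noteq> v" for y
  proof -
    have "y \<in> {u,a'}" using that d unfolding Nv by (auto simp: Na Nb N')
    then show ?thesis using d by (auto simp: Nv Nu N')
  qed
  show False by (rule no_even_cubic[OF cv(1) e])
qed

text \<open>If \<open>u'\<close> had degree 2, \<open>[u',a]\<close> would meet oddly
  \<open>[v',a]\<close> or \<open>[b,v',a]\<close>, according to whether \<open>u'\<close> and
  \<open>v''\<close> are adjacent. So \<open>u'\<close> is a leaf, and it remains to see that the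
  tail of \<open>v\<close> stops at \<open>v''\<close>.\<close>

lemma kite_side_tail_card2:
  assumes sq: "square v a u b v' a'" and Nu: "N u = {a,b,u'}" and Nb: "N b = {v,u}" and Na': "N a' = {a}"
    and c: "card (N u) = 3" and cv': "card (N v') = 2" and cu': "card (N u') \<noteq> 3"
  shows "\<exists>ws. embeds graph8d ws \<and> {v,a,u,b} \<subseteq> set ws"
proof -
  note Nv = squareD(1)[OF sq] and Na = squareD(2)[OF sq]
  note d = kite_distinct(1)[OF sq Nu c] note cv = square_cubic[OF sq] note t = square_tail[OF sq]
  obtain v'' where v'': "N v' = {v,v''}" "v'' \<noteq> v" "v'' \<noteq> v'"
    using N2_ex[OF t(1) cv'] .
  have m: "v' \<in> N v''" "u \<in> N u'" by (rule N_sym, simp add: v'' Nu)+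
  then have nv: "v'' \<notin> {v,a,u,b,v',a'}" using d v''(2-) by (auto simp: Nv Na Nb Nu Na')
  have V: "v'' \<in> V" "u' \<in> V" using m in_V by blast+
  have cb: "card (N b) = 2" using d by (simp add: Nb)
  have iv: "a \<notin> N v''" "b \<notin> N v''"
    using N_sym[of a v''] N_sym[of b v''] nv by (auto simp: Na Nb)
  have iu: "a \<notin> N u'" "b \<notin> N u'" "v \<notin> N u'" "a' \<notin> N u'"
    using N_sym[of a u'] N_sym[of b u'] N_sym[of v u'] N_sym[of a' u'] d by (auto simp: Na Nb Nv Na')
  have B: "nrm ([v'] @ [a]) (2 - 1)"
    by (rule nrm_reduce) (use d nv in \<open>auto intro: nrm_card2[OF cv'] nrm_cubic[OF cv(2)] simp: Na v''(1)\<close>)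
  have B2: "nrm ([b] @ [v',a]) (2 - 1)"
    using B by (intro nrm_reduce) (use d nv in \<open>auto intro: nrm_card2[OF cb] simp: Na Nb v''(1)\<close>)
  have A: "nrm ([u'] @ [a]) (2 - 1)" if "card (N u') = 2"
    by (rule nrm_reduce) (use d iu m in \<open>auto intro: nrm_card2[OF that] nrm_cubic[OF cv(2)] simp: Na\<close>)
  have u2: "card (N u') \<noteq> 2"
  proof
    assume c2: "card (N u') = 2"
    show False
    proof (cases "v'' \<in> N u'")
      case False
      then have "nrm ([u',a] @ [v',a]) (1 - 1)"
        using A[OF c2] B by (intro nrm_reduce) (use iu m d nv in \<open>auto simp: Na v''(1)\<close>)
      from nrm_pos[OF this, of u'] show False using d by auto
    next
      case True
      then have "nrm ([u',a] @ [b,v',a]) (1 - 1)"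
        using A[OF c2] B2 by (intro nrm_reduce) (use iu m d nv in \<open>auto simp: Na Nb v''(1)\<close>)
      from nrm_pos[OF this, of u'] show False using d by auto
    qed
  qed
  then have Nu': "N u' = {u}" using card_N_cases V cu' N1 m by blast
  have ne: "v'' \<noteq> u'"
  proof
    assume "v'' = u'"
    then have "v' \<in> {u}" using m(1) unfolding Nu'[symmetric] by simp
    then show False using d by simp
  qed
  have u: "u \<notin> N v''" "u' \<notin> N v''" using N_sym[of u v''] N_sym[of u' v''] nv ne by (auto simp: Nu Nu')
  have cv'': "card (N v'') \<noteq> 3"
  proof
    assume "card (N v'') = 3"
    then have "even (card (N v'' \<inter> N v))" using even_cubic[OF _ cv(1), of v''] nv by simp
    then show False using iv m d by (simp add: Nv)
  qed
  have "card (N v'') \<noteq> 2"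
  proof
    assume c2: "card (N v'') = 2"
    have C: "nrm ([v''] @ [v]) (2 - 1)"
      by (rule nrm_reduce) (use iv m d in \<open>auto intro: nrm_card2[OF c2] nrm_cubic[OF cv(1)] simp: Nv\<close>)
    \<comment> \<open>The leaf \<open>a'\<close> has norm 3 and shares its neighbour
      \<open>a\<close> with the orthogonal vectors \<open>v\<close> and \<open>u\<close>, so it is
      reduced to norm 1.\<close>
    have "card (N a') = 1" by (simp add: Na')
    then have "nrm ([a'] @ [v]) (3 - 1)"
      by (intro nrm_reduce) (use d in \<open>auto intro: nrm_card1 nrm_cubic[OF cv(1)] simp: Nv Na'\<close>)
    then have "nrm ([a',v] @ [u]) (2 - 1)"
      by (intro nrm_reduce) (use d in \<open>auto intro: nrm_cubic[OF c] simp: Nv Nu Na'\<close>)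
    then have "nrm ([v'',v] @ [a',v,u]) (1 - 1)"
      using C by (intro nrm_reduce) (use iv m d nv u ne in \<open>auto simp: Nv Nu Na'\<close>)
    from nrm_pos[OF this, of v''] show False using d nv by auto
  qed
  then have "N v'' = {v'}" using card_N_cases V cv'' N1 m by blast
  then have "embeds graph8d [v,a,u,b,v',a',u',v'']"
    using d nv ne unfolding embeds_def graph8d_def by (auto simp: Nv Na Nu Nb v''(1) Na' Nu')
  then show ?thesis by force
qed

text \<open>Without a cubic side tail, \<open>a'\<close> is a leaf: with degree 2 it would share
  just \<open>a\<close> with both \<open>v\<close> and \<open>u\<close>. The side tails are not both
  leaves, because then \<open>{b,v',u'}\<close> would be a kernel vector.\<close>

lemma kite_classify:
  assumes sq: "square v a u b v' a'" and Nb: "N b = {v,u}" and c: "card (N u) = 3"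
  shows "\<exists>G\<in>{graph8c,graph8d}. \<exists>ws. embeds G ws \<and> {v,a,u,b} \<subseteq> set ws"
proof -
  have Nv: "N v = {a,b,v'}" and Na: "N a = {v,u,a'}" and ab: "{a,b} \<subseteq> N u" "a \<noteq> b"
    using sq unfolding square_def by auto
  obtain u' where Nu: "N u = {a,b,u'}" using N3_ex[OF ab c] by metis
  note d = kite_distinct(1)[OF sq Nu c] note cv = square_cubic[OF sq] note t = square_tail[OF sq]
  note sq2 = kite_distinct(2)[OF sq Nu c] note t2 = square_tail[OF sq2]
  have Nb2: "N b = {u,v}" using Nb by auto
  show ?thesis
  proof (cases "card (N v') = 3 \<or> card (N u') = 3")
    case True
    then show ?thesis
      using kite_side_tail_cubic[OF sq Nu Nb c] kite_side_tail_cubic[OF sq2 Nv Nb2 cv(1)] by blast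
  next
    case False
    have na: "v' \<notin> N a'" "u' \<notin> N a'"
      using kite_apex_tail_leaf[OF sq Nu Nb c] kite_apex_tail_leaf[OF sq2 Nv Nb2 cv(1)] False N_sym by blast+
    have nb: "b \<notin> N a'" using N_sym[of b a'] d by (auto simp: Nb)
    have "card (N a') \<noteq> 2"
    proof
      assume c2: "card (N a') = 2"
      show False
        by (rule no_two_partners[OF c2 cv(1) c]) (use d na nb t in \<open>auto simp: Nv Nu\<close>)
    qed
    then have Na': "N a' = {a}"
      using card_N_cases[OF t(4)] kite_apex_tail_not_cubic[OF sq Nu Nb c] N1 t(2) by blast
    have "card (N v') = 2 \<or> card (N u') = 2"
    proof (rule ccontr)
      assume "\<not> ?thesis"
      then have l: "N v' = {v}" "N u' = {u}" using False card_N_cases t t2 N1 by blast+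
      have "{b,v',u'} \<subseteq> V" using t t2 in_V(1)[of v b] Nb by auto
      then show False
        by (intro no_kernel[of "{b,v',u'}"]) (use d in \<open>auto simp: Nv Na Nu Nb l\<close>)
    qed
    then show ?thesis
      using kite_side_tail_card2[OF sq Nu Nb Na' c] kite_side_tail_card2[OF sq2 Nv Nb2 Na' cv(1)] False
      by blast
  qed
qed


section \<open>Squares with four cubic vertices\<close>

lemma cubic_square_tail_not_cubic:
  assumes sq: "square v a u b v' a'" and Nu: "N u = {a,b,u'}" and Nb: "N b = {v,u,b'}"
    and c: "card (N u) = 3" "card (N b) = 3"
    and d: "distinct [v,a,u,b,v',a',u',b']"
  shows "card (N v') \<noteq> 3"
proof
  assume cv': "card (N v') = 3"
  note Nv = squareD(1)[OF sq] and Na = squareD(2)[OF sq]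
  note cv = square_cubic[OF sq] note t = square_tail[OF sq]
  have u: "u \<notin> N v'" using N_sym[of u v'] d by (auto simp: Nu)
  \<comment> \<open>Parity against \<open>a\<close> and against \<open>b\<close> puts
    \<open>a'\<close> and \<open>b'\<close> next to \<open>v'\<close>. Then \<open>u\<close>,
    \<open>a'\<close> and \<open>b'\<close> all share two neighbours with \<open>v\<close>.\<close>
  have 1: "a' \<in> N v'" by (rule cubic_neighbour[OF Na cv(2) cv' t(1)]) (use d u in auto)
  have 2: "b' \<in> N v'" by (rule cubic_neighbour[OF Nb c(2) cv' t(1)]) (use d u in auto)
  have Nv': "N v' = {v,a',b'}" using N3[of v a' b' v'] 1 2 t d by auto
  have m: "a \<in> N a'" "v' \<in> N a'" "b \<in> N b'" "v' \<in> N b'" "b \<notin> N a'" "a \<notin> N b'"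
    using t N_sym[OF 1] N_sym[OF 2] N_sym[of b' b] N_sym[of b a'] N_sym[of a b'] d by (auto simp: Nb Na)
  have e: "even (card (N v \<inter> N y))" if "y \<in> \<Union>(N ` N v)" "y \<noteq> v" for y
  proof -
    have "y \<in> {u,a',b'}" using that d unfolding Nv by (auto simp: Na Nb Nv')
    then show ?thesis using d m by (auto simp: Nv Nu)
  qed
  show False by (rule no_even_cubic[OF cv(1) e])
qed

text \<open>If \<open>u'\<close> is a leaf, \<open>[u',a,b]\<close> and \<open>[v',b]\<close> have
  norm 1 and odd inner product. If \<open>u'\<close> and \<open>b'\<close> are joined,
  \<open>v\<close> and \<open>b'\<close> are an exclusive pair, excluded by the prime 5.\<close>

lemma cubic_square_adjacent_tails:
  assumes sq: "square v a u b v' a'" and Nu: "N u = {a,b,u'}" and Nb: "N b = {v,u,b'}"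
    and c: "card (N u) = 3" "card (N b) = 3"
    and d: "distinct [v,a,u,b,v',a',u',b']"
    and Nv': "N v' = {v,a'}" and Na': "N a' = {a,v'}"
    and cu': "card (N u') = 1 \<or> N u' = {u,b'}" and cb': "card (N b') = 1 \<or> N b' = {b,u'}"
  shows False
proof -
  note Nv = squareD(1)[OF sq] and Na = squareD(2)[OF sq]
  note cv = square_cubic[OF sq] note t = square_tail[OF sq]
  have m: "u \<in> N u'" "b \<in> N b'" by (rule N_sym, simp add: Nu Nb)+
  have c2: "card (N v') = 2" "card (N a') = 2" using d by (simp_all add: Nv' Na')
  show False
  proof (cases "N u' = {u,b'}")
    case False
    then have "N u' = {u}" using cu' N1 m by blast
    then have Nu': "N u' = {u}" "card (N u') = 1" by simp_all
    have "nrm ([u'] @ [a]) (3 - 1)"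
      by (rule nrm_reduce) (use d in \<open>auto intro: nrm_card1[OF Nu'(2)] nrm_cubic[OF cv(2)] simp: Na Nu'\<close>)
    then have "nrm ([u',a] @ [b]) (2 - 1)"
      by (intro nrm_reduce) (use d in \<open>auto intro: nrm_cubic[OF c(2)] simp: Na Nb Nu'\<close>)
    moreover have "nrm ([v'] @ [b]) (2 - 1)"
      by (rule nrm_reduce) (use d in \<open>auto intro: nrm_card2[OF c2(1)] nrm_cubic[OF c(2)] simp: Nb Nv'\<close>)
    ultimately have "nrm ([v',b] @ [u',a,b]) (1 - 1)"
      by (intro nrm_reduce) (use d in \<open>auto simp: Na Nb Nu' Nv'\<close>)
    from nrm_pos[OF this, of v'] show False using d by auto
  next
    case True
    then have "u' \<in> N b'" using N_sym[of b' u'] by auto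
    then have Nb': "N b' = {b,u'}" using cb' N1[OF m(2)] d by auto
    then have cb2: "card (N b') = 2" using d by simp
    have e1: "even (card (N v \<inter> N z))" if "z \<in> \<Union>(N ` N v)" "z \<noteq> v" "z \<noteq> b'" for z
    proof -
      have "z \<in> {u,a'}" using that d unfolding Nv by (auto simp: Na Nb Nv')
      then show ?thesis using d by (auto simp: Nv Nu Na')
    qed
    have e2: "even (card (N b' \<inter> N z))" if "z \<in> \<Union>(N ` N b')" "z \<noteq> v" "z \<noteq> b'" for z
    proof -
      have "z \<in> {u}" using that d unfolding Nb' by (auto simp: Nb True)
      then show ?thesis using d by (auto simp: Nb' Nu)
    qed
    have "odd (card (N v \<inter> N b'))" using d by (simp add: Nv Nb')
    then show False using no_exclusive[OF cv(1) cb2 _ e1 e2] by blast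
  qed
qed

text \<open>A tail of degree 2 must end at the tail of a neighbouring cycle vertex; otherwise
  \<open>a'\<close> shares just \<open>a\<close> with each of the cubic vertices \<open>v\<close>
  and \<open>u\<close>.\<close>

lemma cubic_square_tail_cases:
  assumes sq: "square v a u b v' a'" and Nu: "N u = {a,b,u'}" and Nb: "N b = {v,u,b'}"
    and c: "card (N u) = 3" "card (N b) = 3"
    and d: "distinct [v,a,u,b,v',a',u',b']"
  shows "N a' = {a} \<or> N a' = {a,v'} \<or> N a' = {a,u'}"
proof -
  note Nv = squareD(1)[OF sq] and Na = squareD(2)[OF sq]
  note cv = square_cubic[OF sq] note t = square_tail[OF sq]
  have sq2: "square a v b u a' v'" by (rule square_swap[OF sq])
  have "card (N a') \<noteq> 3" by (rule cubic_square_tail_not_cubic[OF sq2 Nb Nu c(2,1)]) (use d in auto)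
  moreover have "v' \<in> N a' \<or> u' \<in> N a'" if c2: "card (N a') = 2"
  proof (rule ccontr)
    assume n: "\<not> ?thesis"
    have nb: "b \<notin> N a'" using N_sym[of b a'] d by (auto simp: Nb)
    show False
      by (rule no_two_partners[OF c2 cv(1) c(1)]) (use d n nb t in \<open>auto simp: Nv Nu\<close>)
  qed
  moreover have "N a' = {a,z}" if "card (N a') = 2" "z \<in> N a'" "z \<noteq> a" for z
    using N2[of a z a'] that t by auto
  moreover have "v' \<noteq> a" "u' \<noteq> a" using d by auto
  ultimately show ?thesis using card_N_cases[OF t(4)] N1[OF t(2)] by blast
qed

lemma tail_paired:
  assumes "N q = {y} \<or> N q = {y,p} \<or> N q = {y,r}" "N p = {x,q}" "p \<noteq> y" "p \<noteq> r"
  shows "N q = {y,p}" "r \<noteq> y \<Longrightarrow> q \<notin> N r"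
proof -
  have "p \<in> N q" by (rule N_sym) (simp add: assms(2))
  then show 1: "N q = {y,p}" using assms(1,3,4) by (metis insertE singletonD)
  show "q \<notin> N r" if "r \<noteq> y"
    using that assms(4) N_sym[of q r] by (auto simp: 1)
qed

lemma tail_unpaired:
  assumes "N q = {y} \<or> N q = {y,p} \<or> N q = {y,r}" "p \<notin> N q"
  shows "card (N q) = 1 \<or> N q = {y,r}"
  using assms by (metis insertI1 insertI2 is_singletonI is_singleton_altdef)

text \<open>An edge between \<open>v'\<close> and \<open>a'\<close> uses up both tails, so the case
  lists for \<open>u'\<close> and \<open>b'\<close> leave only a leaf or an edge between these two,
  as \<open>cubic_square_adjacent_tails\<close> requires.\<close>

lemma cubic_square_tails_not_adjacent:
  assumes sq: "square v a u b v' a'" and Nu: "N u = {a,b,u'}" and Nb: "N b = {v,u,b'}"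
    and c: "card (N u) = 3" "card (N b) = 3"
    and d: "distinct [v,a,u,b,v',a',u',b']"
  shows "a' \<notin> N v'"
proof
  assume "a' \<in> N v'"
  note Nv = squareD(1)[OF sq] and Na = squareD(2)[OF sq] and cv = square_cubic[OF sq]
  have sq4: "square b u a v b' u'" unfolding square_def using d Nu Nb Na Nv by auto
  have Na2: "N a = {u,v,a'}" and Nv2: "N v = {b,a,v'}" using Na Nv by auto
  have d4: "distinct [b,u,a,v,b',u',a',v']" "distinct [u,b,v,a,u',b',v',a']" "distinct [a,v,b,u,a',v',b',u']" using d by auto
  have ne: "v' \<noteq> a" "v' \<noteq> u'" "u' \<noteq> a" "a' \<noteq> v" "a' \<noteq> b'" "b' \<noteq> v" "b' \<noteq> a'" using d by auto
  have sw: "A \<or> B \<or> C \<Longrightarrow> A \<or> C \<or> B" for A B C by blast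
  have Ta: "N a' = {a} \<or> N a' = {a,v'} \<or> N a' = {a,u'}"
    by (rule cubic_square_tail_cases[OF sq Nu Nb c d])
  have Tv: "N v' = {v} \<or> N v' = {v,a'} \<or> N v' = {v,b'}"
    by (rule cubic_square_tail_cases[OF square_swap[OF sq] Nb Nu c(2,1) d4(3)])
  have Tu: "N u' = {u} \<or> N u' = {u,b'} \<or> N u' = {u,a'}"
    by (rule cubic_square_tail_cases[OF sq4 Na2 Nv2 cv(2,1) d4(1)])
  have Tb: "N b' = {b} \<or> N b' = {b,u'} \<or> N b' = {b,v'}"
    by (rule cubic_square_tail_cases[OF square_swap[OF sq4] Nv2 Na2 cv d4(2)])
  have *: "N v' = {v,a'}" using Tv \<open>a' \<in> N v'\<close> ne by (metis insertE singletonD)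
  note a = tail_paired[OF Ta * ne(1,2)]
  have u: "card (N u') = 1 \<or> N u' = {u,b'}" by (rule tail_unpaired[OF sw[OF Tu] a(2)[OF ne(3)]])
  have "b' \<notin> N v'" using ne by (simp add: *)
  then have "v' \<notin> N b'" using N_sym by blast
  then have b: "card (N b') = 1 \<or> N b' = {b,u'}" by (rule tail_unpaired[OF sw[OF Tb]])
  show False by (rule cubic_square_adjacent_tails[OF sq Nu Nb c d * a(1) u b])
qed

lemma cubic_square_classify:
  assumes sq: "square v a u b v' a'" and c: "card (N u) = 3" "card (N b) = 3"
  shows "\<exists>ws. embeds graph8e ws \<and> {v,a,u,b} \<subseteq> set ws"
proof -
  note Nv = squareD(1)[OF sq] and Na = squareD(2)[OF sq]
  have ab: "{a,b} \<subseteq> N u" "a \<noteq> b" "{v,u} \<subseteq> N b" "v \<noteq> u" using sq unfolding square_def by auto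
  obtain u' where Nu: "N u = {a,b,u'}" using N3_ex[OF ab(1,2) c(1)] by metis
  obtain b' where Nb: "N b = {v,u,b'}" using N3_ex[OF ab(3,4) c(2)] by metis
  note sq1 = square_swap[OF sq] and cv = square_cubic[OF sq]
  note du = kite_distinct[OF sq Nu c(1)] and db = kite_distinct[OF sq1 Nb c(2)]
  have "u' \<noteq> b'"
  proof
    assume "u' = b'"
    then have "N u \<inter> N b = {u'}" unfolding Nu Nb using du(1) db(1) by auto
    then show False using even_cubic[OF c] du(1) by simp
  qed
  then have d: "distinct [v,a,u,b,v',a',u',b']" using du(1) db(1) by auto
  \<comment> \<open>Rotations and reflections of the square, so that the preceding lemma applies to
    every pair of neighbouring tails.\<close>
  have sq4: "square b u a v b' u'" and sq8: "square v b u a v' b'" unfolding square_def using d Nu Nb Na Nv by auto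
  have eqs: "N a = {u,v,a'}" "N v = {b,a,v'}" "N b = {u,v,b'}" "N u = {b,a,u'}" using Na Nv Nb Nu by auto
  have ds: "distinct [b,u,a,v,b',u',a',v']" "distinct [u,a,v,b,u',a',v',b']" "distinct [v,b,u,a,v',b',u',a']"
    "distinct [a,v,b,u,a',v',b',u']" using d by auto
  have nadj: "a' \<notin> N v'" "u' \<notin> N b'" "a' \<notin> N u'" "b' \<notin> N v'"
    by (rule cubic_square_tails_not_adjacent[OF sq Nu Nb c d]
      cubic_square_tails_not_adjacent[OF sq4 eqs(1,2) cv(2,1) ds(1)]
      cubic_square_tails_not_adjacent[OF du(2) Nv eqs(3) cv(1) c(2) ds(2)]
      cubic_square_tails_not_adjacent[OF sq8 eqs(4) Na c(1) cv(2) ds(3)])+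
  have leaf: "N p = {x}" if "N p = {x} \<or> N p = {x,q} \<or> N p = {x,r}" "q \<notin> N p" "r \<notin> N p" for p q r x
    using that by (metis insertI1 insertI2)
  have "N a' = {a}" by (rule leaf[OF cubic_square_tail_cases[OF sq Nu Nb c d]]) (use nadj N_sym in blast)+
  moreover have "N v' = {v}"
    by (rule leaf[OF cubic_square_tail_cases[OF sq1 Nb Nu c(2,1) ds(4)]]) (use nadj N_sym in blast)+
  moreover have "N u' = {u}"
    by (rule leaf[OF cubic_square_tail_cases[OF sq4 eqs(1,2) cv(2,1) ds(1)]]) (use nadj N_sym in blast)+
  moreover have "N b' = {b}"
    by (rule leaf[OF cubic_square_tail_cases[OF sq8 eqs(4) Na c(1) cv(2) ds(3)]]) (use nadj N_sym in blast)+
  ultimately have "embeds graph8e [v,a,u,b,v',a',u',b']"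
    using d unfolding embeds_def graph8e_def by (auto simp: Nv Na Nu Nb)
  then show ?thesis by force
qed

theorem common_neighbours_classify:
  assumes "x \<noteq> y" "card (N x \<inter> N y) = 2"
  shows "\<exists>G\<in>{graph6,graph8a,graph8b,graph8c,graph8d,graph8e}. \<exists>ws. embeds G ws \<and> x \<in> set ws"
proof -
  obtain v a u b v' a' where sq: "square v a u b v' a'" and x: "x \<in> {v,a,u,b}"
    using square_exists[OF assms] by blast
  have s: "{a,b} \<subseteq> N u" "{v,u} \<subseteq> N b" and d: "distinct [v,a,u,b,v',a']" using sq unfolding square_def by auto
  have V: "u \<in> V" "b \<in> V" using s in_V by blast+
  have "card {a,b} \<le> card (N u)" "card {v,u} \<le> card (N b)" using s by (intro card_mono; simp)+
  then have "card (N u) = 2 \<or> card (N u) = 3" "card (N b) = 2 \<or> card (N b) = 3"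
    using card_N_cases[OF V(1)] card_N_cases[OF V(2)] d by auto
  moreover have "N u = {a,b}" if "card (N u) = 2" using N2[OF s(1)] that d by auto
  moreover have "N b = {v,u}" if "card (N b) = 2" using N2[OF s(2)] that d by auto
  ultimately consider "N u = {a,b}" "N b = {v,u}" | "N b = {v,u}" "card (N u) = 3"
    | "N u = {a,b}" "card (N b) = 3" | "card (N u) = 3" "card (N b) = 3" by blast
  then show ?thesis
  proof cases
    case 1
    show ?thesis using short_square_classify[OF sq 1] x by fast
  next
    case 2
    show ?thesis using kite_classify[OF sq 2] x by fast
  next
    case 3
    show ?thesis using kite_classify[OF square_swap[OF sq] 3] x by fast
  next
    case 4
    show ?thesis using cubic_square_classify[OF sq 4] x by fast
  qed
qed

end

section \<open>Components\<close>

text \<open>The sum of the later vertex weights \<open>excess\<close> over a component that is a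
  copy of \<open>G\<close>, on lists so that it can be evaluated.\<close>

definition cubic_excess :: "nat list list \<Rightarrow> int" where
  "cubic_excess G = (\<Sum>i\<leftarrow>[0..<length G]. 2 * of_bool (card (set (G ! i)) = 3) -
     int (length (filter (\<lambda>j. j \<noteq> i \<and> card (set (G ! i) \<inter> set (G ! j)) = 2) [0..<length G])))"

text \<open>Each round adds all neighbours; \<open>length G\<close> rounds suffice to reach a whole
  connected graph, which makes connectedness decidable by evaluation.\<close>

fun spread :: "nat list list \<Rightarrow> nat \<Rightarrow> nat list \<Rightarrow> nat list" where
  "spread G 0 is = is"
| "spread G (Suc k) is = spread G k (remdups (concat (map (\<lambda>i. i # G ! i) is)))"

definition connected_list :: "nat list list \<Rightarrow> bool" where
  "connected_list G \<longleftrightarrow>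
     (\<forall>is\<in>set G. \<forall>i\<in>set is. i < length G) \<and>
     (\<forall>i\<in>set [0..<length G]. set [0..<length G] \<subseteq> set (spread G (length G) [i]))"

lemma connected_graphs:
  "connected_list graph6" "connected_list graph8a" "connected_list graph8b"
  "connected_list graph8c" "connected_list graph8d" "connected_list graph8e"
  by code_simp+

lemma cubic_excess_graphs:
  "cubic_excess graph6 = 0" "cubic_excess graph8a = 0" "cubic_excess graph8b = 0"
  "cubic_excess graph8c = 0" "cubic_excess graph8d = 2" "cubic_excess graph8e = 4"
  by code_simp+

context parity_graph begin

lemma embedsD:
  assumes "embeds G ws"
  shows "distinct ws" "length ws = length G" "i < length G \<Longrightarrow> N (ws ! i) = (!) ws ` set (G ! i)"
  using assms unfolding embeds_def by (auto simp: list_all2_conv_all_nth)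

lemma embeds_closed:
  assumes "embeds G ws" "connected_list G" "x \<in> set ws" shows "N x \<subseteq> set ws"
proof -
  obtain i where i: "i < length G" "x = ws ! i" using assms(1,3) embedsD(2) by (metis in_set_conv_nth)
  have "\<And>j. j \<in> set (G ! i) \<Longrightarrow> j < length ws"
    using assms(2) i embedsD(2)[OF assms(1)] unfolding connected_list_def by auto
  then show ?thesis using embedsD(3)[OF assms(1) i(1)] i(2) by auto
qed

lemma embeds_common:
  assumes "embeds G ws" "connected_list G" "i < length G"
  shows "j < length G \<Longrightarrow> card (N (ws ! i) \<inter> N (ws ! j)) = card (set (G ! i) \<inter> set (G ! j))"
    and "card (N (ws ! i)) = card (set (G ! i))"
proof -
  note E = embedsD[OF assms(1)]
  have inj: "inj_on ((!) ws) {..<length G}" using E(1,2) by (simp add: inj_on_def nth_eq_iff_index_eq)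
  have sub: "set (G ! k) \<subseteq> {..<length G}" if "k < length G" for k
    using assms(2) that unfolding connected_list_def by auto
  have card_im: "card ((!) ws ` A) = card A" if "A \<subseteq> {..<length G}" for A
    using card_image inj inj_on_subset that by blast
  show "card (N (ws ! i)) = card (set (G ! i))" using card_im[OF sub] E(3) assms(3) by simp
  assume j: "j < length G"
  have "N (ws ! i) \<inter> N (ws ! j) = (!) ws ` (set (G ! i) \<inter> set (G ! j))"
    using inj_on_image_Int[OF inj sub sub, of i j] assms(3) j E(3) by simp
  then show "card (N (ws ! i) \<inter> N (ws ! j)) = card (set (G ! i) \<inter> set (G ! j))"
    using card_im[of "set (G ! i) \<inter> set (G ! j)"] sub[OF assms(3)] by (simp add: le_infI1)
qed

lemma spread_closed:
  assumes e: "embeds G ws" and c: "connected_list G" and T: "\<And>x. x \<in> T \<Longrightarrow> N x \<subseteq> T"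
  shows "\<forall>i\<in>set is. i < length G \<and> ws ! i \<in> T \<Longrightarrow> \<forall>i\<in>set (spread G k is). ws ! i \<in> T"
proof (induction k arbitrary: "is")
  case (Suc k)
  have *: "j < length G \<and> ws ! j \<in> T" if "i \<in> set is" "j \<in> set (G ! i)" for i j
  proof -
    have i: "i < length G" "ws ! i \<in> T" using Suc.prems that by auto
    have "ws ! j \<in> N (ws ! i)" using embedsD(3)[OF e i(1)] that by auto
    moreover have "j < length G" using c i that unfolding connected_list_def by auto
    ultimately show ?thesis using T i by blast
  qed
  show ?case unfolding spread.simps by (rule Suc.IH) (use Suc.prems * in auto)
qed simp

lemma embeds_connected:
  assumes e: "embeds G ws" and c: "connected_list G" and T: "\<And>x. x \<in> T \<Longrightarrow> N x \<subseteq> T"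
    and x: "x \<in> set ws" "x \<in> T"
  shows "set ws \<subseteq> T"
proof
  fix y assume "y \<in> set ws"
  then obtain j where j: "j < length G" "y = ws ! j" using embedsD(2)[OF e] by (metis in_set_conv_nth)
  obtain i where i: "i < length G" "x = ws ! i" using x embedsD(2)[OF e] by (metis in_set_conv_nth)
  have "{0..<length G} \<subseteq> set (spread G (length G) [i])" using c i unfolding connected_list_def by auto
  then have "j \<in> set (spread G (length G) [i])" using j by auto
  then show "y \<in> T" using spread_closed[OF e c T, of "[i]" "length G"] i j x by auto
qed

text \<open>The trace of \<open>H^4\<close> makes the sum of these weights over all vertices vanish.\<close>

definition excess :: "'a \<Rightarrow> int" where
  "excess x = 2 * of_bool (card (N x) = 3) - int (card {y. y \<noteq> x \<and> card (N x \<inter> N y) = 2})"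

lemma embeds_excess:
  assumes e: "embeds G ws" and c: "connected_list G"
  shows "(\<Sum>x\<in>set ws. excess x) = cubic_excess G"
proof -
  note E = embedsD[OF e]
  let ?n = "length G"
  have inj: "inj_on ((!) ws) {..<?n}" using E(1,2) by (simp add: inj_on_def nth_eq_iff_index_eq)
  note int = embeds_common(1)[OF e c]
  have ex: "excess (ws ! i) = 2 * of_bool (card (set (G ! i)) = 3) -
     int (length (filter (\<lambda>j. j \<noteq> i \<and> card (set (G ! i) \<inter> set (G ! j)) = 2) [0..<?n]))" if i: "i < ?n" for i
  proof -
    have "{y. y \<noteq> ws ! i \<and> card (N (ws ! i) \<inter> N y) = 2}
        = (!) ws ` {j. j < ?n \<and> j \<noteq> i \<and> card (set (G ! i) \<inter> set (G ! j)) = 2}" (is "?A = ?B")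
    proof
      show "?A \<subseteq> ?B"
      proof
        fix y assume y: "y \<in> ?A"
        then have "N (ws ! i) \<inter> N y \<noteq> {}" by auto
        then obtain z where z: "z \<in> N (ws ! i)" "z \<in> N y" by blast
        have "ws ! i \<in> set ws" using i E(2) by auto
        then have "z \<in> set ws" using z embeds_closed[OF e c] by blast
        then have "y \<in> set ws" using embeds_closed[OF e c] N_sym[OF z(2)] by blast
        then obtain j where j: "j < ?n" "y = ws ! j" using E(2) by (metis in_set_conv_nth)
        then show "y \<in> ?B" using y int[OF i j(1)] by auto
      qed
      show "?B \<subseteq> ?A" using int[OF i] i E(1,2) by (auto simp: nth_eq_iff_index_eq)
    qed
    then have "card ?A = card {j. j < ?n \<and> j \<noteq> i \<and> card (set (G ! i) \<inter> set (G ! j)) = 2}"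
      by (simp only:) (rule card_image, rule inj_on_subset[OF inj], auto)
    also have "\<dots> = length (filter (\<lambda>j. j \<noteq> i \<and> card (set (G ! i) \<inter> set (G ! j)) = 2) [0..<?n])"
      by (subst distinct_card[symmetric]) (auto intro!: arg_cong[of _ _ card])
    finally show ?thesis unfolding excess_def embeds_common(2)[OF e c i] by simp
  qed
  have "(\<Sum>x\<in>set ws. excess x) = (\<Sum>x\<leftarrow>ws. excess x)"
    using E(1) by (simp add: sum_list_distinct_conv_sum_set)
  also have "\<dots> = (\<Sum>i\<leftarrow>[0..<?n]. excess (ws ! i))"
    by (metis (no_types, lifting) E(2) map_nth map_map comp_apply map_eq_conv)
  also have "\<dots> = cubic_excess G" unfolding cubic_excess_def
    by (rule arg_cong[of _ _ sum_list], rule map_cong) (simp_all add: ex)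
  finally show ?thesis .
qed

lemma common_neighbours_embed:
  assumes "x \<noteq> y" "card (N x \<inter> N y) = 2"
  obtains G ws where "embeds G ws" "x \<in> set ws" "connected_list G" "cubic_excess G \<ge> 0"
    "cubic_excess G = 0 \<Longrightarrow> G \<in> {graph6,graph8a,graph8b,graph8c}"
  using common_neighbours_classify[OF assms] connected_graphs cubic_excess_graphs
  by (smt (verit) insertE insertI1 insertI2 singletonD)

lemma embeds_sub_V: assumes "embeds G ws" "connected_list G" "x \<in> set ws" "x \<in> V" shows "set ws \<subseteq> V"
  using embeds_connected[OF assms(1,2) _ assms(3,4)] N_sub by blast

text \<open>Whole embedded components are removed one at a time, each contributing a nonnegative
  \<open>cubic_excess\<close>. Where no pair has two common neighbours the negative part of
  \<open>excess\<close> is empty.\<close>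

lemma closed_excess_nonneg:
  assumes "T \<subseteq> V" "\<And>x. x \<in> T \<Longrightarrow> N x \<subseteq> T"
  shows "0 \<le> (\<Sum>x\<in>T. excess x)"
  using assms
proof (induction "card T" arbitrary: T rule: less_induct)
  case less
  have fin: "finite T" using less.prems(1) finite_V finite_subset by blast
  show ?case
  proof (cases "\<exists>x\<in>T. \<exists>y. y \<noteq> x \<and> card (N x \<inter> N y) = 2")
    case False
    have "excess x \<ge> 0" if "x \<in> T" for x
    proof -
      have e: "{y. y \<noteq> x \<and> card (N x \<inter> N y) = 2} = {}" using that False by blast
      show ?thesis unfolding excess_def e by simp
    qed
    then show ?thesis by (simp add: sum_nonneg)
  next
    case True
    then obtain x y where x: "x \<in> T" "x \<noteq> y" "card (N x \<inter> N y) = 2" by metis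
    obtain G ws where G: "embeds G ws" "x \<in> set ws" "connected_list G" "cubic_excess G \<ge> 0"
      using common_neighbours_embed[OF x(2,3)] by metis
    have sub: "set ws \<subseteq> T" by (rule embeds_connected[OF G(1,3) less.prems(2) G(2) x(1)])
    have "0 \<le> (\<Sum>x\<in>T - set ws. excess x)"
    proof (rule less.hyps)
      show "card (T - set ws) < card T" using fin x(1) G(2) by (intro psubset_card_mono) auto
      show "T - set ws \<subseteq> V" using less.prems by auto
      fix z assume z: "z \<in> T - set ws"
      then show "N z \<subseteq> T - set ws" using less.prems(2) embeds_closed[OF G(1,3)] N_sym by blast
    qed
    then show ?thesis using embeds_excess[OF G(1,3)] G(4) sum.subset_diff[OF sub fin, of excess] by simp
  qed
qed

text \<open>\<open>T\<close> and its complement in \<open>V\<close> are both closed, so both sums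
  are nonnegative and add up to zero.\<close>

lemma closed_excess_zero:
  assumes "(\<Sum>x\<in>V. excess x) = 0" "T \<subseteq> V" "\<And>x. x \<in> T \<Longrightarrow> N x \<subseteq> T"
  shows "(\<Sum>x\<in>T. excess x) = 0"
proof -
  have "0 \<le> (\<Sum>x\<in>V - T. excess x)" using assms(3) N_sym N_sub by (intro closed_excess_nonneg) blast+
  then show ?thesis using closed_excess_nonneg[OF assms(2,3)] assms(1)
      sum.subset_diff[OF assms(2) finite_V, of excess] by simp
qed

section \<open>Components, and their shape when all degrees are at most 2\<close>

definition component :: "'a \<Rightarrow> 'a set" where
  "component w = {(x, y). y \<in> N x}\<^sup>* `` {w}"

lemma component_self: "w \<in> component w"
  unfolding component_def by auto

lemma component_closed: "x \<in> component w \<Longrightarrow> N x \<subseteq> component w"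
  unfolding component_def by (auto intro: rtrancl_into_rtrancl)

lemma component_sub: assumes "w \<in> T" "\<And>x. x \<in> T \<Longrightarrow> N x \<subseteq> T" shows "component w \<subseteq> T"
proof
  fix y assume "y \<in> component w"
  then have "(w, y) \<in> {(x, y). y \<in> N x}\<^sup>*" unfolding component_def by simp
  then show "y \<in> T" by induction (use assms in auto)
qed

lemma component_sym: assumes "x \<in> component w" shows "w \<in> component x"
proof -
  have "sym {(x, y). y \<in> N x}" using N_sym by (auto simp: sym_def)
  then have "sym ({(x, y). y \<in> N x}\<^sup>*)" by (rule sym_rtrancl)
  then show ?thesis using assms unfolding component_def sym_def by auto
qed

theorem component_cases:
  assumes total: "(\<Sum>x\<in>V. excess x) = 0" and w: "w \<in> V"
  shows "(\<exists>G\<in>{graph6,graph8a,graph8b,graph8c}. \<exists>ws. embeds G ws \<and> w \<in> set ws) \<or>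
    (\<forall>x\<in>component w. card (N x) \<le> 2)"
proof (cases "\<exists>x\<in>component w. \<exists>y. y \<noteq> x \<and> card (N x \<inter> N y) = 2")
  case True
  then obtain x y where x: "x \<in> component w" "x \<noteq> y" "card (N x \<inter> N y) = 2" by metis
  then obtain G ws where G: "embeds G ws" "x \<in> set ws" "connected_list G" "cubic_excess G \<ge> 0"
    "cubic_excess G = 0 \<Longrightarrow> G \<in> {graph6,graph8a,graph8b,graph8c}"
    using common_neighbours_embed by metis
  have xV: "x \<in> V" using component_sub[OF w] N_sub x(1) by blast
  have "cubic_excess G = 0"
    using closed_excess_zero[OF total embeds_sub_V[OF G(1,3,2) xV] embeds_closed[OF G(1,3)]]
      embeds_excess[OF G(1,3)] by simp
  moreover have "w \<in> set ws"
    using component_sub[OF G(2) embeds_closed[OF G(1,3)]] component_sym[OF x(1)] by blast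
  ultimately show ?thesis using G by blast
next
  case False
  let ?K = "component w"
  have KV: "?K \<subseteq> V" using component_sub[OF w] N_sub by blast
  then have fin: "finite ?K" using finite_V finite_subset by blast
  have "excess x = 2 * of_bool (card (N x) = 3)" if "x \<in> ?K" for x
  proof -
    have e: "{y. y \<noteq> x \<and> card (N x \<inter> N y) = 2} = {}" using that False by blast
    show ?thesis unfolding excess_def e by simp
  qed
  then have "(\<Sum>x\<in>?K. 2 * of_bool (card (N x) = 3) :: int) = 0"
    using closed_excess_zero[OF total KV component_closed] by simp
  then have "\<forall>x\<in>?K. card (N x) \<noteq> 3"
    using fin by (subst (asm) sum_nonneg_eq_0_iff) auto
  then show ?thesis using card_N_le by (metis le_antisym not_less_eq_eq numeral_2_eq_2 numeral_3_eq_3)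
qed

lemma component_path:
  assumes w: "w \<in> V" and deg: "\<forall>x\<in>component w. card (N x) \<le> 2"
  obtains ws where "distinct ws" "set ws = component w"
    "\<And>i. i < length ws \<Longrightarrow> N (ws ! i) = {ws ! j |j. j < length ws \<and> (j = Suc i \<or> i = Suc j)}"
proof -
  let ?K = "component w"
  have KV: "?K \<subseteq> V" using component_sub[OF w] N_sub by blast
  then have finK: "finite ?K" using finite_V finite_subset by blast
  \<comment> \<open>In a cycle all degrees are 2 and the all-ones vector is in the kernel.
    Nonsingularity gives a vertex of odd degree instead, hence a leaf.\<close>
  obtain l where "odd (card (N l \<inter> ?K))" using nonsingular[OF KV] component_self by blast
  then have l: "odd (card (N l \<inter> ?K))" and "N l \<inter> ?K \<noteq> {}" by auto
  then have lK: "l \<in> ?K" using component_closed N_sym by blast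
  have "N l \<inter> ?K = N l" using component_closed[OF lK] by blast
  then have l1: "card (N l) = 1" using l deg lK by (metis One_nat_def even_zero le_SucE le_zero_eq numeral_2_eq_2 dvd_refl)
  define P where "P ws \<longleftrightarrow> distinct ws \<and> ws \<noteq> [] \<and> ws ! 0 = l \<and> set ws \<subseteq> ?K \<and>
    (\<forall>i. Suc i < length ws \<longrightarrow> ws ! Suc i \<in> N (ws ! i))" for ws
  have P0: "P [l]" using lK unfolding P_def by simp
  have bound: "length ws < Suc (card ?K)" if "P ws" for ws
    using that finK card_mono distinct_card unfolding P_def by (metis le_imp_less_Suc)
  \<comment> \<open>A longest path starting at the leaf: maximality keeps the neighbours of its end
    on the path, and the degree bound keeps those of its inner vertices there.\<close>
  obtain ws where ws: "P ws" and max: "\<And>vs. P vs \<Longrightarrow> length vs \<le> length ws"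
    using ex_has_greatest_nat[of P "[l]" length "Suc (card ?K)"] P0 bound by metis
  let ?n = "length ws"
  have D: "distinct ws" and n0: "0 < ?n" and h: "ws ! 0 = l" and sK: "set ws \<subseteq> ?K"
    and st: "\<And>i. Suc i < ?n \<Longrightarrow> ws ! Suc i \<in> N (ws ! i)"
    using ws unfolding P_def by auto
  have eq: "ws ! i = ws ! j \<longleftrightarrow> i = j" if "i < ?n" "j < ?n" for i j
    using D that by (simp add: nth_eq_iff_index_eq)
  have inK: "ws ! i \<in> ?K" if "i < ?n" for i using sK that by auto
  have last: "N (ws ! (?n - 1)) \<subseteq> set ws"
  proof
    fix y assume y: "y \<in> N (ws ! (?n - 1))"
    show "y \<in> set ws"
    proof (rule ccontr)
      assume "y \<notin> set ws"
      moreover have "y \<in> N (ws ! i)" if "Suc i = ?n" for i using y that by (metis diff_Suc_1)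
      moreover have "y \<in> ?K" using y component_closed inK[of "?n - 1"] n0 by auto
      ultimately have "P (ws @ [y])"
        unfolding P_def using D n0 h sK st y by (auto simp: nth_append less_Suc_eq)
      from max[OF this] show False by simp
    qed
  qed
  have inner: "N (ws ! Suc i) = {ws ! i, ws ! Suc (Suc i)}" if i: "Suc (Suc i) < ?n" for i
  proof -
    have "{ws ! i, ws ! Suc (Suc i)} \<subseteq> N (ws ! Suc i)" using st[of i] st[of "Suc i"] N_sym i by auto
    moreover have "card {ws ! i, ws ! Suc (Suc i)} = 2" using eq i by simp
    moreover have "card (N (ws ! Suc i)) \<le> 2" using deg inK i by auto
    ultimately show ?thesis using card_seteq[OF finite_N, of "{ws ! i, ws ! Suc (Suc i)}" "ws ! Suc i"] by simp
  qed
  have first: "N (ws ! 0) = {ws ! 1}" if "1 < ?n"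
    using N1[of "ws ! 1" "ws ! 0"] st[of 0] l1 h that by simp
  have n1: "1 < ?n"
  proof (rule ccontr)
    assume "\<not> 1 < ?n"
    then have "?n = 1" using n0 by linarith
    then have "N l \<subseteq> set ws" "set ws = {l}" using last h by (auto simp: in_set_conv_nth)
    then show False using l1 N_irrefl[of l] by (metis card_1_singletonE insert_subset singletonD)
  qed
  define m where "m = ?n - 2"
  have nm: "?n = Suc (Suc m)" using n1 unfolding m_def by simp
  have lastN: "N (ws ! Suc m) = {ws ! m}"
  proof -
    have "y = ws ! m" if y: "y \<in> N (ws ! Suc m)" for y
    proof -
      have "y \<in> set ws" using last y nm by auto
      then obtain j where j: "j < ?n" "y = ws ! j" by (auto simp: in_set_conv_nth)
      then have y2: "ws ! Suc m \<in> N (ws ! j)" using N_sym[OF y] by simp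
      have "j \<noteq> Suc m" using y j N_irrefl by auto
      show ?thesis
      proof (cases j)
        case 0
        then have "ws ! Suc m = ws ! 1" using y2 first n1 by simp
        then show ?thesis using eq[of "Suc m" 1] nm 0 j by simp
      next
        case (Suc i)
        then have "ws ! Suc m \<in> {ws ! i, ws ! Suc (Suc i)}"
          using y2 inner[of i] \<open>j \<noteq> Suc m\<close> j nm by simp
        then have "Suc m = i \<or> Suc m = Suc (Suc i)"
          using eq[of "Suc m" i] eq[of "Suc m" "Suc (Suc i)"] Suc j nm \<open>j \<noteq> Suc m\<close> by auto
        then show ?thesis using Suc j nm by auto
      qed
    qed
    moreover have "ws ! m \<in> N (ws ! Suc m)" using N_sym[OF st[of m]] nm by simp
    ultimately show ?thesis by blast
  qed
  have N: "N (ws ! i) = {ws ! j |j. j < ?n \<and> (j = Suc i \<or> i = Suc j)}" if i: "i < ?n" for i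
  proof (cases i)
    case 0
    then show ?thesis using first n1 by auto
  next
    case (Suc k)
    show ?thesis
    proof (cases "k = m")
      case True
      then show ?thesis using lastN nm Suc by auto
    next
      case False
      then show ?thesis using inner[of k] nm Suc i by auto
    qed
  qed
  have "?K \<subseteq> set ws"
  proof -
    have "component l \<subseteq> set ws"
      by (rule component_sub) (use h n0 N in \<open>auto simp: in_set_conv_nth\<close>)
    then have "w \<in> set ws" using component_sym[OF lK] by blast
    then show ?thesis by (rule component_sub) (use N in \<open>auto simp: in_set_conv_nth\<close>)
  qed
  then show ?thesis using that[OF D _ N] sK by blast
qed

end

section \<open>Hermitian matrices with unit entries\<close>

definition gaussian_int :: "complex \<Rightarrow> bool" where
  "gaussian_int z \<longleftrightarrow> (\<exists>a b. z = Complex (of_int a) (of_int b))"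

text \<open>For a Gaussian integer this is its residue modulo \<open>1 + i\<close>: it is odd
  exactly if \<open>Complex 1 1\<close> does not divide it.\<close>

definition gaussian_odd :: "complex \<Rightarrow> bool" where
  "gaussian_odd z \<longleftrightarrow> odd (\<lfloor>Re z\<rfloor> + \<lfloor>Im z\<rfloor>)"

lemma gaussian_intI: "gaussian_int (Complex (of_int a) (of_int b))"
  unfolding gaussian_int_def by blast

lemma gaussian_intE:
  assumes "gaussian_int z" obtains a b where "z = Complex (of_int a) (of_int b)" "gaussian_odd z = odd (a + b)"
  using assms unfolding gaussian_int_def gaussian_odd_def by auto

lemma gaussian_odd_Complex [simp]: "gaussian_odd (Complex (of_int a) (of_int b)) \<longleftrightarrow> odd (a + b)"
  unfolding gaussian_odd_def by simp

lemma gaussian_int_add [intro]: "gaussian_int w \<Longrightarrow> gaussian_int z \<Longrightarrow> gaussian_int (w + z)"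
  by (elim gaussian_intE) (auto simp: complex_add simp flip: of_int_add intro: gaussian_intI)

lemma gaussian_int_minus [intro]: "gaussian_int z \<Longrightarrow> gaussian_int (- z)"
  by (elim gaussian_intE) (auto simp: complex_minus simp flip: of_int_minus intro: gaussian_intI)

lemma gaussian_int_diff [intro]: "gaussian_int w \<Longrightarrow> gaussian_int z \<Longrightarrow> gaussian_int (w - z)"
  using gaussian_int_add[of w "- z"] gaussian_int_minus by simp

lemma gaussian_int_mult [intro]: "gaussian_int w \<Longrightarrow> gaussian_int z \<Longrightarrow> gaussian_int (w * z)"
  by (elim gaussian_intE) (auto simp: complex_mult simp flip: of_int_add of_int_mult of_int_diff intro: gaussian_intI)

lemma gaussian_int_cnj [intro]: "gaussian_int z \<Longrightarrow> gaussian_int (cnj z)"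
  by (elim gaussian_intE) (auto simp: complex_cnj simp flip: of_int_minus intro: gaussian_intI)

lemma gaussian_int_of_int [simp]: "gaussian_int (of_int k)"
  unfolding gaussian_int_def by (rule exI[of _ k], rule exI[of _ 0]) (simp add: complex_eq_iff)

lemma gaussian_int_0 [simp]: "gaussian_int 0" and gaussian_int_1 [simp]: "gaussian_int 1"
  and gaussian_int_numeral [simp]: "gaussian_int (numeral k)" and gaussian_int_nat [simp]: "gaussian_int (of_nat m)"
  using gaussian_int_of_int[of 0] gaussian_int_of_int[of 1] gaussian_int_of_int[of "numeral k"]
    gaussian_int_of_int[of "int m"] by simp_all

lemma gaussian_int_ii [simp]: "gaussian_int \<i>"
  unfolding gaussian_int_def by (rule exI[of _ 0], rule exI[of _ 1]) (simp add: complex_eq_iff)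

lemma gaussian_int_sum: "(\<And>a. a \<in> A \<Longrightarrow> gaussian_int (f a)) \<Longrightarrow> gaussian_int (\<Sum>a\<in>A. f a)"
  by (induction A rule: infinite_finite_induct) auto

lemma gaussian_odd_add:
  "gaussian_int w \<Longrightarrow> gaussian_int z \<Longrightarrow> gaussian_odd (w + z) \<longleftrightarrow> gaussian_odd w \<noteq> gaussian_odd z"
  by (elim gaussian_intE) (simp add: complex_add flip: of_int_add, presburger)

lemma gaussian_odd_minus: "gaussian_int z \<Longrightarrow> gaussian_odd (- z) \<longleftrightarrow> gaussian_odd z"
  by (elim gaussian_intE) (simp add: complex_minus flip: of_int_minus, blast)

lemma gaussian_odd_diff:
  "gaussian_int w \<Longrightarrow> gaussian_int z \<Longrightarrow> gaussian_odd (w - z) \<longleftrightarrow> gaussian_odd w \<noteq> gaussian_odd z"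
  using gaussian_odd_add[of w "- z"] gaussian_odd_minus gaussian_int_minus by simp

lemma gaussian_odd_mult:
  "gaussian_int w \<Longrightarrow> gaussian_int z \<Longrightarrow> gaussian_odd (w * z) \<longleftrightarrow> gaussian_odd w \<and> gaussian_odd z"
  by (elim gaussian_intE) (simp add: complex_mult flip: of_int_add of_int_mult of_int_diff, blast)

lemma gaussian_odd_cnj: "gaussian_int z \<Longrightarrow> gaussian_odd (cnj z) \<longleftrightarrow> gaussian_odd z"
  by (elim gaussian_intE) (simp add: complex_cnj flip: of_int_minus)

lemma gaussian_odd_of_int [simp]: "gaussian_odd (of_int k) \<longleftrightarrow> odd k"
  unfolding gaussian_odd_def by simp

lemma gaussian_odd_simps [simp]:
  "\<not> gaussian_odd 0" "gaussian_odd 1" "gaussian_odd \<i>" "gaussian_odd (numeral k) \<longleftrightarrow> odd (numeral k :: int)"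
  using gaussian_odd_of_int[of 0] gaussian_odd_of_int[of 1] gaussian_odd_of_int[of "numeral k"]
  by (simp_all add: gaussian_odd_def)

lemma gaussian_odd_sum:
  assumes "\<And>a. a \<in> A \<Longrightarrow> gaussian_int (f a)" "\<And>a. a \<in> A \<Longrightarrow> gaussian_odd (f a) \<longleftrightarrow> odd (g a :: nat)"
  shows "gaussian_odd (\<Sum>a\<in>A. f a) \<longleftrightarrow> odd (\<Sum>a\<in>A. g a)"
  using assms
  by (induction A rule: infinite_finite_induct) (auto simp: gaussian_odd_add gaussian_int_sum)

text \<open>\<open>a^2 + b^2\<close> and \<open>a + b\<close> have the same parity.\<close>

lemma gaussian_int_norm:
  assumes "gaussian_int z"
  obtains k :: nat where "(cmod z)\<^sup>2 = of_nat k" "gaussian_odd z \<longleftrightarrow> odd k"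
proof -
  obtain a b where z: "z = Complex (of_int a) (of_int b)" "gaussian_odd z = odd (a + b)"
    using assms by (rule gaussian_intE)
  have "(cmod z)\<^sup>2 = of_int (a\<^sup>2 + b\<^sup>2)" by (simp add: z(1) cmod_power2)
  also have "\<dots> = of_nat (nat (a\<^sup>2 + b\<^sup>2))" by (simp add: of_nat_nat)
  finally show ?thesis using that[of "nat (a\<^sup>2 + b\<^sup>2)"] z(2) by (simp add: even_nat_iff)
qed

lemma gaussian_int_zero: "gaussian_int z \<Longrightarrow> (cmod z)\<^sup>2 < 1 \<Longrightarrow> z = 0"
  by (elim gaussian_int_norm) auto

lemma gaussian_int_even_zero: "gaussian_int z \<Longrightarrow> \<not> gaussian_odd z \<Longrightarrow> (cmod z)\<^sup>2 < 2 \<Longrightarrow> z = 0"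
proof (elim gaussian_int_norm)
  fix k assume *: "\<not> gaussian_odd z" "(cmod z)\<^sup>2 < 2" "(cmod z)\<^sup>2 = real k" "gaussian_odd z = odd k"
  then have "k < 2" "even k" by auto
  then have "k = 0" by presburger
  then show "z = 0" using * by simp
qed

lemma gaussian_odd_norm_ge_1: "gaussian_int z \<Longrightarrow> gaussian_odd z \<Longrightarrow> 1 \<le> (cmod z)\<^sup>2"
  by (elim gaussian_int_norm) (metis of_nat_1 of_nat_mono One_nat_def Suc_leI odd_pos)

lemma gaussian_even_div:
  assumes "gaussian_int z" "\<not> gaussian_odd z"
  shows "\<exists>w. gaussian_int w \<and> z = Complex 1 1 * w"
proof -
  obtain a b where z: "z = Complex (of_int a) (of_int b)" "gaussian_odd z = odd (a + b)"
    using assms(1) by (rule gaussian_intE)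
  then have "even (a + b)" "even (b - a)" using assms(2) by auto
  then obtain c d where "a + b = 2 * c" "b - a = 2 * d" by (elim evenE)
  then have "a = c - d" "b = c + d" by auto
  then have "z = Complex 1 1 * Complex (of_int c) (of_int d)" by (simp add: z(1) complex_eq_iff)
  then show ?thesis using gaussian_intI by blast
qed


lemma sum_of_bool_card: "finite A \<Longrightarrow> (\<Sum>a\<in>A. of_bool (P a)) = of_nat (card {a \<in> A. P a})"
  by (simp add: of_bool_def sum.If_cases Int_def)

lemma even_ge_2: "even k \<Longrightarrow> k \<noteq> 0 \<Longrightarrow> 2 \<le> (k :: nat)"
  by presburger

lemma odd_ge_3: "odd k \<Longrightarrow> k \<noteq> 1 \<Longrightarrow> 3 \<le> (k :: nat)"
  by presburger

section \<open>The matrix \<open>H\<close> as a function on indices, and the form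
  \<open>4 - H^2\<close>\<close>

locale unit_hermitian =
  fixes n :: nat and h :: "nat \<Rightarrow> nat \<Rightarrow> complex"
  assumes herm: "h j i = cnj (h i j)"
    and diag: "h i i = 0"
    and entry: "h i j \<in> {0, 1, - 1, \<i>, - \<i>}"
    and supp: "h i j \<noteq> 0 \<Longrightarrow> i < n \<and> j < n"
begin

definition ap :: "(nat \<Rightarrow> complex) \<Rightarrow> nat \<Rightarrow> complex" where
  "ap x i = (\<Sum>j<n. h i j * x j)"

definition nbr :: "nat \<Rightarrow> nat set" where
  "nbr i = {j. h i j \<noteq> 0}"

text \<open>The value of the form \<open>4 - H^2\<close> at \<open>x\<close>; because
  \<open>H\<close> is Hermitian, the second term is the squared length of \<open>H x\<close>.
  Likewise \<open>bil\<close> is its sesquilinear version, and \<open>sq\<close> gives the entries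
  of \<open>H^2\<close>.\<close>

definition quad :: "(nat \<Rightarrow> complex) \<Rightarrow> real" where
  "quad x = 4 * (\<Sum>i<n. (cmod (x i))\<^sup>2) - (\<Sum>i<n. (cmod (ap x i))\<^sup>2)"

definition bil :: "(nat \<Rightarrow> complex) \<Rightarrow> (nat \<Rightarrow> complex) \<Rightarrow> complex" where
  "bil x y = 4 * (\<Sum>i<n. cnj (x i) * y i) - (\<Sum>i<n. cnj (ap x i) * ap y i)"

definition sq :: "nat \<Rightarrow> nat \<Rightarrow> complex" where
  "sq i j = (\<Sum>k<n. h i k * h k j)"

definition nrm :: "nat list \<Rightarrow> int \<Rightarrow> bool" where
  "nrm xs k \<longleftrightarrow> set xs \<subseteq> {..<n} \<and>
     (\<exists>x. (\<forall>i<n. gaussian_int (x i) \<and> (gaussian_odd (x i) \<longleftrightarrow> odd (count_list xs i))) \<and> quad x \<le> of_int k)"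

lemma gaussian_int_h [simp]: "gaussian_int (h i j)"
  using entry[of i j] by (auto intro!: gaussian_int_minus)

lemma gaussian_odd_h: "gaussian_odd (h i j) \<longleftrightarrow> j \<in> nbr i"
  using entry[of i j] by (auto simp: nbr_def gaussian_odd_minus)

lemma cmod_h: "j \<in> nbr i \<Longrightarrow> cmod (h i j) = 1"
  using entry[of i j] by (auto simp: nbr_def)

lemma h_eq_0: "j \<notin> nbr i \<Longrightarrow> h i j = 0"
  by (simp add: nbr_def)

lemma nbr_sub: "nbr i \<subseteq> {..<n}"
  using supp by (auto simp: nbr_def)

lemma nbr_sym: "j \<in> nbr i \<Longrightarrow> i \<in> nbr j"
  using herm[of i j] by (auto simp: nbr_def)

lemma nbr_irrefl: "i \<notin> nbr i"
  by (simp add: nbr_def diag)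

lemma finite_nbr [simp]: "finite (nbr i)"
  using nbr_sub finite_subset by blast

lemma gaussian_int_ap: "(\<And>j. j < n \<Longrightarrow> gaussian_int (x j)) \<Longrightarrow> gaussian_int (ap x i)"
  unfolding ap_def by (intro gaussian_int_sum gaussian_int_mult) auto

lemma gaussian_odd_ap:
  assumes "\<And>j. j < n \<Longrightarrow> gaussian_int (x j)" "\<And>j. j < n \<Longrightarrow> gaussian_odd (x j) \<longleftrightarrow> odd (g j :: nat)"
  shows "gaussian_odd (ap x i) \<longleftrightarrow> odd (\<Sum>j<n. of_bool (j \<in> nbr i) * g j)"
  unfolding ap_def
  by (rule gaussian_odd_sum) (use assms in \<open>auto simp: gaussian_odd_mult gaussian_odd_h\<close>)

lemma bil_self: "bil x x = of_real (quad x)"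
proof -
  have *: "cnj z * z = of_real ((cmod z)\<^sup>2)" for z
    by (metis complex_norm_square mult.commute)
  show ?thesis unfolding bil_def quad_def * by simp
qed

lemma bil_cnj: "cnj (bil x y) = bil y x"
  unfolding bil_def by (simp add: mult.commute)

lemma ap_diff: "ap (\<lambda>i. x i - c * y i) i = ap x i - c * ap y i"
  unfolding ap_def by (simp add: algebra_simps sum_subtractf sum_distrib_left)

lemma ap_add: "ap (\<lambda>i. x i + y i) i = ap x i + ap y i"
  unfolding ap_def by (simp add: algebra_simps sum.distrib)

lemma ap_scale: "ap (\<lambda>i. c * y i) i = c * ap y i"
  unfolding ap_def by (simp add: algebra_simps sum_distrib_left)

lemma bil_diff: "bil z (\<lambda>i. x i - c * y i) = bil z x - c * bil z y"
  unfolding bil_def ap_diff by (simp add: algebra_simps sum_subtractf sum_distrib_left)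

text \<open>An exact projection formula only for \<open>quad y = 1\<close>. The factor
  \<open>2 - quad y\<close> accounts for other norms and is at least 1 whenever
  \<open>quad y\<close> is at most 1, which is all that \<open>nrm\<close> guarantees.\<close>

lemma quad_diff:
  "quad (\<lambda>i. x i - bil y x * y i) = quad x - (2 - quad y) * (cmod (bil y x))\<^sup>2"
proof -
  let ?c = "bil y x" let ?w = "\<lambda>i. x i - ?c * y i"
  have "bil ?w x = of_real (quad x) - cnj ?c * ?c"
    using bil_cnj[of x ?w] by (simp add: bil_diff bil_cnj bil_self)
  moreover have "bil ?w y = cnj ?c - cnj ?c * of_real (quad y)"
    using bil_cnj[of y ?w] by (simp add: bil_diff bil_cnj bil_self)
  ultimately have "bil ?w ?w = of_real (quad x) - cnj ?c * ?c - ?c * (cnj ?c - cnj ?c * of_real (quad y))"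
    by (simp add: bil_diff)
  also have "\<dots> = of_real (quad x) - (2 - of_real (quad y)) * (?c * cnj ?c)"
    by (simp add: algebra_simps)
  also have "\<dots> = of_real (quad x - (2 - quad y) * (cmod ?c)\<^sup>2)"
    by (simp add: complex_norm_square[symmetric])
  finally show ?thesis using bil_self[of ?w] of_real_eq_iff by metis
qed

lemma ap_adjoint: "(\<Sum>i<n. cnj (x i) * ap y i) = (\<Sum>i<n. cnj (ap x i) * y i)"
proof -
  have "(\<Sum>i<n. cnj (x i) * ap y i) = (\<Sum>j<n. (\<Sum>i<n. cnj (x i) * h i j) * y j)"
    unfolding ap_def sum_distrib_left sum_distrib_right by (subst sum.swap) (simp add: algebra_simps)
  moreover have "(\<Sum>i<n. cnj (x i) * h i j) = cnj (ap x j)" for j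
    unfolding ap_def cnj_sum by (rule sum.cong) (auto simp: herm[of _ j])
  ultimately show ?thesis by (simp only:)
qed

lemma sum_common: "set xs \<subseteq> {..<n} \<Longrightarrow> (\<Sum>j<n. of_bool (j \<in> nbr i) * count_list xs j) = (\<Sum>x\<leftarrow>xs. of_bool (x \<in> nbr i))"
proof (induction xs)
  case (Cons x xs)
  have "(\<Sum>j<n. of_bool (j \<in> nbr i) * count_list (x # xs) j)
      = (\<Sum>j<n. of_bool (j \<in> nbr i) * count_list xs j) + (\<Sum>j<n. if j = x then of_bool (j \<in> nbr i) else 0)"
    unfolding sum.distrib[symmetric] by (rule sum.cong) auto
  then show ?case using Cons by simp
qed simp

text \<open>Modulo 2 this is the inner product of \<open>H x\<close> and \<open>H y\<close> for
  vectors with odd entries at the vertices listed oddly in \<open>xs\<close> and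
  \<open>ys\<close>.\<close>

lemma sum_common2:
  "(\<Sum>i<n. (\<Sum>x\<leftarrow>xs. of_bool (x \<in> nbr i)) * (\<Sum>y\<leftarrow>ys. of_bool (y \<in> nbr i)))
     = (\<Sum>x\<leftarrow>xs. \<Sum>y\<leftarrow>ys. card (nbr x \<inter> nbr y))"
proof -
  have c: "(\<Sum>i<n. of_bool (x \<in> nbr i) * of_bool (y \<in> nbr i)) = card (nbr x \<inter> nbr y)" for x y
  proof -
    have "(\<Sum>i<n. of_bool (x \<in> nbr i) * of_bool (y \<in> nbr i)) = card {i \<in> {..<n}. x \<in> nbr i \<and> y \<in> nbr i}"
      unfolding of_bool_conj[symmetric] by (subst sum_of_bool_card) simp_all
    also have "{i \<in> {..<n}. x \<in> nbr i \<and> y \<in> nbr i} = nbr x \<inter> nbr y"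
      using nbr_sub nbr_sym by blast
    finally show ?thesis .
  qed
  have 1: "(\<Sum>i<n. of_bool (x \<in> nbr i) * (\<Sum>y\<leftarrow>ys. of_bool (y \<in> nbr i))) = (\<Sum>y\<leftarrow>ys. card (nbr x \<inter> nbr y))" for x
    by (induction ys) (simp_all add: distrib_left sum.distrib c del: sum_of_bool_mult_eq sum_mult_of_bool_eq)
  show ?thesis by (induction xs) (simp_all add: distrib_right sum.distrib 1 del: sum_of_bool_mult_eq sum_mult_of_bool_eq)
qed

end

text \<open>\<open>unimodular\<close> is invertibility of \<open>H\<close> modulo \<open>p\<close>,
  stated for vectors: if \<open>p\<close> divides \<open>H x\<close> then it divides
  \<open>x\<close>. The values used are \<open>1 + i\<close>, 3 and 5.\<close>

locale definite_hermitian = unit_hermitian +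
  assumes posdef: "\<lbrakk>i < n; x i \<noteq> 0\<rbrakk> \<Longrightarrow> 0 < quad x"
    and unimodular: "\<lbrakk>\<And>i. i < n \<Longrightarrow> gaussian_int (x i);
        \<And>i. i < n \<Longrightarrow> \<exists>z. gaussian_int z \<and> ap x i = p * z; i < n\<rbrakk> \<Longrightarrow> \<exists>z. gaussian_int z \<and> x i = p * z"
begin

definition unit :: "nat \<Rightarrow> nat \<Rightarrow> complex" where
  "unit v i = of_bool (i = v)"

lemma sum_unit: "v < n \<Longrightarrow> (\<Sum>i<n. f i * unit v i) = f v"
  unfolding unit_def by (simp add: of_bool_def if_distrib sum.delta cong: if_cong)

lemma ap_unit: "v < n \<Longrightarrow> ap (unit v) i = h i v"
  unfolding ap_def by (rule sum_unit)

lemma gaussian_int_unit [simp]: "gaussian_int (unit v i)"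
  unfolding unit_def by simp

lemma sum_cmod_h: "(\<Sum>i<n. (cmod (h i v))\<^sup>2) = card (nbr v)"
proof -
  have "(cmod (h i v))\<^sup>2 = of_bool (i \<in> nbr v)" for i
    using cmod_h[of v i] h_eq_0[of v i] nbr_sym[of i v] nbr_sym[of v i] by (cases "i \<in> nbr v") auto
  then have "(\<Sum>i<n. (cmod (h i v))\<^sup>2) = (\<Sum>i<n. of_bool (i \<in> nbr v))" by simp
  also have "\<dots> = card {i \<in> {..<n}. i \<in> nbr v}" by (rule sum_of_bool_card) simp
  also have "{i \<in> {..<n}. i \<in> nbr v} = nbr v" using nbr_sub by blast
  finally show ?thesis .
qed

lemma quad_unit: assumes "v < n" shows "quad (unit v) = 4 - real (card (nbr v))"
proof -
  have "(\<Sum>i<n. (cmod (unit v i))\<^sup>2) = (\<Sum>i<n. 1 * of_bool (i = v))"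
    by (rule sum.cong) (simp_all add: unit_def)
  also have "\<dots> = 1" using assms by simp
  finally show ?thesis unfolding quad_def by (simp add: ap_unit[OF assms] sum_cmod_h)
qed

lemma bil_unit: assumes "v < n" "w < n" "v \<noteq> w" shows "bil (unit v) (unit w) = - sq v w"
proof -
  have "(\<Sum>i<n. cnj (unit v i) * unit w i) = 0"
    using sum_unit[OF assms(2), of "\<lambda>i. cnj (unit v i)"] assms(3) by (simp add: unit_def)
  then show ?thesis unfolding bil_def sq_def by (simp add: ap_unit assms flip: herm)
qed

lemma nrm_single: "x < n \<Longrightarrow> nrm [x] (4 - int (card (nbr x)))"
  unfolding nrm_def by (intro conjI exI[of _ "unit x"]) (auto simp: quad_unit, auto simp: unit_def)

lemma nrm_pos: assumes "nrm xs k" "odd (count_list xs v)" shows "0 < k"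
proof -
  obtain x where x: "\<And>i. i < n \<Longrightarrow> gaussian_int (x i) \<and> (gaussian_odd (x i) \<longleftrightarrow> odd (count_list xs i))"
    and q: "quad x \<le> of_int k" and s: "set xs \<subseteq> {..<n}" using assms(1) unfolding nrm_def by blast
  have "v \<in> set xs" using assms(2) by (metis count_list_0_iff even_zero)
  then have v: "v < n" using s by auto
  then have "x v \<noteq> 0" using x[OF v] assms(2) by auto
  then have "0 < quad x" by (rule posdef[OF v])
  then show ?thesis using q by linarith
qed

lemma gaussian_int_bil:
  "(\<And>i. i < n \<Longrightarrow> gaussian_int (x i)) \<Longrightarrow> (\<And>i. i < n \<Longrightarrow> gaussian_int (y i)) \<Longrightarrow> gaussian_int (bil x y)"
  unfolding bil_def
  by (intro gaussian_int_diff gaussian_int_mult gaussian_int_sum gaussian_int_cnj gaussian_int_ap gaussian_int_numeral) auto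

text \<open>The part with the factor 4 is even. In the other part every unit entry of
  \<open>H\<close> has residue 1, so only the underlying graph matters.\<close>

lemma gaussian_odd_bil:
  assumes x: "\<And>i. i < n \<Longrightarrow> gaussian_int (x i)" "\<And>i. i < n \<Longrightarrow> gaussian_odd (x i) \<longleftrightarrow> odd (count_list xs i)"
    and y: "\<And>i. i < n \<Longrightarrow> gaussian_int (y i)" "\<And>i. i < n \<Longrightarrow> gaussian_odd (y i) \<longleftrightarrow> odd (count_list ys i)"
    and s: "set xs \<subseteq> {..<n}" "set ys \<subseteq> {..<n}"
  shows "gaussian_odd (bil x y) \<longleftrightarrow> odd (\<Sum>x\<leftarrow>xs. \<Sum>y\<leftarrow>ys. card (nbr x \<inter> nbr y))"
proof -
  have i: "gaussian_int (\<Sum>i<n. cnj (x i) * y i)" "gaussian_int (\<Sum>i<n. cnj (ap x i) * ap y i)"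
    using x(1) y(1) by (intro gaussian_int_sum gaussian_int_mult gaussian_int_cnj gaussian_int_ap; simp)+
  have "gaussian_odd (bil x y) \<longleftrightarrow> gaussian_odd (\<Sum>i<n. cnj (ap x i) * ap y i)"
    unfolding bil_def using i by (subst gaussian_odd_diff) (auto simp: gaussian_odd_mult)
  also have "\<dots> \<longleftrightarrow> odd (\<Sum>i<n. (\<Sum>x\<leftarrow>xs. of_bool (x \<in> nbr i)) * (\<Sum>y\<leftarrow>ys. of_bool (y \<in> nbr i)) :: nat)"
  proof (rule gaussian_odd_sum)
    fix i
    show "gaussian_int (cnj (ap x i) * ap y i)"
      using x(1) y(1) by (intro gaussian_int_mult gaussian_int_cnj gaussian_int_ap)
    show "gaussian_odd (cnj (ap x i) * ap y i) =
      odd ((\<Sum>x\<leftarrow>xs. of_bool (x \<in> nbr i)) * (\<Sum>y\<leftarrow>ys. of_bool (y \<in> nbr i)) :: nat)"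
    proof -
      have "gaussian_odd (ap x i) \<longleftrightarrow> odd (\<Sum>x\<leftarrow>xs. of_bool (x \<in> nbr i) :: nat)"
        unfolding sum_common[OF s(1), symmetric] by (rule gaussian_odd_ap) (use x in auto)
      moreover have "gaussian_odd (ap y i) \<longleftrightarrow> odd (\<Sum>y\<leftarrow>ys. of_bool (y \<in> nbr i) :: nat)"
        unfolding sum_common[OF s(2), symmetric] by (rule gaussian_odd_ap) (use y in auto)
      ultimately show ?thesis
        using gaussian_int_ap[of x i] gaussian_int_ap[of y i] x(1) y(1)
        by (simp add: gaussian_odd_mult gaussian_int_cnj gaussian_odd_cnj)
    qed
  qed
  also have "\<dots> \<longleftrightarrow> odd (\<Sum>x\<leftarrow>xs. \<Sum>y\<leftarrow>ys. card (nbr x \<inter> nbr y))"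
    by (simp only: sum_common2)
  finally show ?thesis .
qed

lemma nrm_reduce:
  assumes "nrm xs k" "nrm ys 1" "odd (\<Sum>x\<leftarrow>xs. \<Sum>y\<leftarrow>ys. card (nbr x \<inter> nbr y))"
  shows "nrm (xs @ ys) (k - 1)"
proof -
  obtain x where x: "\<And>i. i < n \<Longrightarrow> gaussian_int (x i)" "\<And>i. i < n \<Longrightarrow> gaussian_odd (x i) \<longleftrightarrow> odd (count_list xs i)"
    and qx: "quad x \<le> of_int k" and sx: "set xs \<subseteq> {..<n}" using assms(1) unfolding nrm_def by blast
  obtain y where y: "\<And>i. i < n \<Longrightarrow> gaussian_int (y i)" "\<And>i. i < n \<Longrightarrow> gaussian_odd (y i) \<longleftrightarrow> odd (count_list ys i)"
    and qy: "quad y \<le> of_int 1" and sy: "set ys \<subseteq> {..<n}" using assms(2) unfolding nrm_def by blast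
  have g: "gaussian_int (bil y x)" by (rule gaussian_int_bil[OF y(1) x(1)])
  have "gaussian_odd (bil x y)" using gaussian_odd_bil[OF x y sx sy] assms(3) by simp
  then have o: "gaussian_odd (bil y x)" using gaussian_odd_cnj[OF gaussian_int_bil[OF x(1) y(1)]] by (simp add: bil_cnj)
  \<comment> \<open>The coefficient is odd, so \<open>?z\<close> agrees with \<open>x + y\<close>
    modulo \<open>1 + i\<close>, as recorded by \<open>xs @ ys\<close>; its squared modulus is at
    least 1, whence the drop of the norm.\<close>
  let ?z = "\<lambda>i. x i - bil y x * y i"
  have "1 \<le> (2 - quad y) * (cmod (bil y x))\<^sup>2"
    using mult_mono[of 1 "2 - quad y" 1 "(cmod (bil y x))\<^sup>2"] qy gaussian_odd_norm_ge_1[OF g o] by simp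
  then have "quad ?z \<le> of_int (k - 1)" using qx by (simp add: quad_diff)
  moreover have "gaussian_int (?z i) \<and> (gaussian_odd (?z i) \<longleftrightarrow> odd (count_list (xs @ ys) i))" if "i < n" for i
    using x y g o that by (auto simp: gaussian_odd_diff gaussian_odd_mult gaussian_int_mult)
  ultimately show ?thesis unfolding nrm_def using sx sy by (intro conjI exI[of _ ?z]) auto
qed

text \<open>If all counts were even, \<open>1 + i\<close> would divide \<open>H\<close> applied to
  the indicator of \<open>S\<close>, hence the indicator itself, whose entry 1 is odd.\<close>

lemma nonsingular: assumes "S \<subseteq> {..<n}" "S \<noteq> {}" shows "\<exists>v. odd (card (nbr v \<inter> S))"
proof (rule ccontr)
  assume ne: "\<not> ?thesis"
  let ?x = "\<lambda>i. of_bool (i \<in> S) :: complex"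
  have gx: "gaussian_int (?x i)" for i by simp
  have "gaussian_odd (ap ?x i) \<longleftrightarrow> odd (\<Sum>j<n. of_bool (j \<in> nbr i) * of_bool (j \<in> S) :: nat)" for i
    by (rule gaussian_odd_ap) auto
  moreover have "(\<Sum>j<n. of_bool (j \<in> nbr i) * of_bool (j \<in> S) :: nat) = card (nbr i \<inter> S)" for i
  proof -
    have "(\<Sum>j<n. of_bool (j \<in> nbr i) * of_bool (j \<in> S)) = card {j \<in> {..<n}. j \<in> nbr i \<and> j \<in> S}"
      unfolding of_bool_conj[symmetric] by (subst sum_of_bool_card) simp_all
    also have "{j \<in> {..<n}. j \<in> nbr i \<and> j \<in> S} = nbr i \<inter> S" using assms by blast
    finally show ?thesis .
  qed
  ultimately have "\<not> gaussian_odd (ap ?x i)" for i using ne by simp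
  then have ev: "\<exists>z. gaussian_int z \<and> ap ?x i = Complex 1 1 * z" for i
    using gaussian_even_div gaussian_int_ap[of ?x i] gx by blast
  obtain v where v: "v \<in> S" "v < n" using assms by auto
  obtain z where z: "gaussian_int z" "?x v = Complex 1 1 * z" using unimodular[OF gx ev v(2)] by metis
  have "gaussian_odd (1 :: complex) \<longleftrightarrow> gaussian_odd (Complex 1 1) \<and> gaussian_odd z"
    using z v gaussian_odd_mult[OF gaussian_intI[of 1 1] z(1)] by simp
  then show False by (simp add: gaussian_odd_def)
qed

sublocale binary_norm_graph "{..<n}" nbr nrm
  by unfold_locales
    (use nbr_sub nbr_sym nbr_irrefl nrm_single nrm_reduce nrm_pos nonsingular in \<open>auto\<close>)

lemma sq_self: "sq x x = card (nbr x)"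
proof -
  have "sq x x = (\<Sum>i<n. of_real ((cmod (h i x))\<^sup>2))"
    unfolding sq_def by (rule sum.cong) (simp_all add: herm[of x] complex_norm_square[symmetric] mult.commute flip: of_real_power)
  also have "\<dots> = of_real (\<Sum>i<n. (cmod (h i x))\<^sup>2)" by simp
  finally show ?thesis by (simp add: sum_cmod_h)
qed

lemma sq_cnj: "cnj (sq x y) = sq y x"
  unfolding sq_def by (simp add: herm[symmetric] mult.commute)

lemma gaussian_int_sq: "gaussian_int (sq x y)"
  unfolding sq_def by (intro gaussian_int_sum gaussian_int_mult) auto

lemma gaussian_odd_sq: "gaussian_odd (sq x y) \<longleftrightarrow> odd (card (nbr x \<inter> nbr y))"
proof -
  have "gaussian_odd (sq x y) \<longleftrightarrow> odd (\<Sum>k<n. of_bool (k \<in> nbr x) * of_bool (k \<in> nbr y) :: nat)"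
    unfolding sq_def by (rule gaussian_odd_sum)
      (auto simp: gaussian_odd_mult gaussian_odd_h intro: nbr_sym)
  also have "(\<Sum>k<n. of_bool (k \<in> nbr x) * of_bool (k \<in> nbr y) :: nat) = card {k \<in> {..<n}. k \<in> nbr x \<and> k \<in> nbr y}"
    unfolding of_bool_conj[symmetric] by (subst sum_of_bool_card) simp_all
  also have "{k \<in> {..<n}. k \<in> nbr x \<and> k \<in> nbr y} = nbr x \<inter> nbr y" using nbr_sub by blast
  finally show ?thesis .
qed

text \<open>Positivity for \<open>unit y\<close> projected off the norm 1 vector
  \<open>unit x\<close>. The inequality is strict because the projection has entry 1 at
  \<open>y\<close>.\<close>

lemma cauchy_schwarz_cubic:
  assumes "card (nbr x) = 3" "y < n" "x \<noteq> y" shows "(cmod (sq x y))\<^sup>2 < 4 - real (card (nbr y))"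
proof -
  have x: "x < n" using card_in_V[of x 2] assms(1) by simp
  have "0 < quad (\<lambda>i. unit y i - bil (unit x) (unit y) * unit x i)"
    by (rule posdef[OF assms(2)]) (use assms in \<open>simp add: unit_def\<close>)
  then have "0 < quad (unit y) - (2 - quad (unit x)) * (cmod (bil (unit x) (unit y)))\<^sup>2"
    by (simp only: quad_diff)
  then show ?thesis
    by (simp add: quad_unit[OF x] quad_unit[OF assms(2)] bil_unit[OF x assms(2,3)] assms(1))
qed

lemma sq_zero: "nbr x \<inter> nbr y = {} \<Longrightarrow> sq x y = 0"
  unfolding sq_def by (rule sum.neutral) (metis disjoint_iff h_eq_0 mult_eq_0_iff nbr_sym)

text \<open>Two common neighbours make the degree of \<open>y\<close> at least 2, so the squared
  modulus is below 2; an even Gaussian integer that small is 0.\<close>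

lemma sq_even_cubic:
  assumes "card (nbr x) = 3" "x \<noteq> y" "even (card (nbr x \<inter> nbr y))" shows "sq x y = 0"
proof (cases "nbr x \<inter> nbr y = {}")
  case False
  then have y: "y < n" using in_V(1) by blast
  have "card (nbr x \<inter> nbr y) \<noteq> 0" using False by simp
  then have "2 \<le> card (nbr x \<inter> nbr y)" using assms(3) even_ge_2 by blast
  also have "\<dots> \<le> card (nbr y)" by (rule card_mono) auto
  finally have "(cmod (sq x y))\<^sup>2 < 2" using cauchy_schwarz_cubic[OF assms(1) y assms(2)] by simp
  then show ?thesis using gaussian_int_even_zero gaussian_int_sq gaussian_odd_sq assms(3) by blast
qed (rule sq_zero)

text \<open>Parity becomes an exact value here: the two walks through two common neighbours must
  cancel. If neither vertex is cubic, both have degree 2 and are twins.\<close>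

lemma sq_even:
  assumes "x \<noteq> y" "even (card (nbr x \<inter> nbr y))" shows "sq x y = 0"
proof (cases "nbr x \<inter> nbr y = {}")
  case False
  then have "card (nbr x \<inter> nbr y) \<noteq> 0" by simp
  then have 2: "2 \<le> card (nbr x \<inter> nbr y)" using assms(2) even_ge_2 by blast
  have "card (nbr x \<inter> nbr y) \<le> card (nbr x)" "card (nbr x \<inter> nbr y) \<le> card (nbr y)" by (rule card_mono; simp)+
  then consider "card (nbr x) = 3" | "card (nbr y) = 3" | "card (nbr x) = 2" "card (nbr y) = 2"
    using 2 card_N_le[of x] card_N_le[of y] by linarith
  then show ?thesis
  proof cases
    case 1
    then show ?thesis using sq_even_cubic assms by blast
  next
    case 2
    then have "sq y x = 0" using sq_even_cubic[of y x] assms by (simp add: Int_commute)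
    then show ?thesis using sq_cnj[of y x] by simp
  next
    case 3
    then have "nbr x \<inter> nbr y = nbr x" "nbr x \<inter> nbr y = nbr y"
      using 2 card_seteq[of "nbr x" "nbr x \<inter> nbr y"] card_seteq[of "nbr y" "nbr x \<inter> nbr y"] by auto
    then have "nbr x = nbr y" by simp
    moreover have "x < n" using False in_V(1) by blast
    ultimately show ?thesis using no_twins assms(1) by blast
  qed
qed (rule sq_zero)

text \<open>Three common neighbours would need two cubic vertices, against
  \<open>even_cubic\<close>. With a single one, the entry of \<open>H^2\<close> is a product of two
  units.\<close>

lemma sq_odd:
  assumes "x \<noteq> y" "odd (card (nbr x \<inter> nbr y))" shows "card (nbr x \<inter> nbr y) = 1" "cmod (sq x y) = 1"
proof -
  have le: "card (nbr x \<inter> nbr y) \<le> card (nbr x)" "card (nbr x \<inter> nbr y) \<le> card (nbr y)" by (rule card_mono; simp)+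
  show 1: "card (nbr x \<inter> nbr y) = 1"
  proof (rule ccontr)
    assume "card (nbr x \<inter> nbr y) \<noteq> 1"
    then have "3 \<le> card (nbr x \<inter> nbr y)" using assms(2) odd_ge_3 by blast
    then have "card (nbr x) = 3" "card (nbr y) = 3" using le card_N_le[of x] card_N_le[of y] by linarith+
    then show False using even_cubic assms by blast
  qed
  then obtain k where k: "nbr x \<inter> nbr y = {k}" by (meson card_1_singletonE)
  then have kn: "k < n" using nbr_sub by auto
  have "h x j * h j y = 0" if "j \<noteq> k" for j using that k h_eq_0 nbr_sym by (metis Int_iff mult_eq_0_iff singletonD)
  then have "(\<Sum>j\<in>{..<n} - {k}. h x j * h j y) = 0" by (intro sum.neutral) auto
  then have "sq x y = h x k * h k y" unfolding sq_def using kn by (subst sum.remove[of _ k]) auto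
  moreover have "cmod (h x k) = 1" "cmod (h k y) = 1" using k nbr_sym cmod_h by blast+
  ultimately show "cmod (sq x y) = 1" by (simp add: norm_mult)
qed

lemma ap_ap: "ap (ap x) i = (\<Sum>k<n. sq i k * x k)"
  unfolding ap_def sq_def sum_distrib_left sum_distrib_right
  by (subst sum.swap) (simp add: mult.assoc)

lemma gaussian_multiple_norm:
  assumes "z = of_nat p * w" "gaussian_int w" "cmod z = of_nat q" shows "p dvd q"
proof -
  obtain k where "(cmod w)\<^sup>2 = of_nat k" using gaussian_int_norm[OF assms(2)] by metis
  then have "of_nat (q\<^sup>2) = (of_nat (p\<^sup>2 * k) :: real)"
    using assms(1,3) by (metis norm_mult norm_of_nat of_nat_mult of_nat_power power_mult_distrib)
  then have "p\<^sup>2 dvd q\<^sup>2" by (metis of_nat_eq_iff dvd_triv_left)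
  then show ?thesis by simp
qed

sublocale parity_graph "{..<n}" nbr nrm
proof unfold_locales
  fix x assume c: "card (nbr x) = 3"
  then have x: "x < n" using card_in_V[of x 2] by simp
  show "\<exists>y. y \<noteq> x \<and> odd (card (nbr x \<inter> nbr y))"
  proof (rule ccontr)
    assume "\<not> ?thesis"
    then have 0: "sq x y = 0" if "y \<noteq> x" for y using sq_even_cubic[OF c] that by auto
    have "ap (\<lambda>i. h i x) i = 3 * unit x i" for i
    proof -
      have "ap (\<lambda>i. h i x) i = sq i x" unfolding ap_def sq_def ..
      also have "\<dots> = cnj (sq x i)" by (simp add: sq_cnj)
      also have "\<dots> = 3 * unit x i" using 0[of i] sq_self[of x] c by (simp add: unit_def)
      finally show ?thesis .
    qed
    then have "\<exists>z. gaussian_int z \<and> h i x = 3 * z" if "i < n" for i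
      using unimodular[of "\<lambda>i. h i x" 3 i] that gaussian_int_unit by (metis gaussian_int_h)
    moreover obtain i where i: "i \<in> nbr x" using c by fastforce
    moreover have "i < n" using i nbr_sub by blast
    ultimately obtain z where "gaussian_int z" "h i x = of_nat 3 * z" by (metis of_nat_numeral)
    moreover have "cmod (h i x) = of_nat 1" using cmod_h nbr_sym[OF i] by simp
    ultimately have "(3::nat) dvd 1" using gaussian_multiple_norm by blast
    then show False by simp
  qed
next
  fix x y assume cards: "card (nbr x) = 3" "card (nbr y) = 2" and o: "odd (card (nbr x \<inter> nbr y))"
  have xy: "x < n" "y < n" using card_in_V[of x 2] card_in_V[of y 1] cards by simp_all
  have ne: "x \<noteq> y" using cards by auto
  show "\<exists>z. z \<noteq> x \<and> z \<noteq> y \<and> (odd (card (nbr x \<inter> nbr z)) \<or> odd (card (nbr y \<inter> nbr z)))"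
  proof (rule ccontr)
    assume "\<not> ?thesis"
    then have 0: "sq x z = 0" "sq y z = 0" if "z \<noteq> x" "z \<noteq> y" for z using sq_even that by auto
    define c where "c = sq y x"
    have s0: "sq z x = 0" "sq z y = 0" if "z \<noteq> x" "z \<noteq> y" for z
      using 0[OF that] sq_cnj by (metis complex_cnj_zero)+
    have nc: "cnj c * c = 1"
      using sq_odd(2)[OF ne o] sq_cnj[of x y] sq_cnj[of y x] complex_norm_square[of "sq x y"] by (simp add: c_def)
    \<comment> \<open>\<open>?w\<close> is column \<open>x\<close> of \<open>H^2\<close>. On the
      plane of the two basis vectors \<open>H^2\<close> has diagonal 3, 2 and off-diagonal units, so
      \<open>H^2\<close> sends \<open>3 e_x + c e_y\<close> to \<open>10 e_x + 5 c e_y\<close>.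
      Applying \<open>unimodular\<close> twice makes 5 divide the entry 3.\<close>
    let ?w = "\<lambda>i. sq i x"
    have w: "?w i = 3 * unit x i + c * unit y i" for i
      using s0[of i] ne sq_self[of x] cards by (auto simp: unit_def c_def)
    have www: "ap (ap ?w) i = 5 * (2 * unit x i + c * unit y i)" for i
    proof -
      have "ap (ap ?w) i = (\<Sum>k<n. (3 * sq i k) * unit x k) + (\<Sum>k<n. (c * sq i k) * unit y k)"
        unfolding ap_ap sum.distrib[symmetric] by (rule sum.cong) (simp_all add: w algebra_simps)
      also have "\<dots> = 3 * sq i x + c * sq i y" by (simp only: sum_unit xy)
      also have "\<dots> = 5 * (2 * unit x i + c * unit y i)"
        using s0[of i] ne sq_self[of x] sq_self[of y] cards nc sq_cnj[of y x, folded c_def, symmetric]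
        by (auto simp: unit_def c_def[symmetric] mult.commute)
      finally show ?thesis .
    qed
    have gw: "gaussian_int (?w i)" for i by (rule gaussian_int_sq)
    have g5: "gaussian_int (2 * unit x i + c * unit y i)" for i
      unfolding c_def by (intro gaussian_int_add gaussian_int_mult gaussian_int_sq) auto
    have "\<exists>z. gaussian_int z \<and> ap ?w i = 5 * z" if "i < n" for i
      using unimodular[of "ap ?w" 5 i] that www g5 gaussian_int_ap[of ?w] gw by metis
    then have "\<exists>z. gaussian_int z \<and> ?w i = 5 * z" if "i < n" for i
      using unimodular[of ?w 5 i] that gw by metis
    then obtain z where "gaussian_int z" "sq x x = of_nat 5 * z" using xy by (metis of_nat_numeral)
    moreover have "cmod (sq x x) = of_nat 3" by (simp add: sq_self cards)
    ultimately have "(5::nat) dvd 3" using gaussian_multiple_norm by blast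
    then show False by simp
  qed
qed

end

text \<open>The left sides are the traces of \<open>H^2\<close> and \<open>H^4\<close>, both
  matrices \<open>H\<close> and \<open>H^2\<close> being Hermitian; the right sides are the values
  for the path.\<close>

locale spectral_hermitian = definite_hermitian +
  assumes trace2: "(\<Sum>i<n. \<Sum>j<n. (cmod (h i j))\<^sup>2) = 2 * real n - 2"
    and trace4: "(\<Sum>i<n. \<Sum>j<n. (cmod (sq i j))\<^sup>2) = 6 * real n - 10"
begin

lemma sum_degrees: "(\<Sum>i<n. int (card (nbr i))) = 2 * int n - 2"
proof -
  have "(\<Sum>j<n. (cmod (h i j))\<^sup>2) = card (nbr i)" for i
    using sum_cmod_h[of i] by (simp add: herm[of i])
  then have "real_of_int (\<Sum>i<n. int (card (nbr i))) = real_of_int (2 * int n - 2)" using trace2 by simp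
  then show ?thesis by linarith
qed

text \<open>Walks of length two from \<open>i\<close>, counted by their end and by their
  midpoint.\<close>

lemma sum_card_common: "(\<Sum>j<n. int (card (nbr i \<inter> nbr j))) = (\<Sum>k\<in>nbr i. int (card (nbr k)))"
proof -
  have 1: "int (card (nbr i \<inter> nbr j)) = (\<Sum>k\<in>nbr i. of_bool (j \<in> nbr k))" for j
    using N_sym_iff[of j] by (subst sum_of_bool_card) (auto simp: Int_def)
  have "(\<Sum>j<n. of_bool (j \<in> nbr k) :: int) = card (nbr k)" for k
    using nbr_sub[of k] by (subst sum_of_bool_card) (auto simp: Int_absorb1 intro!: arg_cong[of _ _ card])
  then show ?thesis unfolding 1 by (subst sum.swap) simp
qed

text \<open>Off the diagonal, a squared entry is 1 for one common neighbour and 0 for none or two.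
  So it is the number of common neighbours, corrected by 2 for each pair with exactly two.\<close>

lemma row_square:
  assumes "i < n"
  shows "(\<Sum>j<n. (cmod (sq i j))\<^sup>2)
     = real_of_int ((int (card (nbr i)))\<^sup>2 + (\<Sum>k\<in>nbr i. int (card (nbr k))) - int (card (nbr i))
         - 2 * int (card {y. y \<noteq> i \<and> card (nbr i \<inter> nbr y) = 2}))"
proof -
  have val: "(cmod (sq i j))\<^sup>2 = real_of_int (int (card (nbr i \<inter> nbr j)) - 2 * of_bool (card (nbr i \<inter> nbr j) = 2))"
    if "j \<noteq> i" for j
  proof (cases "even (card (nbr i \<inter> nbr j))")
    case True
    have "card (nbr i \<inter> nbr j) \<le> card (nbr i)" by (rule card_mono) auto
    then have "card (nbr i \<inter> nbr j) \<le> 3" using card_N_le[of i] by linarith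
    then have "card (nbr i \<inter> nbr j) = 0 \<or> card (nbr i \<inter> nbr j) = 2" using True even_ge_2[OF True] by force
    then show ?thesis using sq_even[OF that[symmetric] True] by auto
  next
    case False
    then show ?thesis using sq_odd[OF that[symmetric]] by simp
  qed
  have two: "{y. y \<noteq> i \<and> card (nbr i \<inter> nbr y) = 2} = {y \<in> {..<n} - {i}. card (nbr i \<inter> nbr y) = 2}"
  proof -
    have "y < n" if "card (nbr i \<inter> nbr y) = 2" for y
    proof -
      have "nbr i \<inter> nbr y \<noteq> {}" using that by auto
      then show ?thesis using in_V(1) by blast
    qed
    then show ?thesis by auto
  qed
  have "(\<Sum>j<n. (cmod (sq i j))\<^sup>2) = (cmod (sq i i))\<^sup>2 + (\<Sum>j\<in>{..<n} - {i}. (cmod (sq i j))\<^sup>2)"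
    using assms by (intro sum.remove) auto
  also have "(\<Sum>j\<in>{..<n} - {i}. (cmod (sq i j))\<^sup>2)
      = (\<Sum>j\<in>{..<n} - {i}. real_of_int (int (card (nbr i \<inter> nbr j)) - 2 * of_bool (card (nbr i \<inter> nbr j) = 2)))"
    by (rule sum.cong[OF refl], rule val) auto
  also have "\<dots> = real_of_int ((\<Sum>j\<in>{..<n} - {i}. int (card (nbr i \<inter> nbr j)))
      - 2 * (\<Sum>j\<in>{..<n} - {i}. of_bool (card (nbr i \<inter> nbr j) = 2)))"
    by (simp only: sum_subtractf sum_distrib_left flip: of_int_sum)
  also have "(\<Sum>j\<in>{..<n} - {i}. of_bool (card (nbr i \<inter> nbr j) = 2) :: int) = card {y. y \<noteq> i \<and> card (nbr i \<inter> nbr y) = 2}"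
    unfolding two by (rule sum_of_bool_card) simp
  also have "(\<Sum>j\<in>{..<n} - {i}. int (card (nbr i \<inter> nbr j))) = (\<Sum>k\<in>nbr i. int (card (nbr k))) - int (card (nbr i))"
    using assms by (simp add: sum_diff1 sum_card_common)
  finally show ?thesis by (simp add: sq_self)
qed

lemma excess_total: "(\<Sum>i<n. excess i) = 0"
proof -
  let ?d = "\<lambda>i. int (card (nbr i))"
  let ?p = "\<lambda>i. int (card {y. y \<noteq> i \<and> card (nbr i \<inter> nbr y) = 2})"
  have swap: "(\<Sum>i<n. \<Sum>k\<in>nbr i. ?d k) = (\<Sum>k<n. (?d k)\<^sup>2)"
  proof -
    have "(\<Sum>k\<in>nbr i. ?d k) = (\<Sum>k<n. of_bool (k \<in> nbr i) * ?d k)" for i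
    proof -
      have "nbr i = {..<n} \<inter> {k. k \<in> nbr i}" using nbr_sub by blast
      then show ?thesis by simp
    qed
    then have "(\<Sum>i<n. \<Sum>k\<in>nbr i. ?d k) = (\<Sum>k<n. (\<Sum>i<n. of_bool (k \<in> nbr i)) * ?d k)"
      by (simp only: sum_distrib_right) (rule sum.swap)
    moreover have "(\<Sum>i<n. of_bool (k \<in> nbr i) :: int) = ?d k" for k
    proof -
      have "(\<Sum>i<n. of_bool (k \<in> nbr i) :: int) = card {i \<in> {..<n}. k \<in> nbr i}"
        by (rule sum_of_bool_card) simp
      also have "{i \<in> {..<n}. k \<in> nbr i} = nbr k" using nbr_sub nbr_sym by blast
      finally show ?thesis .
    qed
    ultimately show ?thesis by (simp add: power2_eq_square)
  qed
  have "real_of_int (6 * int n - 10) = (\<Sum>i<n. \<Sum>j<n. (cmod (sq i j))\<^sup>2)" using trace4 by simp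
  also have "\<dots> = (\<Sum>i<n. real_of_int ((?d i)\<^sup>2 + (\<Sum>k\<in>nbr i. ?d k) - ?d i - 2 * ?p i))"
    by (rule sum.cong) (simp_all only: lessThan_iff row_square)
  also have "\<dots> = real_of_int (\<Sum>i<n. (?d i)\<^sup>2 + (\<Sum>k\<in>nbr i. ?d k) - ?d i - 2 * ?p i)"
    by (simp only: of_int_sum)
  also have "(\<Sum>i<n. (?d i)\<^sup>2 + (\<Sum>k\<in>nbr i. ?d k) - ?d i - 2 * ?p i) = (\<Sum>i<n. 2 * (?d i)\<^sup>2 - ?d i - 2 * ?p i)"
    by (simp only: sum_subtractf sum.distrib swap sum_distrib_left[symmetric])
  \<comment> \<open>For degrees 1, 2 and 3, \<open>2 d^2 - d\<close> equals \<open>5 d - 4\<close>,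
    with an additional 4 if \<open>d = 3\<close>. So the sum of squares reduces to the sum of
    degrees, known from the trace of \<open>H^2\<close>.\<close>
  also have "\<dots> = (\<Sum>i<n. 5 * ?d i - 4 + 2 * excess i)"
  proof (rule sum.cong[OF refl])
    fix i assume "i \<in> {..<n}"
    then consider "?d i = 1" | "?d i = 2" | "?d i = 3" using card_N_cases[of i] by force
    then show "2 * (?d i)\<^sup>2 - ?d i - 2 * ?p i = 5 * ?d i - 4 + 2 * excess i"
      unfolding excess_def by cases auto
  qed
  also have "\<dots> = 5 * (\<Sum>i<n. ?d i) - 4 * int n + 2 * (\<Sum>i<n. excess i)"
    by (simp add: sum_subtractf sum.distrib sum_distrib_left)
  also have "\<dots> = 6 * int n - 10 + 2 * (\<Sum>i<n. excess i)" using sum_degrees by simp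
  finally show ?thesis by linarith
qed

end

section \<open>The largest eigenvalue of the path\<close>

lemma unit_mult_cnj: "cmod c = 1 \<Longrightarrow> cnj c * c = 1" "cmod c = 1 \<Longrightarrow> c * cnj c = 1"
  using complex_norm_square[of c] by (simp_all add: mult.commute)

text \<open>Solving the equations from the top expresses \<open>q\<close> and \<open>r\<close> by
  \<open>p\<close>. The phases \<open>c\<close> and \<open>e\<close> only enter as unit factors, and
  what remains is the characteristic polynomial of the real tridiagonal matrix.\<close>

lemma tridiagonal3:
  fixes t :: complex
  assumes c: "cmod c = 1" "cmod e = 1"
    and eq: "t * p = d1 * p + c * q" "t * q = d2 * q + (cnj c * p + e * r)" "t * r = d3 * r + cnj e * q"
    and nz: "p \<noteq> 0 \<or> q \<noteq> 0 \<or> r \<noteq> 0"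
  shows "(t - d3) * ((t - d2) * (t - d1) - 1) - (t - d1) = 0"
proof -
  note u = unit_mult_cnj[OF c(1)] unit_mult_cnj[OF c(2)]
  have q: "q = cnj c * ((t - d1) * p)" 
  proof -
    have "cnj c * ((t - d1) * p) = cnj c * c * q" using eq(1) by (simp add: algebra_simps)
    then show ?thesis using u by simp
  qed
  have r: "r = cnj e * (cnj c * (((t - d2) * (t - d1) - 1) * p))"
  proof -
    have "cnj e * e * r = cnj e * ((t - d2) * q - cnj c * p)" using eq(2) by (simp add: algebra_simps)
    then show ?thesis using u by (simp add: q algebra_simps)
  qed
  have "cnj e * cnj c * (((t - d3) * ((t - d2) * (t - d1) - 1) - (t - d1)) * p) = (t - d3) * r - cnj e * q"
    unfolding q r by (simp add: algebra_simps)
  also have "\<dots> = 0" using eq(3) by (simp add: algebra_simps)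
  finally have "cnj e = 0 \<or> cnj c = 0 \<or> ((t - d3) * ((t - d2) * (t - d1) - 1) - (t - d1)) = 0 \<or> p = 0" by simp
  moreover have "p \<noteq> 0" using nz q r by auto
  moreover have "cnj e \<noteq> 0" "cnj c \<noteq> 0" using c by auto
  ultimately show ?thesis by blast
qed

lemma tridiagonal4:
  fixes t :: complex
  assumes c: "cmod c = 1" "cmod e = 1" "cmod f = 1"
    and eq: "t * p = d1 * p + c * q" "t * q = d2 * q + (cnj c * p + e * r)"
      "t * r = d3 * r + (cnj e * q + f * s)" "t * s = d4 * s + cnj f * r"
    and nz: "p \<noteq> 0 \<or> q \<noteq> 0 \<or> r \<noteq> 0 \<or> s \<noteq> 0"
  shows "(t - d4) * ((t - d3) * ((t - d2) * (t - d1) - 1) - (t - d1)) - ((t - d2) * (t - d1) - 1) = 0"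
proof -
  note u = unit_mult_cnj[OF c(1)] unit_mult_cnj[OF c(2)] unit_mult_cnj[OF c(3)]
  have q: "q = cnj c * ((t - d1) * p)" 
  proof -
    have "cnj c * ((t - d1) * p) = cnj c * c * q" using eq(1) by (simp add: algebra_simps)
    then show ?thesis using u by simp
  qed
  have r: "r = cnj e * (cnj c * (((t - d2) * (t - d1) - 1) * p))"
  proof -
    have "cnj e * e * r = cnj e * ((t - d2) * q - cnj c * p)" using eq(2) by (simp add: algebra_simps)
    then show ?thesis using u by (simp add: q algebra_simps)
  qed
  have s: "s = cnj f * (cnj e * (cnj c * (((t - d3) * ((t - d2) * (t - d1) - 1) - (t - d1)) * p)))"
  proof -
    have "cnj f * f * s = cnj f * ((t - d3) * r - cnj e * q)" using eq(3) by (simp add: algebra_simps)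
    then show ?thesis using u by (simp add: q r algebra_simps)
  qed
  have "cnj f * cnj e * cnj c * (((t - d4) * ((t - d3) * ((t - d2) * (t - d1) - 1) - (t - d1)) - ((t - d2) * (t - d1) - 1)) * p)
      = (t - d4) * s - cnj f * r"
    unfolding s r by (simp add: algebra_simps)
  also have "\<dots> = 0" using eq(4) by (simp add: algebra_simps)
  finally have "cnj f = 0 \<or> cnj e = 0 \<or> cnj c = 0 \<or>
      ((t - d4) * ((t - d3) * ((t - d2) * (t - d1) - 1) - (t - d1)) - ((t - d2) * (t - d1) - 1)) = 0 \<or> p = 0" by simp
  moreover have "p \<noteq> 0" using nz q r s by auto
  moreover have "cnj f \<noteq> 0" "cnj e \<noteq> 0" "cnj c \<noteq> 0" using c by auto
  ultimately show ?thesis by blast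
qed

text \<open>By \<open>sq_even\<close> and \<open>sq_odd\<close>, the positions of the nonzero
  off-diagonal entries in row \<open>i\<close> of \<open>H^2\<close>.\<close>

definition partners :: "nat list list \<Rightarrow> nat \<Rightarrow> nat list" where
  "partners G i = filter (\<lambda>j. j \<noteq> i \<and> odd (card (set (G ! i) \<inter> set (G ! j)))) [0..<length G]"

lemma partners_graph6: "partners graph6 1 = [4]" "partners graph6 4 = [1,3]" "partners graph6 3 = [4]"
  by code_simp+
lemma partners_graph8a: "partners graph8a 3 = [4]" "partners graph8a 4 = [1,3]" "partners graph8a 1 = [4,6]"
  "partners graph8a 6 = [1]"
  by code_simp+
lemma partners_graph8b: "partners graph8b 3 = [4]" "partners graph8b 4 = [1,3,7]" "partners graph8b 1 = [4,7]"
  "partners graph8b 7 = [1,4]"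
  by code_simp+
lemma partners_graph8c: "partners graph8c 0 = [7]" "partners graph8c 7 = [0,5]" "partners graph8c 5 = [2,7]"
  "partners graph8c 2 = [5]"
  by code_simp+

lemma card_graph6: "card (set (graph6 ! 1)) = 3" "card (set (graph6 ! 4)) = 1" "card (set (graph6 ! 3)) = 2"
  by (simp_all add: graph6_def)
lemma card_graph8a: "card (set (graph8a ! 3)) = 2" "card (set (graph8a ! 4)) = 1" "card (set (graph8a ! 1)) = 3"
  "card (set (graph8a ! 6)) = 2"
  by (simp_all add: graph8a_def)
lemma card_graph8b: "card (set (graph8b ! 3)) = 2" "card (set (graph8b ! 4)) = 2" "card (set (graph8b ! 1)) = 3"
  "card (set (graph8b ! 7)) = 2"
  by (simp_all add: graph8b_def)
lemma card_graph8c: "card (set (graph8c ! 0)) = 3" "card (set (graph8c ! 7)) = 1" "card (set (graph8c ! 5)) = 2"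
  "card (set (graph8c ! 2)) = 3"
  by (simp_all add: graph8c_def)

context definite_hermitian begin

text \<open>Projected off \<open>a\<close>, both \<open>y\<close> and \<open>z\<close> have norm 1.
  Their inner product is then a Gaussian integer of modulus below 1, hence 0. This fixes the weight
  of a triangle in \<open>H^2\<close>.\<close>

lemma sq_cubic_triangle:
  assumes c: "card (nbr a) = 3" "card (nbr y) = 2" "card (nbr z) = 2" "y \<noteq> z"
    and o: "odd (card (nbr a \<inter> nbr y))" "odd (card (nbr a \<inter> nbr z))"
  shows "sq y z = - (sq y a * sq a z)"
proof -
  have lt: "a < n" "y < n" "z < n" using card_in_V[of a 2] card_in_V[of y 1] card_in_V[of z 1] c by simp_all
  have ne: "a \<noteq> y" "a \<noteq> z" using c by auto
  let ?a = "unit a" let ?y = "unit y" let ?z = "unit z"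
  define y' where "y' = (\<lambda>i. ?y i - bil ?a ?y * ?a i)"
  define z' where "z' = (\<lambda>i. ?z i - bil ?a ?z * ?a i)"
  have q1: "quad y' = 1" "quad z' = 1"
    unfolding y'_def z'_def quad_diff using sq_odd(2)[OF ne(1) o(1)] sq_odd(2)[OF ne(2) o(2)]
    by (simp_all add: quad_unit lt c bil_unit ne)
  have aa: "bil ?a ?a = 1" by (simp add: bil_self quad_unit lt c)
  have L: "bil y' w = bil ?y w - bil ?y ?a * bil ?a w" for w
  proof -
    have "bil w y' = bil w ?y - bil ?a ?y * bil w ?a" unfolding y'_def by (rule bil_diff)
    then have "cnj (bil w y') = bil ?y w - bil ?y ?a * bil ?a w" by (simp add: bil_cnj)
    then show ?thesis by (simp add: bil_cnj)
  qed
  have B: "bil y' z' = - sq y z - sq y a * sq a z"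
    unfolding z'_def bil_diff L using aa by (simp add: bil_unit lt ne ne[symmetric] assms(4))
  have "0 < quad (\<lambda>i. z' i - bil y' z' * y' i)"
    by (rule posdef[of z]) (use lt ne assms(4) in \<open>auto simp: z'_def y'_def unit_def\<close>)
  then have "(cmod (bil y' z'))\<^sup>2 < 1" by (simp add: quad_diff q1)
  moreover have "gaussian_int (bil y' z')" unfolding B
    by (intro gaussian_int_diff gaussian_int_minus gaussian_int_mult gaussian_int_sq)
  ultimately have "bil y' z' = 0" by (rule gaussian_int_zero[rotated])
  then show ?thesis unfolding B by (metis eq_iff_diff_eq_0 minus_equation_iff)
qed

lemma ap_nbr: "ap x i = (\<Sum>j\<in>nbr i. h i j * x j)"
proof -
  have "ap x i = (\<Sum>j\<in>{..<n}. h i j * x j)" by (simp add: ap_def)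
  also have "\<dots> = (\<Sum>j\<in>nbr i. h i j * x j)"
    by (rule sum.mono_neutral_right) (use nbr_sub h_eq_0 in auto)
  finally show ?thesis .
qed

context
  fixes x :: "nat \<Rightarrow> complex" and l :: complex
  assumes eig: "\<And>i. i < n \<Longrightarrow> ap x i = l * x i"
begin

lemma eig_square: assumes "i < n" shows "(\<Sum>k<n. sq i k * x k) = l\<^sup>2 * x i"
proof -
  have "ap (ap x) i = (\<Sum>j<n. h i j * (l * x j))" unfolding ap_def[of "ap x"] using eig by simp
  also have "\<dots> = l * ap x i" by (simp add: ap_def sum_distrib_left algebra_simps)
  finally show ?thesis using eig[OF assms] by (simp add: ap_ap power2_eq_square)
qed

lemma embeds_lt: assumes "embeds G ws" "connected_list G" "i < length G" "G ! i \<noteq> []" shows "ws ! i < n"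
  using embedsD(3)[OF assms(1,3)] assms(4) in_V(1)[of _ "ws ! i"] by fastforce

text \<open>The eigenvalue equation of \<open>H^2\<close> in row \<open>ws ! i\<close>: the embedded
  graph is closed, so no entry of \<open>H^2\<close> leads out of it.\<close>

lemma embeds_eig_square:
  assumes e: "embeds G ws" and c: "connected_list G" and i: "i < length G" "G ! i \<noteq> []"
  shows "l\<^sup>2 * x (ws ! i) = of_nat (card (set (G ! i))) * x (ws ! i) +
      (\<Sum>j\<leftarrow>partners G i. sq (ws ! i) (ws ! j) * x (ws ! j))" (is ?A)
    and "j \<in> set (partners G i) \<Longrightarrow> cmod (sq (ws ! i) (ws ! j)) = 1"
proof -
  note E = embedsD[OF e]
  have li: "ws ! i < n" by (rule embeds_lt[OF e c i])
  have inj: "inj_on ((!) ws) {..<length G}" using E(1,2) by (simp add: inj_on_def nth_eq_iff_index_eq)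
  note int = embeds_common(1)[OF e c i(1)]
  have ne: "ws ! i \<noteq> ws ! j" if "j < length G" "j \<noteq> i" for j
    using that i E(1,2) by (simp add: nth_eq_iff_index_eq)
  have wsn: "set ws \<subseteq> {..<n}"
    using embeds_sub_V[OF e c, of "ws ! i"] li i E(2) by auto
  show "cmod (sq (ws ! i) (ws ! j)) = 1" if "j \<in> set (partners G i)"
  proof -
    have j: "j < length G" "j \<noteq> i" "odd (card (set (G ! i) \<inter> set (G ! j)))"
      using that unfolding partners_def by auto
    then show ?thesis using sq_odd(2)[OF ne] int[OF j(1)] by simp
  qed
  have z: "sq (ws ! i) k * x k = 0" if "k \<in> {..<n} - set ws" for k
  proof -
    have "nbr (ws ! i) \<inter> nbr k = {}"
    proof (rule ccontr)
      assume "nbr (ws ! i) \<inter> nbr k \<noteq> {}"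
      then obtain y where "y \<in> nbr (ws ! i)" "y \<in> nbr k" by blast
      then have "k \<in> set ws" using embeds_closed[OF e c] nbr_sym i E(2) by (metis nth_mem subsetD)
      then show False using that by simp
    qed
    then show ?thesis using sq_zero by simp
  qed
  have "l\<^sup>2 * x (ws ! i) = (\<Sum>k\<in>set ws. sq (ws ! i) k * x k)"
    using eig_square[OF li] sum.mono_neutral_left[of "{..<n}" "set ws" "\<lambda>k. sq (ws ! i) k * x k"] wsn z by simp
  also have "\<dots> = (\<Sum>j<length G. sq (ws ! i) (ws ! j) * x (ws ! j))"
  proof -
    have "set ws = (!) ws ` {..<length G}" using E(2) by (auto simp: set_conv_nth)
    then show ?thesis using inj by (simp add: sum.reindex)
  qed
  also have "\<dots> = sq (ws ! i) (ws ! i) * x (ws ! i) +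
      (\<Sum>j\<in>{..<length G} - {i}. sq (ws ! i) (ws ! j) * x (ws ! j))"
    using i by (intro sum.remove) auto
  also have "(\<Sum>j\<in>{..<length G} - {i}. sq (ws ! i) (ws ! j) * x (ws ! j)) =
      (\<Sum>j\<in>set (partners G i). sq (ws ! i) (ws ! j) * x (ws ! j))"
  proof (rule sum.mono_neutral_right)
    show "\<forall>j\<in>{..<length G} - {i} - set (partners G i). sq (ws ! i) (ws ! j) * x (ws ! j) = 0"
    proof
      fix j assume "j \<in> {..<length G} - {i} - set (partners G i)"
      then have j: "j < length G" "j \<noteq> i" "even (card (set (G ! i) \<inter> set (G ! j)))"
        unfolding partners_def by auto
      then show "sq (ws ! i) (ws ! j) * x (ws ! j) = 0" using sq_even[OF ne] int[OF j(1)] by simp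
    qed
  qed (auto simp: partners_def)
  also have "\<dots> = (\<Sum>j\<leftarrow>partners G i. sq (ws ! i) (ws ! j) * x (ws ! j))"
    by (rule sum_list_distinct_conv_sum_set[symmetric]) (simp add: partners_def)
  also have "sq (ws ! i) (ws ! i) = of_nat (card (set (G ! i)))"
    by (simp add: sq_self embeds_common(2)[OF e c i(1)])
  finally show ?A .
qed

lemma embeds_eig_zero:
  assumes e: "embeds G ws" and c: "connected_list G" and i: "i < length G" "G ! i \<noteq> []" and l: "l \<noteq> 0"
    and "\<And>j. j \<in> set (G ! i) \<Longrightarrow> x (ws ! j) = 0"
  shows "x (ws ! i) = 0"
proof -
  have "ap x (ws ! i) = 0" unfolding ap_nbr embedsD(3)[OF e i(1)]
    by (rule sum.neutral) (use assms(6) in auto)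
  then show ?thesis using eig[OF embeds_lt[OF e c i]] l by simp
qed

text \<open>\<open>B\<close> will be one colour class of a bipartite graph. If \<open>x\<close>
  vanishes on \<open>B\<close>, its equation with \<open>l\<close> nonzero makes it vanish on the
  other class too.\<close>

lemma embeds_block_nonzero:
  assumes e: "embeds G ws" and c: "connected_list G" and w: "w \<in> set ws" "x w \<noteq> 0" and l: "l \<noteq> 0"
    and B: "\<forall>i<length G. i \<notin> set B \<longrightarrow> set (G ! i) \<subseteq> set B" and ne: "\<forall>i<length G. G ! i \<noteq> []"
  shows "\<exists>i\<in>set B. x (ws ! i) \<noteq> 0"
proof (rule ccontr)
  assume "\<not> ?thesis"
  then have 0: "x (ws ! i) = 0" if "i \<in> set B" for i using that by blast
  obtain i where i: "i < length G" "w = ws ! i" using w embedsD(2)[OF e] by (metis in_set_conv_nth)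
  have "x (ws ! i) = 0"
  proof (cases "i \<in> set B")
    case False
    then have "set (G ! i) \<subseteq> set B" using B i by blast
    then show ?thesis using embeds_eig_zero[OF e c i(1) _ l] ne i 0 by blast
  qed (rule 0)
  then show False using i w by simp
qed


lemma list_nonempty_all: "[] \<notin> set G \<Longrightarrow> i < length G \<Longrightarrow> G ! i \<noteq> []"
  by (metis nth_mem)

text \<open>On the colour class 1, 4, 3, in this order, \<open>H^2\<close> is tridiagonal with
  diagonal 3, 1, 2.\<close>

lemma graph6_eigenvalue:
  assumes e: "embeds graph6 ws" and w: "w \<in> set ws" "x w \<noteq> 0" and l: "l \<noteq> 0"
  shows "(l\<^sup>2)^3 - 6 * (l\<^sup>2)^2 + 9 * l\<^sup>2 - 1 = 0"
proof -
  note c = connected_graphs(1)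
  have len: "length graph6 = 6" and ne: "[] \<notin> set graph6" by (simp_all add: graph6_def)
  note S = embeds_eig_square[OF e c _ list_nonempty_all[OF ne], unfolded len]
  have nz: "x (ws ! 1) \<noteq> 0 \<or> x (ws ! 4) \<noteq> 0 \<or> x (ws ! 3) \<noteq> 0"
    using embeds_block_nonzero[OF e c w l, of "[1,4,3]"] list_nonempty_all[OF ne]
    by (simp add: graph6_def All_less_Suc numeral_eq_Suc)
  have u: "cmod (sq (ws ! 1) (ws ! 4)) = 1" "cmod (sq (ws ! 4) (ws ! 3)) = 1"
    using S(2)[of 1 4] S(2)[of 4 3] by (simp_all add: partners_graph6 del: One_nat_def)
  have "(l\<^sup>2 - 2) * ((l\<^sup>2 - 1) * (l\<^sup>2 - 3) - 1) - (l\<^sup>2 - 3) = 0"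
    by (rule tridiagonal3[OF u _ _ _ nz])
      (use S(1)[of 1] S(1)[of 4] S(1)[of 3] in \<open>simp_all add: card_graph6 partners_graph6 sq_cnj add_ac del: One_nat_def\<close>)
  then show ?thesis by (simp add: algebra_simps power2_eq_square power3_eq_cube)
qed

lemma graph8a_eigenvalue:
  assumes e: "embeds graph8a ws" and w: "w \<in> set ws" "x w \<noteq> 0" and l: "l \<noteq> 0"
  shows "(l\<^sup>2)^4 - 8 * (l\<^sup>2)^3 + 20 * (l\<^sup>2)^2 - 16 * l\<^sup>2 + 1 = 0"
proof -
  note c = connected_graphs(2)
  have len: "length graph8a = 8" and ne: "[] \<notin> set graph8a" by (simp_all add: graph8a_def)
  note S = embeds_eig_square[OF e c _ list_nonempty_all[OF ne], unfolded len]
  have nz: "x (ws ! 3) \<noteq> 0 \<or> x (ws ! 4) \<noteq> 0 \<or> x (ws ! 1) \<noteq> 0 \<or> x (ws ! 6) \<noteq> 0"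
    using embeds_block_nonzero[OF e c w l, of "[3,4,1,6]"] list_nonempty_all[OF ne]
    by (simp add: graph8a_def All_less_Suc numeral_eq_Suc)
  have u: "cmod (sq (ws ! 3) (ws ! 4)) = 1" "cmod (sq (ws ! 4) (ws ! 1)) = 1" "cmod (sq (ws ! 1) (ws ! 6)) = 1"
    using S(2)[of 3 4] S(2)[of 4 1] S(2)[of 1 6] by (simp_all add: partners_graph8a del: One_nat_def)
  have "(l\<^sup>2 - 2) * ((l\<^sup>2 - 3) * ((l\<^sup>2 - 1) * (l\<^sup>2 - 2) - 1) - (l\<^sup>2 - 2)) - ((l\<^sup>2 - 1) * (l\<^sup>2 - 2) - 1) = 0"
    by (rule tridiagonal4[OF u _ _ _ _ nz])
      (use S(1)[of 3] S(1)[of 4] S(1)[of 1] S(1)[of 6] in \<open>simp_all add: card_graph8a partners_graph8a sq_cnj add_ac del: One_nat_def\<close>)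
  then show ?thesis by (simp add: algebra_simps power2_eq_square power3_eq_cube power4_eq_xxxx)
qed

lemma graph8c_eigenvalue:
  assumes e: "embeds graph8c ws" and w: "w \<in> set ws" "x w \<noteq> 0" and l: "l \<noteq> 0"
  shows "(l\<^sup>2)^4 - 9 * (l\<^sup>2)^3 + 26 * (l\<^sup>2)^2 - 24 * l\<^sup>2 + 1 = 0"
proof -
  note c = connected_graphs(4)
  have len: "length graph8c = 8" and ne: "[] \<notin> set graph8c" by (simp_all add: graph8c_def)
  note S = embeds_eig_square[OF e c _ list_nonempty_all[OF ne], unfolded len]
  have nz: "x (ws ! 0) \<noteq> 0 \<or> x (ws ! 7) \<noteq> 0 \<or> x (ws ! 5) \<noteq> 0 \<or> x (ws ! 2) \<noteq> 0"
    using embeds_block_nonzero[OF e c w l, of "[0,7,5,2]"] list_nonempty_all[OF ne]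
    by (simp add: graph8c_def All_less_Suc numeral_eq_Suc)
  have u: "cmod (sq (ws ! 0) (ws ! 7)) = 1" "cmod (sq (ws ! 7) (ws ! 5)) = 1" "cmod (sq (ws ! 5) (ws ! 2)) = 1"
    using S(2)[of 0 7] S(2)[of 7 5] S(2)[of 5 2] by (simp_all add: partners_graph8c del: One_nat_def)
  have "(l\<^sup>2 - 3) * ((l\<^sup>2 - 2) * ((l\<^sup>2 - 1) * (l\<^sup>2 - 3) - 1) - (l\<^sup>2 - 3)) - ((l\<^sup>2 - 1) * (l\<^sup>2 - 3) - 1) = 0"
    by (rule tridiagonal4[OF u _ _ _ _ nz])
      (use S(1)[of 0] S(1)[of 7] S(1)[of 5] S(1)[of 2] in \<open>simp_all add: card_graph8c partners_graph8c sq_cnj add_ac del: One_nat_def\<close>)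
  then show ?thesis by (simp add: algebra_simps power2_eq_square power3_eq_cube power4_eq_xxxx)
qed

text \<open>On the colour class 3, 4, 1, 7 the matrix \<open>H^2\<close> is not tridiagonal, because
  4, 1, 7 are mutual partners. The weight of this triangle comes from
  \<open>sq_cubic_triangle\<close>.\<close>

lemma graph8b_eigenvalue:
  assumes e: "embeds graph8b ws" and w: "w \<in> set ws" "x w \<noteq> 0" and l: "l \<noteq> 0"
  shows "(l\<^sup>2)^4 - 9 * (l\<^sup>2)^3 + 26 * (l\<^sup>2)^2 - 24 * l\<^sup>2 + 1 = 0"
proof -
  note c = connected_graphs(3)
  have len: "length graph8b = 8" and ne: "[] \<notin> set graph8b" by (simp_all add: graph8b_def)
  note S = embeds_eig_square[OF e c _ list_nonempty_all[OF ne], unfolded len]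
  note E = embedsD[OF e]
  let ?b = "ws ! 3" let ?v = "ws ! 4" let ?a = "ws ! 1" let ?z = "ws ! 7"
  have nz: "x ?b \<noteq> 0 \<or> x ?v \<noteq> 0 \<or> x ?a \<noteq> 0 \<or> x ?z \<noteq> 0"
    using embeds_block_nonzero[OF e c w l, of "[3,4,1,7]"] list_nonempty_all[OF ne]
    by (simp add: graph8b_def All_less_Suc numeral_eq_Suc)
  have u: "cmod (sq ?b ?v) = 1" "cmod (sq ?v ?a) = 1" "cmod (sq ?a ?z) = 1" "cmod (sq ?a ?v) = 1"
    using S(2)[of 3 4] S(2)[of 4 1] S(2)[of 1 7] S(2)[of 1 4] by (simp_all add: partners_graph8b del: One_nat_def)
  have d: "ws ! i \<noteq> ws ! j" if "i < 8" "j < 8" "i \<noteq> j" for i j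
    using that E(1,2) len by (simp add: nth_eq_iff_index_eq)
  have N: "nbr ?a = {ws ! 0, ws ! 2, ws ! 5}" "nbr ?v = {ws ! 0, ws ! 6}" "nbr ?z = {ws ! 5, ws ! 6}"
    using E(3)[of 1] E(3)[of 4] E(3)[of 7] by (simp_all add: graph8b_def)
  have tri: "sq ?v ?z = - (sq ?v ?a * sq ?a ?z)"
    by (rule sq_cubic_triangle) (simp_all add: N d del: One_nat_def)
  have tri': "sq ?z ?v = - (sq ?z ?a * sq ?a ?v)"
    using arg_cong[OF tri, of cnj] by (simp add: sq_cnj mult.commute)
  let ?t = "l\<^sup>2"
  \<comment> \<open>The phases along the chain 3, 4, 1, 7 are absorbed into the unknowns. All
    off-diagonal coefficients become 1, except -1 on the edge closing the triangle.\<close>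
  define p where "p = x ?b"
  define q where "q = sq ?b ?v * x ?v"
  define r where "r = sq ?b ?v * (sq ?v ?a * x ?a)"
  define s where "s = sq ?b ?v * (sq ?v ?a * (sq ?a ?z * x ?z))"
  have k: "sq ?v ?b * sq ?b ?v = 1" "sq ?a ?v * sq ?v ?a = 1" "sq ?z ?a * sq ?a ?z = 1"
    using unit_mult_cnj(1)[OF u(1)] unit_mult_cnj(1)[OF u(2)] unit_mult_cnj(1)[OF u(3)] by (simp_all add: sq_cnj del: One_nat_def)
  have e1: "?t * p = 2 * p + q"
    using S(1)[of 3] by (simp add: card_graph8b partners_graph8b p_def q_def del: One_nat_def)
  have e2: "?t * q = 2 * q + p + r - s"
  proof -
    have "?t * x ?v = 2 * x ?v + (sq ?v ?a * x ?a + (sq ?v ?b * x ?b + sq ?v ?z * x ?z))"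
      using S(1)[of 4] by (simp add: card_graph8b partners_graph8b del: One_nat_def)
    from arg_cong[OF this[unfolded tri], of "(*) (sq ?b ?v)"] have "?t * q = 2 * q + r + (sq ?v ?b * sq ?b ?v) * p - s"
      unfolding q_def r_def s_def p_def by (simp add: algebra_simps)
    then show ?thesis by (simp add: k del: One_nat_def)
  qed
  have e3: "?t * r = 3 * r + q + s"
  proof -
    have "?t * x ?a = 3 * x ?a + (sq ?a ?v * x ?v + sq ?a ?z * x ?z)"
      using S(1)[of 1] by (simp add: card_graph8b partners_graph8b del: One_nat_def)
    from arg_cong[OF this, of "(*) (sq ?b ?v * sq ?v ?a)"] have "?t * r = 3 * r + (sq ?a ?v * sq ?v ?a) * q + s"
      unfolding q_def r_def s_def by (simp add: algebra_simps)
    then show ?thesis by (simp add: k del: One_nat_def)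
  qed
  have e4: "?t * s = 2 * s + r - q"
  proof -
    have "?t * x ?z = 2 * x ?z + (sq ?z ?a * x ?a + sq ?z ?v * x ?v)"
      using S(1)[of 7] by (simp add: card_graph8b partners_graph8b del: One_nat_def)
    from arg_cong[OF this[unfolded tri'], of "(*) (sq ?b ?v * (sq ?v ?a * sq ?a ?z))"] have "?t * s = 2 * s + (sq ?z ?a * sq ?a ?z) * r - (sq ?z ?a * sq ?a ?z) * (sq ?a ?v * sq ?v ?a) * q"
      unfolding q_def r_def s_def by (simp add: algebra_simps)
    then show ?thesis by (simp add: k del: One_nat_def)
  qed
  have nz': "p \<noteq> 0 \<or> q \<noteq> 0 \<or> r \<noteq> 0 \<or> s \<noteq> 0"
    using nz u unfolding p_def q_def r_def s_def by auto
  define T where "T = l\<^sup>2"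
  note e1 = e1[folded T_def] and e2 = e2[folded T_def] and e3 = e3[folded T_def] and e4 = e4[folded T_def]
  have q: "q = (T - 2) * p" using e1 by (simp add: algebra_simps)
  have A: "(T - 3) * r = q + s" using e3 by (simp add: algebra_simps)
  have B: "(T - 2) * s = r - q" using e4 by (simp add: algebra_simps)
  have C: "r - s = ((T - 2)^2 - 1) * p" using e2 unfolding q by (simp add: algebra_simps power2_eq_square)
  have "(T^4 - 9 * T^3 + 26 * T^2 - 24 * T + 1) * p = 0"
  proof -
    define D where "D = ((T - 2)^2 - 1) * p"
    have r: "r = s + D" using C by (simp add: D_def algebra_simps)
    have A': "(T - 4) * s = q - (T - 3) * D" using A unfolding r by (simp add: algebra_simps)
    have B': "(T - 3) * s = D - q" using B unfolding r by (simp add: algebra_simps)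
    have "s = (T - 3) * s - (T - 4) * s" by (simp add: algebra_simps)
    then have s: "s = (T - 2) * D - 2 * q" unfolding A' B' by (simp add: algebra_simps)
    have "(T - 3) * ((T - 2) * D - 2 * q) - (D - q) = 0" using B' unfolding s by simp
    moreover have "(T - 3) * ((T - 2) * D - 2 * q) - (D - q) = (T^4 - 9 * T^3 + 26 * T^2 - 24 * T + 1) * p"
      unfolding D_def q by (simp add: algebra_simps power2_eq_square power3_eq_cube power4_eq_xxxx)
    ultimately show ?thesis by simp
  qed
  moreover have "p \<noteq> 0"
  proof
    assume "p = 0"
    then have "q = 0" "r = s" using q C by auto
    then have "(T - 3) * s = s" "(T - 2) * s = s" using A B by auto
    then have "(T - 2) * s - (T - 3) * s = s - s" by (simp only:)
    moreover have "(T - 2) * s - (T - 3) * s = s" by (simp add: algebra_simps)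
    ultimately have "s = 0" by (simp only: diff_self)
    then show False using nz' \<open>p = 0\<close> \<open>q = 0\<close> \<open>r = s\<close> by simp
  qed
  ultimately show ?thesis unfolding T_def by simp
qed

end
end

section \<open>Path components carrying the largest eigenvalue\<close>

lemma sin_recurrence: "2 * cos \<theta> * sin (real (Suc k) * \<theta>) - sin (real k * \<theta>) = sin (real (Suc (Suc k)) * \<theta>)"
proof -
  have "real (Suc (Suc k)) * \<theta> = real (Suc k) * \<theta> + \<theta>" "real k * \<theta> = real (Suc k) * \<theta> - \<theta>"
    by (simp_all add: algebra_simps)
  then show ?thesis by (simp only: sin_add sin_diff) (simp add: algebra_simps)
qed

lemma square_double_cos: "(of_real (2 * cos a) :: complex)\<^sup>2 = of_real (2 + 2 * cos (2 * a))"
proof -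
  have "(2 * cos a)\<^sup>2 = 2 + 2 * cos (2 * a)" by (simp only: cos_double_cos power_mult_distrib) simp
  then show ?thesis by (metis of_real_power)
qed

context definite_hermitian begin

context
  fixes x :: "nat \<Rightarrow> complex" and N :: nat and l :: complex
  assumes eig: "\<And>i. i < n \<Longrightarrow> ap x i = l * x i"
    and l: "l = of_real (2 * cos (pi / N))" and N: "3 \<le> N"
begin

text \<open>Multiplied by the phases accumulated along the path, the eigenvector obeys the
  recurrence of the undirected path, so its entries are proportional to
  \<open>sin ((k + 1) pi / N)\<close>. Vanishing just beyond the last of \<open>m\<close> vertices
  gives \<open>sin ((m + 1) pi / N) = 0\<close>.\<close>

lemma path_component_length:
  assumes w: "w < n" "x w \<noteq> 0" and deg: "\<forall>y\<in>component w. card (nbr y) \<le> 2" and nN: "n < N"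
  obtains ws where "distinct ws" "set ws \<subseteq> {..<n}" "length ws = N - 1"
    "\<And>i. i < length ws \<Longrightarrow> nbr (ws ! i) = {ws ! j |j. j < length ws \<and> (j = Suc i \<or> i = Suc j)}"
proof -
  obtain ws where D: "distinct ws" and S: "set ws = component w"
    and Nb: "\<And>i. i < length ws \<Longrightarrow> nbr (ws ! i) = {ws ! j |j. j < length ws \<and> (j = Suc i \<or> i = Suc j)}"
    using component_path[of w] w(1) deg by auto
  have sub: "set ws \<subseteq> {..<n}" unfolding S using component_sub[of w "{..<n}"] w(1) nbr_sub by auto
  define m where "m = length ws"
  have m0: "0 < m" unfolding m_def using component_self[of w] S by auto
  have mn: "m \<le> n" unfolding m_def using D sub by (metis card_lessThan card_mono distinct_card finite_lessThan)
  define y where "y i = (if i < m then x (ws ! i) else 0)" for i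
  \<comment> \<open>The value 1 past the last edge is multiplied by \<open>y m = 0\<close> and keeps
    the recurrence uniform up to the boundary.\<close>
  define u where "u i = (if Suc i < m then h (ws ! i) (ws ! Suc i) else 1)" for i
  define g where "g i = (\<Prod>k<i. u k)" for i
  have u1: "cnj (u i) * u i = 1" for i
  proof (cases "Suc i < m")
    case True
    then have "ws ! Suc i \<in> nbr (ws ! i)" using Nb[of i] unfolding m_def by auto
    then show ?thesis using True cmod_h unit_mult_cnj(1) by (simp add: u_def)
  next
    case False
    then show ?thesis by (simp add: u_def)
  qed
  have g0: "g i \<noteq> 0" for i unfolding g_def using u1 by (simp add: prod_zero_iff) (metis mult_zero_right zero_neq_one)
  have rec: "l * y i = (if i = 0 then 0 else cnj (u (i - 1)) * y (i - 1)) + u i * y (Suc i)" if i: "i < m" for i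
  proof -
    have lt: "ws ! i < n" using i sub nth_mem[of i ws] unfolding m_def by blast
    have "l * y i = (\<Sum>j\<in>nbr (ws ! i). h (ws ! i) j * x j)"
      using eig[OF lt] i by (simp add: y_def ap_nbr)
    also have "nbr (ws ! i) = (!) ws ` {j. j < m \<and> (j = Suc i \<or> i = Suc j)}"
      using Nb[of i] i unfolding m_def by auto
    also have "(\<Sum>j\<in>(!) ws ` {j. j < m \<and> (j = Suc i \<or> i = Suc j)}. h (ws ! i) j * x j)
        = (\<Sum>j\<in>{j. j < m \<and> (j = Suc i \<or> i = Suc j)}. h (ws ! i) (ws ! j) * y j)"
      by (subst sum.reindex) (use D in \<open>auto simp: inj_on_def nth_eq_iff_index_eq m_def y_def intro!: sum.cong\<close>)
    also have "\<dots> = (if i = 0 then 0 else h (ws ! i) (ws ! (i - 1)) * y (i - 1)) +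
        (if Suc i < m then h (ws ! i) (ws ! Suc i) * y (Suc i) else 0)"
    proof -
      have e: "{j. j < m \<and> (j = Suc i \<or> i = Suc j)} = (if i = 0 then {} else {i - 1}) \<union> (if Suc i < m then {Suc i} else {})"
        using i by auto
      show ?thesis unfolding e by (cases "i = 0"; cases "Suc i < m") auto
    qed
    also have "(if i = 0 then 0 else h (ws ! i) (ws ! (i - 1)) * y (i - 1)) = (if i = 0 then 0 else cnj (u (i - 1)) * y (i - 1))"
      using i herm[of "ws ! i"] by (auto simp: u_def)
    also have "(if Suc i < m then h (ws ! i) (ws ! Suc i) * y (Suc i) else 0) = u i * y (Suc i)"
      by (simp add: u_def y_def)
    finally show ?thesis .
  qed
  let ?\<theta> = "pi / N"
  define z where "z i = g i * y i" for i
  have gS: "g (Suc i) = g i * u i" for i by (simp add: g_def)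
  have z1: "z 1 = l * z 0" using rec[of 0] m0 by (simp add: z_def g_def)
  have zS: "z (Suc (Suc i)) = l * z (Suc i) - z i" if "Suc i < m" for i
  proof -
    have "u (Suc i) * y (Suc (Suc i)) = l * y (Suc i) - cnj (u i) * y i" using rec[OF that] by simp
    then have "z (Suc (Suc i)) = g (Suc i) * (l * y (Suc i) - cnj (u i) * y i)"
      by (simp add: z_def gS mult.assoc)
    also have "\<dots> = l * z (Suc i) - g i * (cnj (u i) * u i) * y i" by (simp add: z_def gS algebra_simps)
    finally show ?thesis by (simp add: u1 z_def)
  qed
  have zs: "of_real (sin ?\<theta>) * z i = of_real (sin (real (Suc i) * ?\<theta>)) * z 0 \<and>
      (i < m \<longrightarrow> of_real (sin ?\<theta>) * z (Suc i) = of_real (sin (real (Suc (Suc i)) * ?\<theta>)) * z 0)" if "i \<le> m" for i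
    using that
  proof (induction i)
    case 0
    have "sin (real (Suc (Suc 0)) * ?\<theta>) = 2 * cos ?\<theta> * sin ?\<theta>" using sin_recurrence[of ?\<theta> 0] by simp
    then show ?case using z1 l by simp
  next
    case (Suc i)
    have IH: "of_real (sin ?\<theta>) * z i = of_real (sin (real (Suc i) * ?\<theta>)) * z 0"
      "of_real (sin ?\<theta>) * z (Suc i) = of_real (sin (real (Suc (Suc i)) * ?\<theta>)) * z 0"
      using Suc by auto
    have "of_real (sin ?\<theta>) * z (Suc (Suc i)) = of_real (sin (real (Suc (Suc (Suc i))) * ?\<theta>)) * z 0" if "Suc i < m"
    proof -
      have "of_real (sin ?\<theta>) * z (Suc (Suc i)) = l * (of_real (sin ?\<theta>) * z (Suc i)) - of_real (sin ?\<theta>) * z i"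
        unfolding zS[OF that] by (simp add: algebra_simps)
      also have "\<dots> = of_real (2 * cos ?\<theta> * sin (real (Suc (Suc i)) * ?\<theta>) - sin (real (Suc i) * ?\<theta>)) * z 0"
        unfolding IH l by (simp add: algebra_simps)
      finally show ?thesis by (simp only: sin_recurrence)
    qed
    then show ?case using IH by blast
  qed
  have "z m = 0" by (simp add: z_def y_def)
  then have "sin (real (Suc m) * ?\<theta>) = 0 \<or> z 0 = 0" using zs[of m] by simp
  moreover have "z 0 \<noteq> 0"
  proof
    assume z0: "z 0 = 0"
    obtain i where i: "i < m" "w = ws ! i" using component_self[of w] S unfolding m_def by (metis in_set_conv_nth)
    have "sin ?\<theta> \<noteq> 0" using N by (intro less_imp_neq[symmetric] sin_gt_zero) (auto simp: field_simps)
    then have "z i = 0" using zs[of i] i z0 by simp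
    then show False using g0[of i] i w(2) by (simp add: z_def y_def)
  qed
  ultimately have sin0: "sin (real (Suc m) * ?\<theta>) = 0" by blast
  \<comment> \<open>Otherwise the angle lies strictly between 0 and pi, where the sine is
    positive.\<close>
  have "\<not> Suc m < N"
  proof
    assume "Suc m < N"
    then have "real (Suc m) * ?\<theta> < real N * ?\<theta>" by (intro mult_strict_right_mono) auto
    also have "\<dots> = pi" using N by simp
    finally have "0 < sin (real (Suc m) * ?\<theta>)" using N by (intro sin_gt_zero mult_pos_pos) auto
    then show False using sin0 by simp
  qed
  then have "length ws = N - 1" using mn nN unfolding m_def by linarith
  then show ?thesis using that D sub Nb by blast
qed

end
end

section \<open>Which angles solve the polynomial equations\<close>

lemma cos_multiples:
  fixes c :: real assumes "c = cos a"
  shows "cos (3 * a) = 4 * c^3 - 3 * c" "cos (4 * a) = 8 * c^4 - 8 * c^2 + 1"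
proof -
  have s: "(sin a)\<^sup>2 = 1 - c\<^sup>2" using assms by (simp add: sin_squared_eq)
  show "cos (3 * a) = 4 * c^3 - 3 * c" using cos_treble_cos[of a] assms by simp
  have "cos (4 * a) = 2 * (cos (2 * a))\<^sup>2 - 1" using cos_double_cos[of "2 * a"] by simp
  also have "cos (2 * a) = 2 * c\<^sup>2 - 1" using cos_double_cos[of a] assms by simp
  finally show "cos (4 * a) = 8 * c^4 - 8 * c^2 + 1" by (simp add: algebra_simps power2_eq_square power4_eq_xxxx)
qed

lemma cos_angle_eq:
  fixes p q N :: nat
  assumes "cos (p * pi / N) = cos (q * pi / r)" "p \<le> N" "0 < N" "q \<le> r" "0 < r"
  shows "p * r = q * N"
proof -
  have "p * pi / N = q * pi / r"
    by (rule cos_inj_pi) (use assms in \<open>auto simp: field_simps\<close>)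
  then have "real p * real r = real q * real N" using assms by (simp add: field_simps)
  then show ?thesis by (metis of_nat_eq_iff of_nat_mult)
qed

text \<open>In terms of \<open>c\<close> the cubic is \<open>2 cos (6 pi / N) + 1\<close>. The bound
  on \<open>N\<close> keeps the angle within the range where the cosine is injective.\<close>

lemma angle_graph6:
  fixes N :: nat and c :: real
  assumes c: "c = cos (2 * pi / N)" and N: "7 \<le> N"
    and t: "(2 + 2 * c)^3 - 6 * (2 + 2 * c)^2 + 9 * (2 + 2 * c) - 1 = 0"
  shows "N = 9"
proof -
  have "2 * cos (3 * (2 * pi / N)) = - 1"
    unfolding cos_multiples(1)[OF c] using t by (simp add: algebra_simps power2_eq_square power3_eq_cube)
  then have "cos (real 6 * pi / N) = cos (real 2 * pi / 3)" by (simp add: cos_120)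
  then have "6 * 3 = 2 * N" using N by (intro cos_angle_eq) auto
  then show ?thesis by simp
qed

text \<open>In terms of \<open>c\<close> the quartic is \<open>2 cos (8 pi / N) - 1\<close>.\<close>

lemma angle_graph8a:
  fixes N :: nat and c :: real
  assumes c: "c = cos (2 * pi / N)" and N: "9 \<le> N"
    and t: "(2 + 2 * c)^4 - 8 * (2 + 2 * c)^3 + 20 * (2 + 2 * c)^2 - 16 * (2 + 2 * c) + 1 = 0"
  shows "N = 24"
proof -
  have "2 * cos (4 * (2 * pi / N)) = 1"
    unfolding cos_multiples(2)[OF c] using t by (simp add: algebra_simps power2_eq_square power3_eq_cube power4_eq_xxxx)
  then have "cos (real 8 * pi / N) = cos (real 1 * pi / 3)" by (simp add: cos_60)
  then have "8 * 3 = 1 * N" using N by (intro cos_angle_eq) auto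
  then show ?thesis by simp
qed

text \<open>After the shift by 2 the quartic is the minimal polynomial of
  \<open>2 cos (2 pi / 15)\<close>. With \<open>m = z + 1 / z\<close>, multiplying it by
  \<open>z^4\<close> gives the 15th cyclotomic polynomial in \<open>z\<close>.\<close>

lemma angle_graph8c:
  fixes N :: nat and c :: real
  assumes c: "c = cos (2 * pi / N)" and N: "9 \<le> N"
    and t: "(2 + 2 * c)^4 - 9 * (2 + 2 * c)^3 + 26 * (2 + 2 * c)^2 - 24 * (2 + 2 * c) + 1 = 0"
  shows "N dvd 15"
proof -
  define z where "z = cis (2 * pi / N)"
  have zz: "z * cnj z = 1" by (simp add: z_def complex_norm_square[symmetric])
  have zc: "z + cnj z = of_real (2 * c)" using c by (simp add: z_def complex_add_cnj)
  define w where "w = cnj z"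
  have t': "(2 * c)^4 - (2 * c)^3 - 4 * (2 * c)^2 + 4 * (2 * c) + 1 = 0"
    using t by (simp add: algebra_simps power2_eq_square power3_eq_cube power4_eq_xxxx)
  define m where "m = z + w"
  have "m^4 - m^3 - 4 * m^2 + 4 * m + 1 = of_real ((2 * c)^4 - (2 * c)^3 - 4 * (2 * c)^2 + 4 * (2 * c) + 1)"
    unfolding m_def w_def zc by simp
  then have m: "m^4 - m^3 - 4 * m^2 + 4 * m + 1 = 0" unfolding t' by simp
  have zw: "z * w = 1" using zz by (simp add: w_def)
  have "z^8 - z^7 + z^5 - z^4 + z^3 - z + 1 = z^4 * (m^4 - m^3 - 4 * m^2 + 4 * m + 1)"
  proof -
    have zm: "z * m = z^2 + 1" unfolding m_def using zw by (simp add: algebra_simps power2_eq_square)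
    have "z^4 * (m^4 - m^3 - 4 * m^2 + 4 * m + 1) = (z * m)^4 - z * (z * m)^3 - 4 * z^2 * (z * m)^2 + 4 * z^3 * (z * m) + z^4"
      by (simp add: algebra_simps power_mult_distrib power2_eq_square power3_eq_cube power4_eq_xxxx)
    also have "\<dots> = z^8 - z^7 + z^5 - z^4 + z^3 - z + 1"
      unfolding zm by (simp add: algebra_simps eval_nat_numeral)
    finally show ?thesis by simp
  qed
  then have "z^8 - z^7 + z^5 - z^4 + z^3 - z + 1 = 0" using m by simp
  \<comment> \<open>The cyclotomic factor is completed to \<open>(z^15 - 1) (z - 1)\<close> by
    \<open>z^5 - 1\<close> and \<open>z^3 - 1\<close>.\<close>
  then have "(z^8 - z^7 + z^5 - z^4 + z^3 - z + 1) * ((z^5 - 1) * (z^3 - 1)) = 0" by simp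
  moreover have "(z^8 - z^7 + z^5 - z^4 + z^3 - z + 1) * ((z^5 - 1) * (z^3 - 1)) = (z^15 - 1) * (z - 1)"
    by (simp add: algebra_simps eval_nat_numeral)
  moreover have "z \<noteq> 1"
  proof
    assume "z = 1"
    then have "cos (real 2 * pi / N) = cos (real 0 * pi / 1)" by (simp add: z_def complex_eq_iff)
    then have "2 * 1 = 0 * N" using N by (intro cos_angle_eq) auto
    then show False by simp
  qed
  ultimately have "z ^ 15 = 1" by simp
  then have "cis (30 * pi / N) = 1" by (simp add: z_def DeMoivre)
  then have "cos (30 * pi / N) = 1" by (simp add: complex_eq_iff)
  then obtain k :: int where "30 * pi / N = of_int k * 2 * pi" by (auto simp: cos_one_2pi_int)
  then have "15 = real_of_int k * real N" using N by (simp add: field_simps)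
  then have "int 15 = k * int N" by (metis of_int_eq_iff of_int_mult of_int_of_nat_eq of_nat_numeral of_int_numeral)
  then show ?thesis by (metis dvd_triv_right int_dvd_int_iff)
qed

lemma dvd_15: fixes N :: nat assumes "N dvd 15" "9 \<le> N" shows "N = 15"
proof -
  obtain k where k: "15 = N * k" using assms(1) by (rule dvdE)
  have "k < 2"
  proof (rule ccontr)
    assume "\<not> k < 2"
    then have "9 * 2 \<le> N * k" using assms(2) by (intro mult_le_mono) auto
    then show False using k by simp
  qed
  then have "k = 0 \<or> k = 1" by linarith
  then show ?thesis using k by auto
qed

context spectral_hermitian begin

text \<open>The values 9, 24 and 15 of \<open>n + 1\<close> mean \<open>n\<close> = 8, 23 and 14.
  The middle one is excluded by parity, the others by hypothesis.\<close>

theorem extremal_eigenvector_path: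
  assumes eig: "\<And>i. i < n \<Longrightarrow> ap x i = of_real (2 * cos (pi / Suc n)) * x i"
    and w: "w < n" "x w \<noteq> 0" and n: "even n" "n \<notin> {8, 14}"
  obtains ws where "distinct ws" "set ws = {..<n}" 
    "\<And>i. i < n \<Longrightarrow> nbr (ws ! i) = {ws ! j |j. j < n \<and> (j = Suc i \<or> i = Suc j)}"
proof -
  let ?N = "Suc n"
  have N3: "3 \<le> ?N" using w(1) n(1) by (cases "n = 1") auto
  define l :: complex where "l = of_real (2 * cos (pi / ?N))"
  have eig': "\<And>i. i < n \<Longrightarrow> ap x i = l * x i" unfolding l_def by (rule eig)
  have l0: "l \<noteq> 0"
  proof -
    have "0 < cos (pi / ?N)" by (rule cos_gt_zero) (use N3 in \<open>auto simp: field_simps\<close>)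
    then show ?thesis unfolding l_def by simp
  qed
  define c where "c = cos (2 * pi / ?N)"
  have l2: "l\<^sup>2 = of_real (2 + 2 * c)" unfolding c_def using square_double_cos[of "pi / ?N"] by (simp add: l_def)
  \<comment> \<open>An embedded graph fits into \<open>n\<close> vertices; this gives the lower
    bounds that the angle lemmas need.\<close>
  have len: "length G \<le> n" if "embeds G ws" "connected_list G" "w \<in> set ws" for G ws
  proof -
    have "set ws \<subseteq> {..<n}" using embeds_sub_V[OF that] w(1) by simp
    then have "card (set ws) \<le> n" by (metis card_lessThan card_mono finite_lessThan)
    then show ?thesis using embedsD(1,2)[OF that(1)] distinct_card by metis
  qed
  have no: False if G: "G \<in> {graph6,graph8a,graph8b,graph8c}" and e: "embeds G ws" and ww: "w \<in> set ws" for G ws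
  proof -
    consider "G = graph6" | "G = graph8a" | "G = graph8b \<or> G = graph8c" using G by auto
    then show False
    proof cases
      case 1
      have "6 \<le> n" using len[OF e _ ww] connected_graphs 1 by (simp add: graph6_def)
      have "(of_real ((2 + 2 * c)^3 - 6 * (2 + 2 * c)^2 + 9 * (2 + 2 * c) - 1) :: complex) = 0"
        using graph6_eigenvalue[OF eig' e[unfolded 1] ww w(2) l0] unfolding l2 by simp
      then have "?N = 9" using angle_graph6[OF c_def] \<open>6 \<le> n\<close> unfolding of_real_eq_0_iff by simp
      then show False using n by simp
    next
      case 2
      have "8 \<le> n" using len[OF e _ ww] connected_graphs 2 by (simp add: graph8a_def)
      have "(of_real ((2 + 2 * c)^4 - 8 * (2 + 2 * c)^3 + 20 * (2 + 2 * c)^2 - 16 * (2 + 2 * c) + 1) :: complex) = 0"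
        using graph8a_eigenvalue[OF eig' e[unfolded 2] ww w(2) l0] unfolding l2 by simp
      then have "?N = 24" using angle_graph8a[OF c_def] \<open>8 \<le> n\<close> unfolding of_real_eq_0_iff by simp
      then show False using n by presburger
    next
      case 3
      have "8 \<le> n" using len[OF e _ ww] connected_graphs 3 by (auto simp: graph8b_def graph8c_def)
      have "(of_real ((2 + 2 * c)^4 - 9 * (2 + 2 * c)^3 + 26 * (2 + 2 * c)^2 - 24 * (2 + 2 * c) + 1) :: complex) = 0"
        using 3 graph8b_eigenvalue[OF eig' _ ww w(2) l0] graph8c_eigenvalue[OF eig' _ ww w(2) l0] e
        unfolding l2 by auto
      then have "?N dvd 15" using angle_graph8c[OF c_def] \<open>8 \<le> n\<close> unfolding of_real_eq_0_iff by simp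
      then show False using dvd_15[of ?N] \<open>8 \<le> n\<close> n by simp
    qed
  qed
  have total: "(\<Sum>y\<in>{..<n}. excess y) = 0" by (rule excess_total)
  have "\<forall>y\<in>component w. card (nbr y) \<le> 2"
    using component_cases[OF total, of w] w(1) no by auto
  then obtain ws where D: "distinct ws" "set ws \<subseteq> {..<n}" "length ws = n"
    and Nb: "\<And>i. i < length ws \<Longrightarrow> nbr (ws ! i) = {ws ! j |j. j < length ws \<and> (j = Suc i \<or> i = Suc j)}"
    using path_component_length[OF eig' l_def N3 w] by auto
  have "set ws = {..<n}" using D by (metis card_lessThan card_subset_eq distinct_card finite_lessThan)
  then show ?thesis using that[OF D(1)] Nb unfolding D(3) by blast
qed

end

section \<open>From the spectrum to the definite form\<close>

lemma sum_cos_even_multiples: "2 * sin a * (\<Sum>k<m. cos (2 * real (Suc k) * a)) = sin ((2 * real m + 1) * a) - sin a"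
proof (induction m)
  case (Suc m)
  have "(2 * real (Suc m) + 1) * a = 2 * real (Suc m) * a + a" "(2 * real m + 1) * a = 2 * real (Suc m) * a - a"
    by (simp_all add: algebra_simps)
  then have "sin ((2 * real (Suc m) + 1) * a) - sin ((2 * real m + 1) * a) = 2 * sin a * cos (2 * real (Suc m) * a)"
    by (simp only: sin_add sin_diff) (simp add: algebra_simps)
  then show ?case using Suc by (simp add: algebra_simps)
qed simp

text \<open>Real part of the fact that the powers 1 to \<open>n\<close> of a nontrivial
  \<open>(n + 1)\<close>-th root of unity sum to -1.\<close>

lemma sum_cos_angles:
  assumes "0 < j" "j < Suc n"
  shows "(\<Sum>k<n. cos (2 * real (Suc k) * (real j * pi / Suc n))) = - 1"
proof -
  let ?a = "real j * pi / Suc n"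
  have "real j * pi < real (Suc n) * pi" using assms by (intro mult_strict_right_mono) auto
  then have "0 < sin ?a" using assms by (intro sin_gt_zero) (auto simp: divide_less_eq mult.commute)
  moreover have "(2 * real n + 1) * ?a = - ?a + real (2 * j) * pi" by (simp add: field_simps)
  then have "sin ((2 * real n + 1) * ?a) = - sin ?a" by (simp only: sin_add sin_npi cos_npi) simp
  ultimately have "2 * sin ?a * ((\<Sum>k<n. cos (2 * real (Suc k) * ?a)) + 1) = 0"
    using sum_cos_even_multiples[of ?a n] by (simp add: algebra_simps)
  then show ?thesis using \<open>0 < sin ?a\<close> by simp
qed

text \<open>Counting starts at 0, so \<open>path_eigenvalue n 0\<close> is the largest one, with
  angle \<open>pi / (n + 1)\<close>.\<close>

definition path_eigenvalue :: "nat \<Rightarrow> nat \<Rightarrow> real" where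
  "path_eigenvalue n k = 2 * cos (real (Suc k) * (pi / Suc n))"

lemma sin_path_angle:
  assumes "k < n"
  shows "0 < sin (real (Suc k) * (pi / Suc n))" "sin (real (Suc n) * (real (Suc k) * (pi / Suc n))) = 0"
proof -
  have "real (Suc k) * (pi / Suc n) < real (Suc n) * (pi / Suc n)"
    using assms by (intro mult_strict_right_mono) auto
  then show "0 < sin (real (Suc k) * (pi / Suc n))" by (intro sin_gt_zero) auto
  have "real (Suc n) * (real (Suc k) * (pi / Suc n)) = real (Suc k) * pi" by (simp add: field_simps)
  then show "sin (real (Suc n) * (real (Suc k) * (pi / Suc n))) = 0" by (simp only: sin_npi)
qed

lemma path_eigenvalue_square:
  "(path_eigenvalue n k)\<^sup>2 = 2 + 2 * cos (2 * real (Suc k) * (real 1 * pi / Suc n))"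
proof -
  have "(path_eigenvalue n k)\<^sup>2 = 2 + 2 * cos (2 * (real (Suc k) * (pi / Suc n)))"
    unfolding path_eigenvalue_def by (simp only: cos_double_cos power_mult_distrib) simp
  then show ?thesis by (simp only: mult.assoc of_nat_1 mult_1_left)
qed

lemma path_eigenvalue_fourth:
  "(path_eigenvalue n k)^4 = 6 + 8 * cos (2 * real (Suc k) * (real 1 * pi / Suc n)) +
     2 * cos (2 * real (Suc k) * (real 2 * pi / Suc n))"
proof -
  let ?b = "2 * real (Suc k) * (real 1 * pi / Suc n)"
  have "2 * real (Suc k) * (real 2 * pi / Suc n) = 2 * ?b" by simp
  then have c: "cos (2 * real (Suc k) * (real 2 * pi / Suc n)) = 2 * (cos ?b)\<^sup>2 - 1" by (simp only: cos_double_cos)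
  have "(path_eigenvalue n k)^4 = ((path_eigenvalue n k)\<^sup>2)\<^sup>2" by simp
  also have "\<dots> = (2 + 2 * cos ?b)\<^sup>2" by (simp only: path_eigenvalue_square)
  finally show ?thesis unfolding c by (simp add: power2_sum algebra_simps power_mult_distrib)
qed

lemma sum_path_eigenvalues:
  assumes "2 \<le> n"
  shows "(\<Sum>k<n. (path_eigenvalue n k)\<^sup>2) = 2 * real n - 2" "(\<Sum>k<n. (path_eigenvalue n k)^4) = 6 * real n - 10"
  unfolding path_eigenvalue_square path_eigenvalue_fourth sum.distrib sum_distrib_left[symmetric]
  using sum_cos_angles[of 1 n] sum_cos_angles[of 2 n] assms by (simp_all del: of_nat_1 of_nat_numeral)

lemma path_eigenvalue_less_2: assumes "k < n" shows "(path_eigenvalue n k)\<^sup>2 < 4"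
proof -
  have "0 < (sin (real (Suc k) * (pi / Suc n)))\<^sup>2" using sin_path_angle(1)[OF assms] by simp
  then show ?thesis unfolding path_eigenvalue_def by (simp add: power_mult_distrib cos_squared_eq)
qed

lemma path_eigenvalue_inj: "inj_on (path_eigenvalue n) {..<n}"
proof (rule inj_onI)
  fix j k assume *: "j \<in> {..<n}" "k \<in> {..<n}" "path_eigenvalue n j = path_eigenvalue n k"
  have b: "0 \<le> real (Suc i) * (pi / Suc n) \<and> real (Suc i) * (pi / Suc n) \<le> pi" if "i < n" for i
  proof -
    have "real (Suc i) * (pi / Suc n) \<le> real (Suc n) * (pi / Suc n)" using that by (intro mult_right_mono) auto
    then show ?thesis by simp
  qed
  have "real (Suc j) * (pi / Suc n) = real (Suc k) * (pi / Suc n)"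
  proof -
    have "cos (real (Suc j) * (pi / Suc n)) = cos (real (Suc k) * (pi / Suc n))"
      using *(3) unfolding path_eigenvalue_def by simp
    then show ?thesis using b[of j] b[of k] *(1,2) cos_inj_pi by (metis lessThan_iff)
  qed
  then show "j = k" by simp
qed

section \<open>Chebyshev polynomials of \<open>H\<close> and the passage to
  \<open>spectral_hermitian\<close>\<close>

context unit_hermitian begin

text \<open>The vector \<open>U_k (H / 2) x\<close>, by the three-term recurrence instead of a
  polynomial in a matrix.\<close>

fun cheb :: "(nat \<Rightarrow> complex) \<Rightarrow> nat \<Rightarrow> nat \<Rightarrow> complex" where
  "cheb x 0 = x"
| "cheb x (Suc 0) = ap x"
| "cheb x (Suc (Suc k)) = (\<lambda>i. ap (cheb x (Suc k)) i - cheb x k i)"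

lemma ap_cong: "(\<And>j. j < n \<Longrightarrow> x j = y j) \<Longrightarrow> ap x i = ap y i"
  unfolding ap_def by (rule sum.cong) auto

text \<open>If every entry of \<open>ap x\<close> is divisible by \<open>p\<close>, the recurrence reads \<open>x, 0, - x, 0, x, \<dots>\<close> modulo \<open>p\<close>.\<close>

lemma cheb_mod:
  assumes x: "\<And>i. i < n \<Longrightarrow> gaussian_int (x i)"
    and dvd: "\<And>i. i < n \<Longrightarrow> \<exists>z. gaussian_int z \<and> ap x i = p * z" and i: "i < n"
  shows "\<exists>z. gaussian_int z \<and> cheb x (2 * m) i = (- 1) ^ m * x i + p * z"
proof -
  \<comment> \<open>Stated for vectors congruent to any multiple \<open>c\<close> of
    \<open>x\<close>, so that it serves both the odd terms, with \<open>c = 0\<close>, and the even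
    ones, with \<open>c\<close> a sign.\<close>
  have step: "\<exists>z. gaussian_int z \<and> ap y i = p * z"
    if y: "\<And>j. j < n \<Longrightarrow> \<exists>z. gaussian_int z \<and> y j = c * x j + p * z" and c: "gaussian_int c" and i: "i < n" for y c i
  proof -
    obtain f where f: "\<And>j. j < n \<Longrightarrow> gaussian_int (f j) \<and> y j = c * x j + p * f j" using y by metis
    obtain z where z: "gaussian_int z" "ap x i = p * z" using dvd[OF i] by blast
    have "ap y i = ap (\<lambda>j. c * x j + p * f j) i" by (rule ap_cong) (use f in auto)
    also have "\<dots> = c * ap x i + p * ap f i" by (simp only: ap_add ap_scale)
    also have "\<dots> = p * (c * z + ap f i)" by (simp add: z algebra_simps)
    finally show ?thesis using z f c by (intro exI[of _ "c * z + ap f i"]) (auto intro: gaussian_int_ap)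
  qed
  have "(\<exists>z. gaussian_int z \<and> cheb x (2 * m) i = (- 1) ^ m * x i + p * z) \<and>
      (\<exists>z. gaussian_int z \<and> cheb x (Suc (2 * m)) i = 0 * x i + p * z)" if "i < n" for i
    using that
  proof (induction m arbitrary: i)
    case 0
    then show ?case using dvd[of i] by (auto intro!: exI[of _ 0])
  next
    case (Suc m)
    have g: "gaussian_int ((- 1) ^ k)" for k by (induction k) (auto intro: gaussian_int_mult gaussian_int_minus)
    have even: "\<exists>z. gaussian_int z \<and> cheb x (2 * Suc m) j = (- 1) ^ Suc m * x j + p * z" if j: "j < n" for j
    proof -
      obtain z where z: "gaussian_int z" "ap (cheb x (Suc (2 * m))) j = p * z"
        using step[OF conjunct2[OF Suc.IH] gaussian_int_0 j] by blast
      obtain w where "gaussian_int w" "cheb x (2 * m) j = (- 1) ^ m * x j + p * w" using Suc.IH[OF j] by blast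
      then show ?thesis using z by (intro exI[of _ "z - w"]) (auto simp: algebra_simps)
    qed
    obtain z where z: "gaussian_int z" "ap (cheb x (2 * Suc m)) i = p * z"
      using step[OF even g Suc.prems] by blast
    obtain w where "gaussian_int w" "cheb x (Suc (2 * m)) i = 0 * x i + p * w" using Suc.IH[OF Suc.prems] by blast
    then have "\<exists>z. gaussian_int z \<and> cheb x (Suc (2 * Suc m)) i = 0 * x i + p * z"
      using z by (intro exI[of _ "z - w"]) (auto simp: algebra_simps)
    then show ?case using even[OF Suc.prems] by blast
  qed
  then show ?thesis using i by blast
qed

text \<open>In the eigenbasis the form is diagonal with positive weights
  \<open>4 - path_eigenvalue^2\<close>, and \<open>U_n (H / 2)\<close> is zero because every
  eigenvalue is a root. With \<open>n = 2 m\<close>, \<open>cheb_mod\<close> then makes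
  \<open>x\<close>, up to sign, a multiple of \<open>p\<close>.\<close>

lemma spectral_hermitianI:
  fixes e :: "nat \<Rightarrow> nat \<Rightarrow> complex"
  assumes eig: "\<And>k i. k < n \<Longrightarrow> i < n \<Longrightarrow> ap (e k) i = of_real (path_eigenvalue n k) * e k i"
    and orth: "\<And>k. k < n \<Longrightarrow> (\<Sum>i<n. (cmod (e k i))\<^sup>2) = 1"
    and compl: "\<And>i j. i < n \<Longrightarrow> j < n \<Longrightarrow> (\<Sum>k<n. e k i * cnj (e k j)) = of_bool (i = j)"
    and n: "even n" "0 < n"
  shows "spectral_hermitian n h"
proof -
  let ?c = "path_eigenvalue n"
  define a where "a x k = (\<Sum>j<n. cnj (e k j) * x j)" for x k
  have expand: "x i = (\<Sum>k<n. a x k * e k i)" if "i < n" for x i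
  proof -
    have "(\<Sum>k<n. a x k * e k i) = (\<Sum>j<n. (\<Sum>k<n. e k i * cnj (e k j)) * x j)"
      unfolding a_def sum_distrib_right by (subst sum.swap) (simp add: algebra_simps)
    also have "\<dots> = (\<Sum>j<n. of_bool (i = j) * x j)" by (rule sum.cong) (use compl that in auto)
    also have "\<dots> = (\<Sum>j<n. if j = i then x j else 0)" by (rule sum.cong) auto
    also have "\<dots> = x i" using that by simp
    finally show ?thesis by simp
  qed
  have parseval: "(\<Sum>i<n. (cmod (x i))\<^sup>2) = (\<Sum>k<n. (cmod (a x k))\<^sup>2)" for x
  proof -
    have "of_real (\<Sum>i<n. (cmod (x i))\<^sup>2) = (\<Sum>i<n. cnj (x i) * x i)"
      by (simp add: complex_norm_square[symmetric] mult.commute)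
    also have "\<dots> = (\<Sum>i<n. cnj (x i) * (\<Sum>k<n. a x k * e k i))" by (rule sum.cong) (auto simp flip: expand)
    also have "\<dots> = (\<Sum>k<n. a x k * (\<Sum>i<n. cnj (x i) * e k i))"
      unfolding sum_distrib_left by (subst sum.swap) (simp add: algebra_simps)
    also have "\<dots> = (\<Sum>k<n. a x k * cnj (a x k))"
      unfolding a_def cnj_sum by (simp add: mult.commute)
    also have "\<dots> = of_real (\<Sum>k<n. (cmod (a x k))\<^sup>2)" by (simp add: complex_norm_square[symmetric])
    finally show ?thesis by (simp only: of_real_eq_iff)
  qed
  have a_ap: "a (ap x) k = of_real (?c k) * a x k" if "k < n" for x k
  proof -
    have "a (ap x) k = (\<Sum>j<n. cnj (ap (e k) j) * x j)" unfolding a_def by (rule ap_adjoint)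
    also have "\<dots> = of_real (?c k) * a x k"
      unfolding a_def sum_distrib_left by (rule sum.cong) (use eig that in \<open>auto simp: algebra_simps\<close>)
    finally show ?thesis .
  qed
  have pos: "0 < quad x" if "i < n" "x i \<noteq> 0" for x i
  proof -
    have "\<exists>k<n. a x k \<noteq> 0"
    proof (rule ccontr)
      assume "\<not> ?thesis"
      then show False using expand[OF that(1), of x] that(2) by simp
    qed
    then obtain k where k: "k < n" "a x k \<noteq> 0" by blast
    have "quad x = (\<Sum>k<n. (4 - (?c k)\<^sup>2) * (cmod (a x k))\<^sup>2)"
      unfolding quad_def parseval[of x] parseval[of "ap x"] sum_distrib_left sum_subtractf[symmetric]
      by (rule sum.cong) (auto simp: a_ap norm_mult power_mult_distrib algebra_simps)
    also have "0 < \<dots>"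
    proof (rule sum_pos2[of _ k])
      show "0 < (4 - (?c k)\<^sup>2) * (cmod (a x k))\<^sup>2" using k path_eigenvalue_less_2[of k n] by simp
      show "0 \<le> (4 - (?c j)\<^sup>2) * (cmod (a x j))\<^sup>2" if "j \<in> {..<n}" for j
        using path_eigenvalue_less_2[of j n] that by simp
    qed (use k in auto)
    finally show ?thesis .
  qed
  \<comment> \<open>\<open>U_m (cos t) = sin ((m + 1) t) / sin t\<close>, multiplied out so that the
    induction needs no division.\<close>
  have cheb_sin: "of_real (sin (real (Suc k) * (pi / Suc n))) * a (cheb x m) k =
      of_real (sin (real (Suc m) * (real (Suc k) * (pi / Suc n)))) * a x k" if k: "k < n" for x m k
    using k
  proof (induction x m rule: cheb.induct)
    case (1 x)
    show ?case by simp
  next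
    case (2 x)
    let ?t = "real (Suc k) * (pi / Suc n)"
    have "sin (real (Suc (Suc 0)) * ?t) = 2 * cos ?t * sin ?t" using sin_recurrence[of ?t 0] by simp
    then have "of_real (sin (real (Suc (Suc 0)) * ?t)) * a x k = of_real (sin ?t) * (of_real (?c k) * a x k)"
      by (simp add: path_eigenvalue_def)
    then show ?case by (simp only: cheb.simps a_ap[OF k])
  next
    case (3 x m)
    let ?t = "real (Suc k) * (pi / Suc n)"
    have e: "a (cheb x (Suc (Suc m))) k = of_real (?c k) * a (cheb x (Suc m)) k - a (cheb x m) k"
      unfolding a_ap[OF k, symmetric] by (simp add: a_def algebra_simps sum_subtractf)
    have "s * (c * p - q) = c * (s * p) - s * q" for s c p q :: complex by (simp add: algebra_simps)
    then have "of_real (sin ?t) * a (cheb x (Suc (Suc m))) k =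
        of_real (?c k) * (of_real (sin ?t) * a (cheb x (Suc m)) k) - of_real (sin ?t) * a (cheb x m) k"
      by (simp only: e)
    also have "\<dots> = of_real (2 * cos ?t * sin (real (Suc (Suc m)) * ?t) - sin (real (Suc m) * ?t)) * a x k"
    proof -
      have c: "?c k = 2 * cos ?t" by (simp only: path_eigenvalue_def)
      have "of_real (p :: real) * (of_real q * y) - of_real r * y = of_real (p * q - r) * (y :: complex)" for p q r y
        by (simp add: algebra_simps)
      then show ?thesis by (simp only: 3(1)[OF k] 3(2)[OF k] c)
    qed
    finally show ?case by (simp only: sin_recurrence)
  qed
  have cheb_zero: "cheb x n i = 0" if "i < n" for x i
  proof -
    have "a (cheb x n) k = 0" if k: "k < n" for k
    proof -
      show ?thesis using sin_path_angle[OF k] using cheb_sin[OF k, of x n] by (simp add: mult.commute)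
    qed
    then show ?thesis using expand[OF that, of "cheb x n"] by simp
  qed
  interpret definite_hermitian n h
  proof unfold_locales
    fix x i p assume x: "\<And>i. i < n \<Longrightarrow> gaussian_int (x i)"
      "\<And>i. i < n \<Longrightarrow> \<exists>z. gaussian_int z \<and> ap x i = p * z" "i < n"
    obtain m where m: "n = 2 * m" using n(1) by (rule evenE)
    obtain z where z: "gaussian_int z" "cheb x n i = (- 1) ^ m * x i + p * z"
      using cheb_mod[OF x, of m] m by auto
    then have "(- 1) ^ m * x i = p * - z" using cheb_zero[OF x(3), of x] by (simp add: eq_neg_iff_add_eq_0)
    then have "x i = p * ((- 1) ^ m * - z)"
      by (metis (no_types, opaque_lifting) left_minus_one_mult_self mult.left_commute)
    moreover have "gaussian_int ((- 1) ^ m * - z)"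
      using z(1) by (cases "even m") auto
    ultimately show "\<exists>z. gaussian_int z \<and> x i = p * z" by blast
  qed (rule pos)
  have a_unit: "(cmod (a (unit i) k))\<^sup>2 = (cmod (e k i))\<^sup>2" if "i < n" for i k
    using sum_unit[OF that, of "\<lambda>j. cnj (e k j)"] by (simp add: a_def)
  have tr: "(\<Sum>i<n. \<Sum>k<n. f k * (cmod (e k i))\<^sup>2) = (\<Sum>k<n. f k)" for f
    by (subst sum.swap) (simp add: orth flip: sum_distrib_left)
  have 2: "2 \<le> n" using n by (cases "n = 1") auto
  show ?thesis
  proof unfold_locales
    have "(\<Sum>j<n. (cmod (h i j))\<^sup>2) = (\<Sum>k<n. (?c k)\<^sup>2 * (cmod (e k i))\<^sup>2)" if i: "i < n" for i
    proof -
      have "(\<Sum>j<n. (cmod (h i j))\<^sup>2) = (\<Sum>j<n. (cmod (ap (unit i) j))\<^sup>2)"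
        using ap_unit[OF i] herm[of i] by simp
      also have "\<dots> = (\<Sum>k<n. (?c k)\<^sup>2 * (cmod (e k i))\<^sup>2)"
        unfolding parseval[of "ap (unit i)"]
        by (rule sum.cong) (auto simp: a_ap norm_mult power_mult_distrib a_unit[OF i])
      finally show ?thesis .
    qed
    then have "(\<Sum>i<n. \<Sum>j<n. (cmod (h i j))\<^sup>2) = (\<Sum>i<n. \<Sum>k<n. (?c k)\<^sup>2 * (cmod (e k i))\<^sup>2)" by simp
    then show "(\<Sum>i<n. \<Sum>j<n. (cmod (h i j))\<^sup>2) = 2 * real n - 2"
      using tr[of "\<lambda>k. (?c k)\<^sup>2"] sum_path_eigenvalues(1)[OF 2] by simp
    have "(\<Sum>j<n. (cmod (sq i j))\<^sup>2) = (\<Sum>k<n. (?c k)^4 * (cmod (e k i))\<^sup>2)" if i: "i < n" for i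
    proof -
      have c4: "y ^ 4 = y\<^sup>2 * y\<^sup>2" for y :: real by (simp flip: power_add)
      have "ap (ap (unit i)) j = sq j i" for j unfolding ap_ap by (rule sum_unit[OF i])
      moreover have "cmod (sq j i) = cmod (sq i j)" for j
        unfolding sq_cnj[of i j, symmetric] by (rule complex_mod_cnj)
      ultimately have "(\<Sum>j<n. (cmod (sq i j))\<^sup>2) = (\<Sum>j<n. (cmod (ap (ap (unit i)) j))\<^sup>2)"
        by (simp only:)
      also have "\<dots> = (\<Sum>k<n. (?c k)^4 * (cmod (e k i))\<^sup>2)"
        unfolding parseval[of "ap (ap (unit i))"]
      proof (rule sum.cong[OF refl])
        fix k assume "k \<in> {..<n}"
        then have "(cmod (a (ap (ap (unit i))) k))\<^sup>2 = (?c k)\<^sup>2 * ((?c k)\<^sup>2 * (cmod (e k i))\<^sup>2)"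
          by (simp add: a_ap norm_mult power_mult_distrib a_unit[OF i])
        then show "(cmod (a (ap (ap (unit i))) k))\<^sup>2 = (?c k)^4 * (cmod (e k i))\<^sup>2"
          by (simp only: c4 mult.assoc)
      qed
      finally show ?thesis .
    qed
    then have "(\<Sum>i<n. \<Sum>j<n. (cmod (sq i j))\<^sup>2) = (\<Sum>i<n. \<Sum>k<n. (?c k)^4 * (cmod (e k i))\<^sup>2)" by simp
    then show "(\<Sum>i<n. \<Sum>j<n. (cmod (sq i j))\<^sup>2) = 6 * real n - 10"
      using tr[of "\<lambda>k. (?c k)^4"] sum_path_eigenvalues(2)[OF 2] by simp
  qed
qed

end

section \<open>Eigenvalues of matrices and the spectrum of the path\<close>

lemma mult_mat_vec_index:
  fixes f :: "nat \<times> nat \<Rightarrow> 'a :: comm_ring_1"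
  assumes "i < n" "dim_vec v = n"
  shows "(mat n n f *\<^sub>v v) $ i = (\<Sum>j<n. f (i, j) * v $ j)"
  using assms by (simp add: scalar_prod_def lessThan_atLeast0)

lemma eigenvalue_mat_iff:
  fixes f :: "nat \<times> nat \<Rightarrow> complex"
  shows "eigenvalue (mat n n f) c \<longleftrightarrow>
    (\<exists>x. (\<exists>i<n. x i \<noteq> 0) \<and> (\<forall>i<n. (\<Sum>j<n. f (i, j) * x j) = c * x i))" (is "?L \<longleftrightarrow> ?R")
proof
  assume ?L
  then obtain v where v: "v \<in> carrier_vec n" "v \<noteq> 0\<^sub>v n" and e: "mat n n f *\<^sub>v v = c \<cdot>\<^sub>v v"
    unfolding eigenvalue_def eigenvector_def by auto
  have d: "dim_vec v = n" using v by simp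
  have "\<exists>i<n. v $ i \<noteq> 0" using v d by (metis eq_vecI index_zero_vec(1,2))
  moreover have "(\<Sum>j<n. f (i, j) * v $ j) = c * v $ i" if "i < n" for i
    unfolding mult_mat_vec_index[OF that d, symmetric] e using that d by simp
  ultimately show ?R by blast
next
  assume ?R
  then obtain x where x: "\<exists>i<n. x i \<noteq> 0" "\<And>i. i < n \<Longrightarrow> (\<Sum>j<n. f (i, j) * x j) = c * x i" by blast
  have "vec n x \<noteq> 0\<^sub>v n" using x(1) by (metis index_vec index_zero_vec(1))
  moreover have "mat n n f *\<^sub>v vec n x = c \<cdot>\<^sub>v vec n x"
    by (rule eq_vecI) (simp_all add: mult_mat_vec_index x(2) del: index_mult_mat_vec)
  ultimately show ?L unfolding eigenvalue_def eigenvector_def by (intro exI[of _ "vec n x"]) auto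
qed

text \<open>Distinct eigenvalues, as many as the degree, leave no room for further roots or
  multiplicities.\<close>

lemma proots_char_poly_distinct:
  fixes A :: "complex mat"
  assumes A: "A \<in> carrier_mat n n" and inj: "inj_on c {..<n}"
    and e: "\<And>k. k < n \<Longrightarrow> eigenvalue A (c k)"
  shows "proots (char_poly A) = mset_set (c ` {..<n})"
proof -
  let ?p = "char_poly A"
  have deg: "degree ?p = n" and p0: "?p \<noteq> 0" using degree_monic_char_poly[OF A] by auto
  have "mset_set (c ` {..<n}) \<subseteq># proots ?p"
  proof (rule mset_subset_eqI)
    fix z
    show "count (mset_set (c ` {..<n})) z \<le> count (proots ?p) z"
    proof (cases "z \<in> c ` {..<n}")
      case True
      then have "poly ?p z = 0" using e eigenvalue_root_char_poly[OF A] by auto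
      then have "z \<in># proots ?p" using p0 by simp
      then show ?thesis using True by (simp add: count_greater_zero_iff[symmetric] Suc_le_eq del: count_greater_zero_iff)
    qed simp
  qed
  moreover have "size (proots ?p) \<le> size (mset_set (c ` {..<n}))"
    using size_proots_le[of ?p] deg inj by (simp add: card_image)
  ultimately show ?thesis by (metis mset_subset_size not_less subset_mset.le_imp_less_or_eq)
qed

lemma herm_mat_eq:
  "herm_mat X = mat (card (verts X)) (card (verts X))
     (\<lambda>(j, k). herm_entry X (sorted_list_of_set (verts X) ! j) (sorted_list_of_set (verts X) ! k))"
  by (simp add: herm_mat_def Let_def)

lemma herm_mat_carrier: "herm_mat X \<in> carrier_mat (card (verts X)) (card (verts X))"
  by (simp add: herm_mat_eq)

lemma herm_spec_distinct:
  assumes "card (verts X) = n" "inj_on c {..<n}" "\<And>k. k < n \<Longrightarrow> eigenvalue (herm_mat X) (c k)"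
  shows "herm_spec X = mset_set (c ` {..<n})"
  unfolding herm_spec_def using herm_mat_carrier[of X] assms by (intro proots_char_poly_distinct) auto

lemma herm_mat_path_graph:
  "herm_mat (path_graph n) = mat n n (\<lambda>(j, k). of_bool (k = Suc j \<or> j = Suc k))"
proof (rule eq_matI)
  fix j k assume "j < dim_row (mat n n (\<lambda>(j, k). of_bool (k = Suc j \<or> j = Suc k)))"
    "k < dim_col (mat n n (\<lambda>(j, k). of_bool (k = Suc j \<or> j = Suc k)))"
  then have jk: "j < n" "k < n" by simp_all
  have e: "{j, k} \<in> edges (path_graph n) \<longleftrightarrow> k = Suc j \<or> j = Suc k"
    using jk unfolding path_graph_def by (auto simp: doubleton_eq_iff)
  have "arcs (path_graph n) = {}" "verts (path_graph n) = {0..<n}" by (simp_all add: path_graph_def)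
  then show "herm_mat (path_graph n) $$ (j, k) = mat n n (\<lambda>(j, k). of_bool (k = Suc j \<or> j = Suc k)) $$ (j, k)"
    using jk by (simp add: herm_mat_eq herm_entry_def e)
qed (simp_all add: herm_mat_eq path_graph_def)

lemma inj_on_path_eigenvalue_complex: "inj_on (\<lambda>k. of_real (path_eigenvalue n k) :: complex) {..<n}"
  using path_eigenvalue_inj[of n] by (simp add: inj_on_def)

lemma herm_spec_path_graph:
  "herm_spec (path_graph n) = mset_set ((\<lambda>k. of_real (path_eigenvalue n k)) ` {..<n})"
proof (rule herm_spec_distinct[OF _ inj_on_path_eigenvalue_complex])
  show "card (verts (path_graph n)) = n" by (simp add: path_graph_def)
  fix k assume k: "k < n"
  let ?t = "real (Suc k) * (pi / Suc n)"
  let ?x = "\<lambda>i. of_real (sin (real (Suc i) * ?t)) :: complex"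
  have "(\<Sum>j<n. of_bool (j = Suc i \<or> i = Suc j) * ?x j) = of_real (path_eigenvalue n k) * ?x i" if i: "i < n" for i
  proof -
    have "{..<n} \<inter> {j. j = Suc i \<or> i = Suc j} = (if i = 0 then {} else {i - 1}) \<union> (if Suc i < n then {Suc i} else {})"
      using i by auto
    then have "(\<Sum>j<n. of_bool (j = Suc i \<or> i = Suc j) * ?x j) =
        (\<Sum>j\<in>(if i = 0 then {} else {i - 1}) \<union> (if Suc i < n then {Suc i} else {}). ?x j)"
      by (simp only: sum_of_bool_mult_eq finite_lessThan)
    also have "\<dots> = (if i = 0 then 0 else ?x (i - 1)) + (if Suc i < n then ?x (Suc i) else 0)"
      by (cases "i = 0"; cases "Suc i < n") auto
    \<comment> \<open>At both ends the missing neighbour is replaced by a sine that vanishes: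
      \<open>sin 0\<close> before the first vertex, \<open>sin ((n + 1) t)\<close> after the
      last.\<close>
    also have "(if i = 0 then 0 else ?x (i - 1)) = of_real (sin (real i * ?t))"
      by (cases i) auto
    also have "(if Suc i < n then ?x (Suc i) else 0) = of_real (sin (real (Suc (Suc i)) * ?t))"
    proof (cases "Suc i < n")
      case False
      then have "Suc i = n" using i by simp
      then show ?thesis using sin_path_angle(2)[OF k] by simp
    qed simp
    also have "of_real (sin (real i * ?t)) + of_real (sin (real (Suc (Suc i)) * ?t)) =
        (of_real (2 * cos ?t * sin (real (Suc i) * ?t)) :: complex)"
      unfolding sin_recurrence[of ?t i, symmetric] of_real_add[symmetric] by simp
    also have "\<dots> = of_real (path_eigenvalue n k) * ?x i"
      by (simp only: path_eigenvalue_def of_real_mult)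
    finally show ?thesis .
  qed
  moreover have "?x 0 \<noteq> 0" using sin_path_angle(1)[OF k] by simp
  moreover have "0 < n" using k by simp
  ultimately show "eigenvalue (herm_mat (path_graph n)) (of_real (path_eigenvalue n k))"
    unfolding herm_mat_path_graph eigenvalue_mat_iff by (intro exI[of _ ?x]) auto
qed

text \<open>The eigenvalues are distinct, so normalised eigenvectors are automatically orthonormal,
  \<open>H\<close> being Hermitian.\<close>

lemma (in unit_hermitian) spectral_hermitian_eigenvalues:
  assumes ev: "\<And>k. k < n \<Longrightarrow> \<exists>x. (\<exists>i<n. x i \<noteq> 0) \<and> (\<forall>i<n. ap x i = of_real (path_eigenvalue n k) * x i)"
    and n: "even n" "0 < n"
  shows "spectral_hermitian n h"
proof -
  let ?c = "path_eigenvalue n"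
  obtain f where f: "\<And>k. k < n \<Longrightarrow> \<exists>i<n. f k i \<noteq> 0"
    "\<And>k i. k < n \<Longrightarrow> i < n \<Longrightarrow> ap (f k) i = of_real (?c k) * f k i"
    using ev by metis
  define s where "s k = sqrt (\<Sum>i<n. (cmod (f k i))\<^sup>2)" for k
  define e where "e k i = f k i / of_real (s k)" for k i
  have s0: "0 < s k" if k: "k < n" for k
  proof -
    obtain i where i: "i < n" "f k i \<noteq> 0" using f(1)[OF k] by blast
    have "0 < (\<Sum>i<n. (cmod (f k i))\<^sup>2)" by (rule sum_pos2[of _ i]) (use i in auto)
    then show ?thesis unfolding s_def by simp
  qed
  have eig: "ap (e k) i = of_real (?c k) * e k i" if "k < n" "i < n" for k i
    using ap_scale[of "1 / of_real (s k)" "f k" i] f(2)[OF that] by (simp add: e_def[abs_def])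
  have unit: "(\<Sum>i<n. (cmod (e k i))\<^sup>2) = 1" if "k < n" for k
  proof -
    have "(\<Sum>i<n. (cmod (e k i))\<^sup>2) = (\<Sum>i<n. (cmod (f k i))\<^sup>2) / (s k)\<^sup>2"
      unfolding sum_divide_distrib by (simp add: e_def norm_divide power_divide)
    also have "(s k)\<^sup>2 = (\<Sum>i<n. (cmod (f k i))\<^sup>2)" unfolding s_def by (simp add: sum_nonneg)
    finally show ?thesis using s0[OF that] unfolding s_def by simp
  qed
  have orth: "(\<Sum>i<n. cnj (e k i) * e l i) = of_bool (k = l)" if kl: "k < n" "l < n" for k l
  proof (cases "k = l")
    case True
    have "(\<Sum>i<n. cnj (e k i) * e k i) = of_real (\<Sum>i<n. (cmod (e k i))\<^sup>2)"
      by (simp add: complex_norm_square[symmetric] mult.commute)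
    then show ?thesis using True unit kl by simp
  next
    case False
    let ?s = "\<Sum>i<n. cnj (e k i) * e l i"
    have "of_real (?c l) * ?s = (\<Sum>i<n. cnj (e k i) * ap (e l) i)"
      unfolding sum_distrib_left by (rule sum.cong) (use eig kl in \<open>auto simp: algebra_simps\<close>)
    also have "\<dots> = (\<Sum>i<n. cnj (ap (e k) i) * e l i)" by (rule ap_adjoint)
    also have "\<dots> = of_real (?c k) * ?s"
      unfolding sum_distrib_left by (rule sum.cong) (use eig kl in \<open>auto simp: algebra_simps\<close>)
    finally have "?c l = ?c k \<or> ?s = 0" by auto
    moreover have "?c l \<noteq> ?c k" using path_eigenvalue_inj[of n] False kl by (auto simp: inj_on_def)
    ultimately show ?thesis using False by simp
  qed
  define M where "M = mat n n (\<lambda>(k, i). cnj (e k i))"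
  define M' where "M' = mat n n (\<lambda>(i, k). e k i)"
  have carr: "M \<in> carrier_mat n n" "M' \<in> carrier_mat n n" by (simp_all add: M_def M'_def)
  have "M * M' = 1\<^sub>m n"
    by (rule eq_matI) (simp_all add: M_def M'_def scalar_prod_def orth flip: lessThan_atLeast0)
  \<comment> \<open>For square matrices a right inverse is a left inverse, which turns
    orthonormality into completeness.\<close>
  then have M: "M' * M = 1\<^sub>m n" using mat_mult_left_right_inverse[OF carr] by simp
  have compl: "(\<Sum>k<n. e k i * cnj (e k j)) = of_bool (i = j)" if "i < n" "j < n" for i j
  proof -
    have "(\<Sum>k<n. e k i * cnj (e k j)) = (M' * M) $$ (i, j)"
      using that by (simp add: M_def M'_def scalar_prod_def lessThan_atLeast0)
    then show ?thesis using that by (simp add: M)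
  qed
  show ?thesis by (rule spectral_hermitianI[OF eig unit compl n])
qed

section \<open>The underlying graph of a mixed graph cospectral with the path\<close>

lemma herm_entry_cnj: "mixed_graph X \<Longrightarrow> herm_entry X y x = cnj (herm_entry X x y)"
  unfolding mixed_graph_def herm_entry_def by (auto simp: insert_commute)

lemma herm_entry_self: "mixed_graph X \<Longrightarrow> herm_entry X x x = 0"
  unfolding mixed_graph_def herm_entry_def by (auto simp: doubleton_eq_iff)

lemma herm_entry_values: "herm_entry X x y \<in> {0, 1, - 1, \<i>, - \<i>}"
  unfolding herm_entry_def by auto

theorem cospectral_path_graph_structure:
  fixes Y :: "'a::linorder mixed_graph"
  assumes Y: "mixed_graph Y" "herm_spec Y = herm_spec (path_graph n)" and n: "even n" "0 < n" "n \<notin> {8, 14}"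
  obtains us where "distinct us" "set us = verts Y" "length us = n"
    "\<And>i j. i < n \<Longrightarrow> j < n \<Longrightarrow> herm_entry Y (us ! i) (us ! j) \<noteq> 0 \<longleftrightarrow> j = Suc i \<or> i = Suc j"
proof -
  have fin: "finite (verts Y)" using Y(1) unfolding mixed_graph_def by blast
  have size: "size (herm_spec X) = card (verts X)" for X :: "'b::linorder mixed_graph"
    unfolding herm_spec_def size_proots_complex using degree_monic_char_poly[OF herm_mat_carrier[of X]] by simp
  have card: "card (verts Y) = n" using size[of Y] size[of "path_graph n"] Y(2) by (simp add: path_graph_def)
  define vs where "vs = sorted_list_of_set (verts Y)"
  have vs: "distinct vs" "set vs = verts Y" "length vs = n" using fin card by (simp_all add: vs_def)
  define h where "h i j = (if i < n \<and> j < n then herm_entry Y (vs ! i) (vs ! j) else 0)" for i j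
  have H: "herm_mat Y = mat n n (\<lambda>(i, j). h i j)"
    unfolding herm_mat_eq card vs_def[symmetric] by (rule eq_matI) (simp_all add: h_def)
  interpret unit_hermitian n h
  proof
    show "h j i = cnj (h i j)" for i j
      unfolding h_def herm_entry_cnj[OF Y(1), of "vs ! j" "vs ! i"] by simp
    show "h i i = 0" for i using herm_entry_self[OF Y(1)] by (simp add: h_def)
    show "h i j \<in> {0, 1, - 1, \<i>, - \<i>}" for i j using herm_entry_values[of Y "vs ! i" "vs ! j"] by (simp add: h_def)
    show "i < n \<and> j < n" if "h i j \<noteq> 0" for i j using that by (simp add: h_def split: if_splits)
  qed
  have ev: "\<exists>x. (\<exists>i<n. x i \<noteq> 0) \<and> (\<forall>i<n. ap x i = of_real (path_eigenvalue n k) * x i)" if k: "k < n" for k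
  proof -
    have "of_real (path_eigenvalue n k) \<in># herm_spec Y"
      using k unfolding Y(2) herm_spec_path_graph by simp
    then have "poly (char_poly (herm_mat Y)) (of_real (path_eigenvalue n k)) = 0"
    proof -
      have "char_poly (herm_mat Y) \<noteq> 0" using degree_monic_char_poly[OF herm_mat_carrier[of Y]] by auto
      then show ?thesis using \<open>_ \<in># herm_spec Y\<close> unfolding herm_spec_def by simp
    qed
    then have "eigenvalue (herm_mat Y) (of_real (path_eigenvalue n k))"
      using eigenvalue_root_char_poly[OF herm_mat_carrier] by blast
    then show ?thesis unfolding H eigenvalue_mat_iff ap_def by simp
  qed
  interpret spectral_hermitian n h by (rule spectral_hermitian_eigenvalues[OF ev n(1,2)])
  obtain x w where x: "w < n" "x w \<noteq> 0" "\<And>i. i < n \<Longrightarrow> ap x i = of_real (path_eigenvalue n 0) * x i"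
    using ev[OF n(2)] by blast
  obtain ws where ws: "distinct ws" "set ws = {..<n}"
    "\<And>i. i < n \<Longrightarrow> nbr (ws ! i) = {ws ! j |j. j < n \<and> (j = Suc i \<or> i = Suc j)}"
    by (rule extremal_eigenvector_path[of x w]) (use x n in \<open>auto simp: path_eigenvalue_def\<close>)
  have lw: "length ws = n" using ws(1,2) distinct_card by fastforce
  define us where "us = map ((!) vs) ws"
  show ?thesis
  proof
    have inj: "inj_on ((!) vs) {..<n}" using vs by (simp add: inj_on_def nth_eq_iff_index_eq)
    show "distinct us" using inj ws unfolding us_def by (simp add: distinct_map)
    have "set us = (!) vs ` {..<length vs}" unfolding us_def set_map ws(2) vs(3) ..
    also have "\<dots> = set vs" by (auto simp: set_conv_nth)
    finally show "set us = verts Y" by (simp only: vs(2))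
    show "length us = n" using lw by (simp add: us_def)
    fix i j assume ij: "i < n" "j < n"
    have lt: "ws ! i < n" "ws ! j < n" using ij ws(2) lw nth_mem by blast+
    then have "herm_entry Y (us ! i) (us ! j) = h (ws ! i) (ws ! j)"
      using ij lw by (simp add: us_def h_def)
    moreover have "h (ws ! i) (ws ! j) \<noteq> 0 \<longleftrightarrow> ws ! j \<in> nbr (ws ! i)" by (simp add: nbr_def)
    moreover have "\<dots> \<longleftrightarrow> j = Suc i \<or> i = Suc j"
      unfolding ws(3)[OF ij(1)] using ij ws(1) lw by (auto simp: nth_eq_iff_index_eq)
    ultimately show "herm_entry Y (us ! i) (us ! j) \<noteq> 0 \<longleftrightarrow> j = Suc i \<or> i = Suc j" by simp
  qed
qed

section \<open>Switching\<close>

lemma mixed_graph_pathI: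
  assumes "distinct us" "finite V" "set us = V"
  shows "mixed_graph \<lparr>verts = V, edges = {{us ! i, us ! Suc i} |i. Suc i < length us}, arcs = {}\<rparr>"
proof -
  have "\<exists>x\<in>V. \<exists>y\<in>V. x \<noteq> y \<and> {us ! i, us ! Suc i} = {x, y}" if "Suc i < length us" for i
    by (rule bexI[of _ "us ! i"], rule bexI[of _ "us ! Suc i"])
      (use that assms(1,3) nth_mem[of i us] nth_mem[of "Suc i" us] in \<open>simp_all add: nth_eq_iff_index_eq\<close>)
  then show ?thesis using assms(2) unfolding mixed_graph_def by auto
qed

lemma DHS_path_graph:
  assumes n: "even n" "0 < n" "n \<notin> {8, 14}"
  shows "DHS (path_graph n)"
  unfolding DHS_def
proof (intro allI impI)
  fix Y :: "nat mixed_graph"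
  assume Y: "mixed_graph Y \<and> herm_spec Y = herm_spec (path_graph n)"
  then have Y1: "mixed_graph Y" by simp
  obtain us where us: "distinct us" "set us = verts Y" "length us = n"
    and adj: "\<And>i j. i < n \<Longrightarrow> j < n \<Longrightarrow> herm_entry Y (us ! i) (us ! j) \<noteq> 0 \<longleftrightarrow> j = Suc i \<or> i = Suc j"
    using cospectral_path_graph_structure[OF _ _ n, of Y] Y by blast
  have fin: "finite (verts Y)" using us by (metis List.finite_set)
  define Z where "Z = \<lparr>verts = verts Y, edges = {{us ! i, us ! Suc i} |i. Suc i < n}, arcs = {}\<rparr>"
  have Z: "mixed_graph Z" using mixed_graph_pathI[OF us(1) fin us(2)] by (simp add: Z_def us(3))
  have eqi: "us ! i = us ! j \<longleftrightarrow> i = j" if "i < n" "j < n" for i j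
    using that us by (simp add: nth_eq_iff_index_eq)
  have Zedge: "{us ! i, us ! j} \<in> edges Z \<longleftrightarrow> j = Suc i \<or> i = Suc j" if "i < n" "j < n" for i j
    using that unfolding Z_def by (auto simp: doubleton_eq_iff eqi)
  have Zent: "herm_entry Z (us ! i) (us ! j) = of_bool (j = Suc i \<or> i = Suc j)" if "i < n" "j < n" for i j
    using Zedge[OF that] unfolding herm_entry_def by (simp add: Z_def)
  define g where "g = the_inv_into {..<n} ((!) us)"
  have bij: "bij_betw ((!) us) {..<n} (verts Y)"
    using us by (metis bij_betw_nth)
  have gu: "g (us ! i) = i" if "i < n" for i
    unfolding g_def using bij that by (intro the_inv_into_f_f) (auto simp: bij_betw_def)
  have ug: "g x < n" "us ! g x = x" if "x \<in> verts Y" for x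
    using that us gu by (metis in_set_conv_nth)+
  have iso: "isomorphic Z (path_graph n)"
    unfolding isomorphic_def
  proof (intro exI[of _ g] conjI ballI)
    have "bij_betw g (verts Y) {..<n}" unfolding g_def by (rule bij_betw_the_inv_into[OF bij])
    then show "bij_betw g (verts Z) (verts (path_graph n))"
      by (simp add: Z_def path_graph_def lessThan_atLeast0)
    fix x y assume "x \<in> verts Z" "y \<in> verts Z"
    then have xy: "x \<in> verts Y" "y \<in> verts Y" by (simp_all add: Z_def)
    have "{g x, g y} \<in> edges (path_graph n) \<longleftrightarrow> g y = Suc (g x) \<or> g x = Suc (g y)"
      using ug[OF xy(1)] ug[OF xy(2)] unfolding path_graph_def by (auto simp: doubleton_eq_iff)
    then show "{g x, g y} \<in> edges (path_graph n) \<longleftrightarrow> {x, y} \<in> edges Z"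
      using Zedge[of "g x" "g y"] ug[OF xy(1)] ug[OF xy(2)] by simp
    show "(g x, g y) \<in> arcs (path_graph n) \<longleftrightarrow> (x, y) \<in> arcs Z" by (simp add: Z_def path_graph_def)
  qed
  \<comment> \<open>The phase accumulated from the first vertex on. A path has no cycle, so
    conjugation by these units turns every nonzero entry into 1.\<close>
  define d where "d i = (\<Prod>k<i. herm_entry Y (us ! k) (us ! Suc k))" for i
  have ent: "herm_entry Y (us ! k) (us ! Suc k) \<in> {1, - 1, \<i>, - \<i>}" if "Suc k < n" for k
    using adj[of k "Suc k"] herm_entry_values[of Y "us ! k" "us ! Suc k"] that by auto
  have d: "d i \<in> {1, - 1, \<i>, - \<i>}" if "i < n" for i
    using that
  proof (induction i)
    case (Suc i)
    then show ?case using ent[of i] by (auto simp: d_def)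
  qed (simp add: d_def)
  have dd: "cnj (d i) * d i = 1" if "i < n" for i using d[OF that] by auto
  have edge: "herm_entry Y (us ! i) (us ! Suc i) = cnj (d i) * d (Suc i)" if "Suc i < n" for i
  proof -
    have "cnj (d i) * d (Suc i) = (cnj (d i) * d i) * herm_entry Y (us ! i) (us ! Suc i)" by (simp add: d_def)
    then show ?thesis using dd[of i] that by simp
  qed
  have switch: "herm_entry Y x y = cnj (d (g x)) * herm_entry Z x y * d (g y)"
    if "x \<in> verts Y" "y \<in> verts Y" for x y
  proof -
    define i j where "i = g x" and "j = g y"
    have ij: "i < n" "j < n" "x = us ! i" "y = us ! j" using ug that by (simp_all add: i_def j_def)
    have "herm_entry Y (us ! i) (us ! j) = cnj (d i) * herm_entry Z (us ! i) (us ! j) * d j"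
    proof (cases "j = Suc i \<or> i = Suc j")
      case True
      then show ?thesis
      proof
        assume "j = Suc i"
        then show ?thesis using edge[of i] Zent[of i j] ij by simp
      next
        assume *: "i = Suc j"
        have "herm_entry Y (us ! i) (us ! j) = cnj (herm_entry Y (us ! j) (us ! i))" by (rule herm_entry_cnj[OF Y1])
        then show ?thesis using edge[of j] Zent[of i j] ij * by simp
      qed
    next
      case False
      then show ?thesis using adj[of i j] Zent[of i j] ij by simp
    qed
    then show ?thesis using ij gu by simp
  qed
  define vs where "vs = sorted_list_of_set (verts Y)"
  have card: "card (verts Y) = n" using us distinct_card by metis
  have vs: "vs ! i \<in> verts Y" if "i < n" for i
    using that fin card nth_mem[of i vs] unfolding vs_def by simp
  define D where "D = mat_diag n (\<lambda>i. d (g (vs ! i)))"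
  define D' where "D' = mat_diag n (\<lambda>i. cnj (d (g (vs ! i))))"
  have HZ: "herm_mat Z \<in> carrier_mat n n" and HY: "herm_mat Y \<in> carrier_mat n n"
    using herm_mat_carrier[of Z] herm_mat_carrier[of Y] card by (simp_all add: Z_def)
  have one: "mat_diag n f = 1\<^sub>m n" if "\<And>i. i < n \<Longrightarrow> f i = 1" for f :: "nat \<Rightarrow> complex"
    by (rule eq_matI) (use that in \<open>auto simp: mat_diag_def\<close>)
  have unit: "cnj (d (g (vs ! i))) * d (g (vs ! i)) = 1" if "i < n" for i using dd ug vs that by blast
  have "herm_mat Y = D' * herm_mat Z * D"
  proof (rule eq_matI)
    fix i j assume "i < dim_row (D' * herm_mat Z * D)" "j < dim_col (D' * herm_mat Z * D)"
    then have ij: "i < n" "j < n" by (simp_all add: D_def D'_def mat_diag_def)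
    have "(D' * herm_mat Z * D) $$ (i, j) = cnj (d (g (vs ! i))) * herm_mat Z $$ (i, j) * d (g (vs ! j))"
      unfolding D_def D'_def mat_diag_mult_left[OF HZ]
      by (subst mat_diag_mult_right[of _ n]) (use ij in auto)
    then show "herm_mat Y $$ (i, j) = (D' * herm_mat Z * D) $$ (i, j)"
      using ij switch[OF vs vs, of i j] card by (simp add: herm_mat_eq vs_def Z_def)
  qed (use HY in \<open>simp_all add: D_def D'_def mat_diag_def\<close>)
  moreover have "D' * D = 1\<^sub>m n" "D * D' = 1\<^sub>m n"
    unfolding D_def D'_def mat_diag_diag by (rule one; use unit in \<open>simp add: mult.commute\<close>)+
  ultimately have "similar_mat_wit (herm_mat Y) (herm_mat Z) D' D"
  proof -
    have "dim_row (herm_mat Y) = n" using HY by simp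
    moreover have "D \<in> carrier_mat n n" "D' \<in> carrier_mat n n" by (simp_all add: D_def D'_def)
    ultimately show ?thesis
      using HY HZ \<open>herm_mat Y = _\<close> \<open>D' * D = _\<close> \<open>D * D' = _\<close>
      unfolding similar_mat_wit_def Let_def by (simp only: insert_subset empty_subsetI simp_thms)
  qed
  moreover have "diagonal_mat D" unfolding diagonal_mat_def D_def mat_diag_def by simp
  moreover have "set (diag_mat D) \<subseteq> {1, - 1, \<i>, - \<i>}"
  proof -
    have "set (diag_mat D) = (\<lambda>i. d (g (vs ! i))) ` {..<n}" by (auto simp: diag_mat_def D_def mat_diag_def)
    also have "\<dots> \<subseteq> {1, - 1, \<i>, - \<i>}"
      by (rule image_subsetI) (use d ug vs in blast)
    finally show ?thesis .
  qed
  ultimately have "switching_equivalent Y Z" unfolding switching_equivalent_def by (auto simp: Z_def)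
  then show "\<exists>Z. mixed_graph Z \<and> isomorphic Z (path_graph n) \<and> switching_equivalent Y Z"
    using Z iso by blast
qed

text \<open>In \<open>D H(X) = H(Y) D\<close> the entries of \<open>D\<close> on the diagonal are
  units, so zeros stay in place.\<close>

lemma switching_equivalent_support:
  assumes "switching_equivalent X Y" "finite (verts X)" "x \<in> verts X" "y \<in> verts X"
  shows "herm_entry X x y \<noteq> 0 \<longleftrightarrow> herm_entry Y x y \<noteq> 0"
proof -
  let ?n = "card (verts X)" let ?vs = "sorted_list_of_set (verts X)"
  obtain D D' where v: "verts X = verts Y" and D: "diagonal_mat D" "set (diag_mat D) \<subseteq> {1, - 1, \<i>, - \<i>}"
    and w: "similar_mat_wit (herm_mat X) (herm_mat Y) D' D"
    using assms(1) unfolding switching_equivalent_def by blast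
  have carr: "herm_mat X \<in> carrier_mat ?n ?n" "herm_mat Y \<in> carrier_mat ?n ?n"
    using herm_mat_carrier[of X] herm_mat_carrier[of Y] v by auto
  then have dim: "dim_row (herm_mat X) = ?n" by blast
  have DD: "D \<in> carrier_mat ?n ?n" "D' \<in> carrier_mat ?n ?n" "D * D' = 1\<^sub>m ?n" "herm_mat X = D' * herm_mat Y * D"
    using w unfolding similar_mat_wit_def Let_def dim by (simp_all only: insert_subset)
  have "D * herm_mat X = (D * D') * herm_mat Y * D"
    unfolding DD(4) using DD(1,2) carr(2) by (simp add: assoc_mult_mat[of _ ?n ?n _ ?n _ ?n])
  then have eq: "D * herm_mat X = herm_mat Y * D" unfolding DD(3) using carr(2) by simp
  define f where "f i = D $$ (i, i)" for i
  have Df: "D = mat_diag ?n f"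
    by (rule eq_matI) (use D(1) DD(1) in \<open>auto simp: mat_diag_def f_def diagonal_mat_def\<close>)
  have f0: "f i \<noteq> 0" if "i < ?n" for i
  proof -
    have "f i \<in> set (diag_mat D)" using that DD(1) unfolding diag_mat_def f_def by auto
    then show ?thesis using D(2) by auto
  qed
  obtain i where i: "i < ?n" "x = ?vs ! i" using assms(2,3) by (metis in_set_conv_nth length_sorted_list_of_set set_sorted_list_of_set)
  obtain j where j: "j < ?n" "y = ?vs ! j" using assms(2,4) by (metis in_set_conv_nth length_sorted_list_of_set set_sorted_list_of_set)
  have "f i * herm_mat X $$ (i, j) = herm_mat Y $$ (i, j) * f j"
    using arg_cong[OF eq, of "\<lambda>M. M $$ (i, j)"] i(1) j(1)
    unfolding Df mat_diag_mult_left[OF carr(1)] mat_diag_mult_right[OF carr(2)] by simp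
  then have "f i * herm_entry X x y = herm_entry Y x y * f j"
    using i j v by (simp add: herm_mat_eq)
  then show ?thesis using f0[OF i(1)] f0[OF j(1)] by auto
qed

text \<open>Switching and isomorphism preserve the number of neighbours, and no vertex of a path has
  three.\<close>

lemma not_DHS_path_graph:
  fixes Y :: "nat mixed_graph"
  assumes Y: "mixed_graph Y" "herm_spec Y = herm_spec (path_graph n)"
    and v: "v \<in> verts Y" "a \<in> verts Y" "b \<in> verts Y" "c \<in> verts Y" "distinct [a, b, c]"
    and e: "herm_entry Y v a \<noteq> 0" "herm_entry Y v b \<noteq> 0" "herm_entry Y v c \<noteq> 0"
  shows "\<not> DHS (path_graph n)"
proof
  assume "DHS (path_graph n)"
  then obtain Z where Z: "isomorphic Z (path_graph n)" "switching_equivalent Y Z"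
    using Y unfolding DHS_def by blast
  have fin: "finite (verts Y)" and VZ: "verts Z = verts Y"
    using Y(1) Z(2) unfolding mixed_graph_def switching_equivalent_def by auto
  obtain f where f: "bij_betw f (verts Z) (verts (path_graph n))"
    "\<And>x y. x \<in> verts Z \<Longrightarrow> y \<in> verts Z \<Longrightarrow> {f x, f y} \<in> edges (path_graph n) \<longleftrightarrow> {x, y} \<in> edges Z"
    "\<And>x y. x \<in> verts Z \<Longrightarrow> y \<in> verts Z \<Longrightarrow> (f x, f y) \<in> arcs (path_graph n) \<longleftrightarrow> (x, y) \<in> arcs Z"
    using Z(1) unfolding isomorphic_def by blast
  have near: "f y = Suc (f v) \<or> f v = Suc (f y)" if y: "y \<in> verts Y" "herm_entry Y v y \<noteq> 0" for y
  proof -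
    have "herm_entry Z v y \<noteq> 0" using switching_equivalent_support[OF Z(2) fin v(1) y(1)] y(2) by simp
    moreover have "(v, y) \<notin> arcs Z" "(y, v) \<notin> arcs Z"
      using f(3)[of v y] f(3)[of y v] v(1) y(1) VZ by (simp_all add: path_graph_def)
    ultimately have "{v, y} \<in> edges Z" unfolding herm_entry_def by (simp split: if_splits)
    then have "{f v, f y} \<in> edges (path_graph n)" using f(2)[of v y] v(1) y(1) VZ by simp
    then show ?thesis unfolding path_graph_def by (auto simp: doubleton_eq_iff)
  qed
  have "inj_on f (verts Y)" using f(1) VZ by (simp add: bij_betw_def)
  then have "f a \<noteq> f b" "f a \<noteq> f c" "f b \<noteq> f c" using v by (auto simp: inj_on_def)
  then show False using near[OF v(2) e(1)] near[OF v(3) e(2)] near[OF v(4) e(3)] by linarith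
qed

section \<open>The cospectral mates\<close>

definition graph_of_lists :: "nat \<Rightarrow> (nat \<times> nat) list \<Rightarrow> (nat \<times> nat) list \<Rightarrow> nat mixed_graph" where
  "graph_of_lists n es as = \<lparr>verts = {0..<n}, edges = (\<lambda>(x, y). {x, y}) ` set es, arcs = set as\<rparr>"

definition list_entry :: "(nat \<times> nat) list \<Rightarrow> (nat \<times> nat) list \<Rightarrow> nat \<Rightarrow> nat \<Rightarrow> complex" where
  "list_entry es as x y =
     (if (x, y) \<in> set es \<or> (y, x) \<in> set es then 1
      else if (x, y) \<in> set as then \<i> else if (y, x) \<in> set as then - \<i> else 0)"

lemma edges_graph_of_lists: "{x, y} \<in> edges (graph_of_lists n es as) \<longleftrightarrow> (x, y) \<in> set es \<or> (y, x) \<in> set es"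
  unfolding graph_of_lists_def by (auto simp: doubleton_eq_iff image_iff)

lemma herm_entry_graph_of_lists: "herm_entry (graph_of_lists n es as) x y = list_entry es as x y"
  unfolding herm_entry_def list_entry_def edges_graph_of_lists by (simp add: graph_of_lists_def)

lemma mixed_graph_graph_of_lists:
  assumes "\<forall>(x, y)\<in>set es. x < n \<and> y < n \<and> x \<noteq> y"
    and "\<forall>(x, y)\<in>set as. x < n \<and> y < n \<and> x \<noteq> y \<and> (y, x) \<notin> set as \<and> (x, y) \<notin> set es \<and> (y, x) \<notin> set es"
  shows "mixed_graph (graph_of_lists n es as)"
proof -
  have "\<forall>(x, y)\<in>set as. {x, y} \<notin> edges (graph_of_lists n es as)"
    using assms(2) unfolding edges_graph_of_lists by auto
  then show ?thesis using assms unfolding mixed_graph_def by (fastforce simp: graph_of_lists_def)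
qed

lemma herm_mat_graph_of_lists:
  "herm_mat (graph_of_lists n es as) = mat n n (\<lambda>(i, j). list_entry es as i j)"
proof -
  have "verts (graph_of_lists n es as) = {0..<n}" by (simp add: graph_of_lists_def)
  then show ?thesis by (intro eq_matI) (simp_all add: herm_mat_eq herm_entry_graph_of_lists)
qed

definition list_eigenvalue :: "nat \<Rightarrow> (nat \<times> nat) list \<Rightarrow> (nat \<times> nat) list \<Rightarrow> complex \<Rightarrow> bool" where
  "list_eigenvalue n es as c \<longleftrightarrow> (\<exists>xs. (\<exists>i<n. xs ! i \<noteq> 0) \<and>
     (\<forall>i<n. (\<Sum>j<n. list_entry es as i j * xs ! j) = c * xs ! i))"

lemma list_eigenvalueI:
  assumes "i < n" "xs ! i \<noteq> 0" "\<forall>i<n. (\<Sum>j<n. list_entry es as i j * xs ! j) = c * xs ! i"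
  shows "list_eigenvalue n es as c"
  using assms unfolding list_eigenvalue_def by blast

lemma herm_spec_graph_of_lists:
  assumes "\<And>k. k < n \<Longrightarrow> list_eigenvalue n es as (of_real (path_eigenvalue n k))"
  shows "herm_spec (graph_of_lists n es as) = herm_spec (path_graph n)"
  unfolding herm_spec_path_graph
proof (rule herm_spec_distinct[OF _ inj_on_path_eigenvalue_complex])
  show "card (verts (graph_of_lists n es as)) = n" by (simp add: graph_of_lists_def)
  show "eigenvalue (herm_mat (graph_of_lists n es as)) (of_real (path_eigenvalue n k))" if "k < n" for k
    using assms[OF that] unfolding herm_mat_graph_of_lists eigenvalue_mat_iff list_eigenvalue_def prod.case by blast
qed

text \<open>This is \<open>U_k (c / 2)\<close>, whose zeros for \<open>k = n\<close> are the
  eigenvalues of the path.\<close>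

fun chebyshev_value :: "real \<Rightarrow> nat \<Rightarrow> real" where
  "chebyshev_value c 0 = 1"
| "chebyshev_value c (Suc 0) = c"
| "chebyshev_value c (Suc (Suc k)) = c * chebyshev_value c (Suc k) - chebyshev_value c k"

lemma chebyshev_value_sin: "sin t * chebyshev_value (2 * cos t) k = sin (real (Suc k) * t)"
proof (induction "2 * cos t" k rule: chebyshev_value.induct)
  case 2
  show ?case using sin_recurrence[of t 0] by (simp add: mult_ac)
next
  case (3 k)
  have "sin t * chebyshev_value (2 * cos t) (Suc (Suc k)) =
      2 * cos t * (sin t * chebyshev_value (2 * cos t) (Suc k)) - sin t * chebyshev_value (2 * cos t) k"
    by (simp add: algebra_simps)
  then show ?case unfolding 3 by (simp only: sin_recurrence)
qed simp

lemma chebyshev_value_path_eigenvalue: assumes "k < n" shows "chebyshev_value (path_eigenvalue n k) n = 0"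
proof -
  let ?t = "real (Suc k) * (pi / Suc n)"
  show ?thesis using sin_path_angle[OF assms] using chebyshev_value_sin[of ?t n] unfolding path_eigenvalue_def by simp
qed

lemma chebyshev_value_8: "chebyshev_value c 8 = (c\<^sup>2 - 1) * (c^6 - 6 * c^4 + 9 * c^2 - 1)"
  by (simp add: eval_nat_numeral algebra_simps)

lemma chebyshev_value_14:
  "chebyshev_value c 14 = (c\<^sup>2 - 1) * (c^4 - 3 * c^2 + 1) * (c^8 - 9 * c^6 + 26 * c^4 - 24 * c^2 + 1)"
  by (simp add: eval_nat_numeral algebra_simps)

text \<open>
  Two consecutive arcs give a 4-cycle the weight \<open>i * i = -1\<close>. The characteristic polynomials of the
  components are the factors in \<open>chebyshev_value_8\<close> and \<open>chebyshev_value_14\<close>.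
\<close>

definition mate8 :: "nat mixed_graph" where
  "mate8 = graph_of_lists 8 [(0,1), (1,2), (0,4), (1,5), (6,7)] [(2,3), (3,0)]"

definition mate14 :: "nat mixed_graph" where
  "mate14 = graph_of_lists 14 [(0,1), (1,2), (1,5), (2,6), (4,7), (8,9), (10,11), (11,12), (12,13)]
     [(2,3), (3,0), (5,4), (4,0)]"

lemma mate8_eigenvalue:
  assumes "c * c = 1 \<or> c^6 - 6 * c^4 + 9 * c^2 - 1 = 0"
  shows "list_eigenvalue 8 [(0,1), (1,2), (0,4), (1,5), (6,7)] [(2,3), (3,0)] c"
  using assms
proof
  assume c: "c * c = 1"
  show ?thesis
    by (rule list_eigenvalueI[of 6 _ "[0, 0, 0, 0, 0, 0, 1, c]"])
      (use c in \<open>simp_all add: eval_nat_numeral All_less_Suc2 list_entry_def\<close>)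
next
  assume c: "c^6 - 6 * c^4 + 9 * c^2 - 1 = 0"
  show ?thesis
    \<comment> \<open>The entry at vertex 3 is scaled to the imaginary unit. The equations at 0, 1,
      2, 3 and 4 determine the rest of the component, and the one at the leaf 5 is the assumed
      polynomial.\<close>
    by (rule list_eigenvalueI[of 3 _ "[c * (c^2 - 2), c^4 - 3 * c^2 + 1, c * (c^2 - 3), \<i>, c^2 - 2,
          c * (c^4 - 3 * c^2 + 1) - c * (c^2 - 2) - c * (c^2 - 3), 0, 0]"])
      (use c in \<open>simp_all add: eval_nat_numeral All_less_Suc2 list_entry_def algebra_simps\<close>)
qed

lemma herm_spec_mate8: "herm_spec mate8 = herm_spec (path_graph 8)"
  unfolding mate8_def
proof (rule herm_spec_graph_of_lists[OF mate8_eigenvalue])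
  fix k :: nat assume "k < 8"
  let ?r = "path_eigenvalue 8 k" let ?c = "complex_of_real ?r"
  have "?r\<^sup>2 - 1 = 0 \<or> ?r^6 - 6 * ?r^4 + 9 * ?r^2 - 1 = 0"
    using chebyshev_value_path_eigenvalue[OF \<open>k < 8\<close>] unfolding chebyshev_value_8 by simp
  then have "complex_of_real (?r\<^sup>2 - 1) = 0 \<or> complex_of_real (?r^6 - 6 * ?r^4 + 9 * ?r^2 - 1) = 0"
    by (simp only: of_real_eq_0_iff)
  then show "?c * ?c = 1 \<or> ?c^6 - 6 * ?c^4 + 9 * ?c^2 - 1 = 0" by (simp add: power2_eq_square)
qed

lemma mate14_eigenvalue:
  assumes "c * c = 1 \<or> c^4 - 3 * c^2 + 1 = 0 \<or> c^8 - 9 * c^6 + 26 * c^4 - 24 * c^2 + 1 = 0"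
  shows "list_eigenvalue 14 [(0,1), (1,2), (1,5), (2,6), (4,7), (8,9), (10,11), (11,12), (12,13)]
     [(2,3), (3,0), (5,4), (4,0)] c"
  using assms
proof (elim disjE)
  assume c: "c * c = 1"
  show ?thesis
    by (rule list_eigenvalueI[of 8 _ "[0, 0, 0, 0, 0, 0, 0, 0, 1, c, 0, 0, 0, 0]"])
      (use c in \<open>simp_all add: eval_nat_numeral All_less_Suc2 list_entry_def\<close>)
next
  assume c: "c^4 - 3 * c^2 + 1 = 0"
  show ?thesis
    by (rule list_eigenvalueI[of 10 _ "[0, 0, 0, 0, 0, 0, 0, 0, 0, 0, 1, c, c^2 - 1, c^3 - 2 * c]"])
      (use c in \<open>simp_all add: eval_nat_numeral All_less_Suc2 list_entry_def algebra_simps\<close>)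
next
  assume c: "c^8 - 9 * c^6 + 26 * c^4 - 24 * c^2 + 1 = 0"
  show ?thesis
    \<comment> \<open>The entry at the leaf 7 is scaled to minus the imaginary unit. The equations
      at 0 and 2 to 7 hold identically in \<open>c\<close>, and the one at vertex 1 is the assumed
      polynomial.\<close>
    by (rule list_eigenvalueI[of 7 _ "[c^6 - 6 * c^4 + 8 * c^2, c^7 - 6 * c^5 + 9 * c^3 - 2 * c,
          c^6 - 5 * c^4 + 5 * c^2, \<i> * (3 * c - c^3), - \<i> * c, c^6 - 6 * c^4 + 9 * c^2 - 1,
          c^5 - 5 * c^3 + 5 * c, - \<i>, 0, 0, 0, 0, 0, 0]"])
      (use c in \<open>simp_all add: eval_nat_numeral All_less_Suc2 list_entry_def algebra_simps\<close>)
qed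

lemma herm_spec_mate14: "herm_spec mate14 = herm_spec (path_graph 14)"
  unfolding mate14_def
proof (rule herm_spec_graph_of_lists[OF mate14_eigenvalue])
  fix k :: nat assume "k < 14"
  let ?r = "path_eigenvalue 14 k" let ?c = "complex_of_real ?r"
  have "?r\<^sup>2 - 1 = 0 \<or> ?r^4 - 3 * ?r^2 + 1 = 0 \<or> ?r^8 - 9 * ?r^6 + 26 * ?r^4 - 24 * ?r^2 + 1 = 0"
    using chebyshev_value_path_eigenvalue[OF \<open>k < 14\<close>] unfolding chebyshev_value_14 by simp
  then have "complex_of_real (?r\<^sup>2 - 1) = 0 \<or> complex_of_real (?r^4 - 3 * ?r^2 + 1) = 0 \<or>
      complex_of_real (?r^8 - 9 * ?r^6 + 26 * ?r^4 - 24 * ?r^2 + 1) = 0"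
    by (simp only: of_real_eq_0_iff)
  then show "?c * ?c = 1 \<or> ?c^4 - 3 * ?c^2 + 1 = 0 \<or> ?c^8 - 9 * ?c^6 + 26 * ?c^4 - 24 * ?c^2 + 1 = 0"
    by (simp add: power2_eq_square)
qed

lemma mixed_graph_mates: "mixed_graph mate8" "mixed_graph mate14"
  unfolding mate8_def mate14_def by (rule mixed_graph_graph_of_lists; simp)+

theorem theorem3p15:
  fixes n :: nat
  assumes "even n" and "n > 0"
  shows "DHS (path_graph n) \<longleftrightarrow> n \<notin> {8, 14}"
proof -
  \<comment> \<open>In both mates vertex 0 is cubic, with neighbours 1, 3 and 4.\<close>
  have "\<not> DHS (path_graph 8)"
    by (rule not_DHS_path_graph[OF mixed_graph_mates(1) herm_spec_mate8, of 0 1 3 4])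
      (simp_all add: mate8_def herm_entry_graph_of_lists list_entry_def, simp_all add: graph_of_lists_def)
  moreover have "\<not> DHS (path_graph 14)"
    by (rule not_DHS_path_graph[OF mixed_graph_mates(2) herm_spec_mate14, of 0 1 3 4])
      (simp_all add: mate14_def herm_entry_graph_of_lists list_entry_def, simp_all add: graph_of_lists_def)
  ultimately show ?thesis using DHS_path_graph[OF assms] by auto
qed

end
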